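(* Let $0\le\delta<\rho\le1$, $\mu\in\mathbb{R}$, and let $\sigma_\hbar\in S^\mu_{\rho,\delta}(\hbar\mathbb{Z}^n\times\mathbb{T}^n)$. Then there exists a symbol $\sigma_\hbar^*\in S^\mu_{\rho,\delta}(\hbar\mathbb{Z}^n\times\mathbb{T}^n)$ such that the adjoint operator $\mathrm{Op}_\hbar(\sigma_\hbar)^*$ is the pseudo-differential operator with symbol $\sigma_\hbar^*$, i.e. $\mathrm{Op}_\hbar(\sigma_\hbar)^*=\mathrm{Op}_\hbar(\sigma_\hbar^* )$. Moreover, one has the asymptotic expansion $$\sigma_\hbar^*(k,\theta)\sim\sum_\alpha\frac1{\alpha!}\Delta^\alpha_{\hbar,k}D^{(\alpha)}_{\hbar,\theta}\overline{\sigma_\hbar(k,\theta)}.$$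
   Context: Fix $n\ge1$ and $\hbar\in(0,1]$. $\hbar\mathbb{Z}^n=\{\hbar\bar k:\bar k\in\mathbb{Z}^n\}\subset\mathbb{R}^n$, $|k|$ is the Euclidean norm, $\mathbb{T}^n=\mathbb{R}^n/\mathbb{Z}^n$ with normalized Haar measure, $k\cdot\theta=\sum_jk_j\theta_j$, $\mathbb{N}_0=\{0,1,2,\dots\}$. Semi-classical Fourier transform: $\widehat f(\theta)=\sum_{k\in\hbar\mathbb{Z}^n}e^{-2\pi\frac{i}{\hbar}k\cdot\theta}f(k)$. $\mathcal{S}(\hbar\mathbb{Z}^n)$ is the space of $\varphi:\hbar\mathbb{Z}^n\to\mathbb{C}$ with $\sup_k(1+|k|)^N|\varphi(k)|<\infty$ for all $N$. Difference operators: with $v_j$ the $j$-th standard unit vector, $\Delta_{\hbar,j}g(k)=\frac{g(k+\hbar v_j)-g(k)}{\hbar}$ and $\Delta_\hbar^\alpha=\Delta_{\hbar,1}^{\alpha_1}\cdots\Delta_{\hbar,n}^{\alpha_n}$ (written $\Delta^\alpha_{\hbar,k}$ when acting in $k$). Toroidal operators: $D_{\hbar,\theta}^{(\beta)}=\hbar^{|\beta|}\prod_{j=1}^n\prod_{\ell=0}^{\beta_j-1}\big(\frac{1}{2\pi i}\frac{\partial}{\partial\theta_j}-\ell\big)$; in the expansion $D^{(\alpha)}_{\hbar,\theta}$ is applied to the function $\theta\mapsto\overline{\sigma_\hbar(k,\theta)}$. Symbol class: $\sigma_\hbar:\hbar\mathbb{Z}^n\times\mathbb{T}^n\to\mathbb{C}$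 belongs to $S^\mu_{\rho,\delta}(\hbar\mathbb{Z}^n\times\mathbb{T}^n)$ if $\sigma_\hbar(k,\cdot)\in C^\infty(\mathbb{T}^n)$ for all $k$ and for all $\alpha,\beta\in\mathbb{N}_0^n$ there is $C_{\alpha,\beta}>0$ with $|D^{(\beta)}_{\hbar,\theta}\Delta^\alpha_{\hbar,k}\sigma_\hbar(k,\theta)|\le C_{\alpha,\beta}(1+|k|)^{\mu-\rho|\alpha|+\delta|\beta|}$ for all $(k,\theta)$. Quantization: $\mathrm{Op}_\hbar(\sigma_\hbar)f(k)=\int_{\mathbb{T}^n}e^{2\pi\frac{i}{\hbar}k\cdot\theta}\sigma_\hbar(k,\theta)\widehat f(\theta)\,d\theta$. The adjoint is taken with respect to $(f,g)_{\ell^2(\hbar\mathbb{Z}^n)}=\sum_kf(k)\overline{g(k)}$: $(\mathrm{Op}_\hbar(\sigma_\hbar)f,g)_{\ell^2}=(f,\mathrm{Op}_\hbar(\sigma_\hbar)^*g)_{\ell^2}$ for $f,g\in\mathcal{S}(\hbar\mathbb{Z}^n)$. The asymptotic expansion means: for every $N\in\mathbb{N}$, $\sigma^*_\hbar-\sum_{|\alpha|<N}\frac1{\alpha!}\Delta^\alpha_{\hbar,k}D^{(\alpha)}_{\hbar,\theta}\overline{\sigma_\hbar}\in S^{\mu-N(\rho-\delta)}_{\rho,\delta}(\hbar\mathbb{Z}^n\times\mathbb{T}^n)$. *)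

theory Defs
  imports "HOL-Analysis.Analysis"
begin

text \<open>
  Vectors of dimension \<open>n\<close> have type \<open>real ^ 'n\<close>; the linear order on \<open>'n\<close> plays the role of the
  order of the coordinates \<open>1, \<dots>, n\<close> in the products of operators below. Multi-indices have
  type \<open>'n \<Rightarrow> nat\<close>. Functions on \<open>h\<int>\<^sup>n\<close> are represented by functions on \<open>real ^ 'n\<close> of which only
  the values on \<open>hlattice h\<close> are ever used, and functions on the torus by \<open>\<int>\<^sup>n\<close>-periodic
  functions on \<open>real ^ 'n\<close>.
\<close>

definition int_lattice :: "(real ^ 'n) set" where
  "int_lattice = {z. \<forall>j. z $ j \<in> \<int>}"

definition hlattice :: "real \<Rightarrow> (real ^ 'n) set" where
  "hlattice h = (\<lambda>z. h *\<^sub>R z) ` int_lattice"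

definition mabs :: "('n::finite \<Rightarrow> nat) \<Rightarrow> nat" where
  "mabs \<alpha> = (\<Sum>j\<in>UNIV. \<alpha> j)"

definition mfact :: "('n::finite \<Rightarrow> nat) \<Rightarrow> nat" where
  "mfact \<alpha> = (\<Prod>j\<in>UNIV. fact (\<alpha> j))"

definition schwartz :: "real \<Rightarrow> (real ^ 'n \<Rightarrow> complex) set" where
  "schwartz h = {\<phi>. \<forall>N::nat. bdd_above ((\<lambda>k. (1 + norm k) ^ N * norm (\<phi> k)) ` hlattice h)}"

definition hdiff :: "real \<Rightarrow> 'n \<Rightarrow> (real ^ 'n \<Rightarrow> complex) \<Rightarrow> real ^ 'n \<Rightarrow> complex" where
  "hdiff h j g = (\<lambda>k. (g (k + h *\<^sub>R axis j 1) - g k) / of_real h)"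

definition hDelta ::
  "real \<Rightarrow> ('n::{finite,linorder} \<Rightarrow> nat) \<Rightarrow> (real ^ 'n::_ \<Rightarrow> complex) \<Rightarrow> real ^ 'n::_ \<Rightarrow> complex" where
  "hDelta h \<alpha> g = foldr (\<lambda>j. hdiff h j ^^ \<alpha> j) (sorted_list_of_set UNIV) g"

definition partial_deriv :: "'n \<Rightarrow> (real ^ 'n \<Rightarrow> complex) \<Rightarrow> real ^ 'n \<Rightarrow> complex" where
  "partial_deriv j f = (\<lambda>x. vector_derivative (\<lambda>t. f (x + t *\<^sub>R axis j 1)) (at 0))"

text \<open>All iterated partial derivatives up to order \<open>m\<close> exist and are continuous.\<close>

primrec Ck :: "nat \<Rightarrow> (real ^ 'n \<Rightarrow> complex) \<Rightarrow> bool" where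
  "Ck 0 f \<longleftrightarrow> continuous_on UNIV f"
| "Ck (Suc m) f \<longleftrightarrow> continuous_on UNIV f \<and>
     (\<forall>j. (\<forall>x. (\<lambda>t. f (x + t *\<^sub>R axis j 1)) differentiable (at (0::real))) \<and>
          Ck m (partial_deriv j f))"

definition smooth_torus :: "(real ^ 'n \<Rightarrow> complex) \<Rightarrow> bool" where
  "smooth_torus f \<longleftrightarrow> (\<forall>\<theta>. \<forall>z\<in>int_lattice. f (\<theta> + z) = f \<theta>) \<and> (\<forall>m. Ck m f)"

definition torus_factor ::
  "'n \<Rightarrow> nat \<Rightarrow> (real ^ 'n \<Rightarrow> complex) \<Rightarrow> real ^ 'n \<Rightarrow> complex" where
  "torus_factor j l f = (\<lambda>\<theta>. 1 / (2 * of_real pi * \<i>) * partial_deriv j f \<theta> - of_nat l * f \<theta>)"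

definition torus_D ::
  "real \<Rightarrow> ('n::{finite,linorder} \<Rightarrow> nat) \<Rightarrow> (real ^ 'n::_ \<Rightarrow> complex) \<Rightarrow> real ^ 'n::_ \<Rightarrow> complex" where
  "torus_D h \<beta> f = (\<lambda>\<theta>. of_real (h ^ mabs \<beta>) *
     foldr (\<lambda>j. foldr (torus_factor j) [0..<\<beta> j]) (sorted_list_of_set UNIV) f \<theta>)"

definition symbol_class ::
  "real \<Rightarrow> real \<Rightarrow> real \<Rightarrow> real \<Rightarrow> (real ^ 'n::{finite,linorder} \<Rightarrow> real ^ 'n::_ \<Rightarrow> complex) set" where
  "symbol_class h \<mu> \<rho> \<delta> = {\<sigma>.
     (\<forall>k\<in>hlattice h. smooth_torus (\<sigma> k)) \<and>
     (\<forall>\<alpha> \<beta>. \<exists>C>0. \<forall>k\<in>hlattice h. \<forall>\<theta>.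
        norm (torus_D h \<beta> (\<lambda>\<theta>'. hDelta h \<alpha> (\<lambda>k'. \<sigma> k' \<theta>') k) \<theta>)
          \<le> C * (1 + norm k) powr (\<mu> - \<rho> * real (mabs \<alpha>) + \<delta> * real (mabs \<beta>)))}"

definition hfourier :: "real \<Rightarrow> (real ^ 'n \<Rightarrow> complex) \<Rightarrow> real ^ 'n \<Rightarrow> complex" where
  "hfourier h f \<theta> =
     (\<Sum>\<^sub>\<infinity>k\<in>hlattice h. exp (- 2 * of_real pi * (\<i> / of_real h) * of_real (k \<bullet> \<theta>)) * f k)"

text \<open>Haar measure on the torus is Lebesgue measure on the unit cube.\<close>

definition hOp ::
  "real \<Rightarrow> (real ^ 'n \<Rightarrow> real ^ 'n \<Rightarrow> complex) \<Rightarrow> (real ^ 'n \<Rightarrow> complex) \<Rightarrow> real ^ 'n \<Rightarrow> complex" where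
  "hOp h \<sigma> f k = (LINT \<theta>:cbox 0 1|lborel.
     exp (2 * of_real pi * (\<i> / of_real h) * of_real (k \<bullet> \<theta>)) * \<sigma> k \<theta> * hfourier h f \<theta>)"

definition hinner :: "real \<Rightarrow> (real ^ 'n \<Rightarrow> complex) \<Rightarrow> (real ^ 'n \<Rightarrow> complex) \<Rightarrow> complex" where
  "hinner h f g = (\<Sum>\<^sub>\<infinity>k\<in>hlattice h. f k * cnj (g k))"

text \<open>
  \<open>B\<close> is the adjoint of \<open>A\<close> on the Schwartz space. Summability is required explicitly since
  \<open>infsum\<close> of a non-summable family is \<open>0\<close>. By \<open>is_adjoint_unique\<close> below, the adjoint is unique.
\<close>

definition is_adjoint ::
  "real \<Rightarrow> ((real ^ 'n \<Rightarrow> complex) \<Rightarrow> real ^ 'n \<Rightarrow> complex) \<Rightarrow>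
   ((real ^ 'n \<Rightarrow> complex) \<Rightarrow> real ^ 'n \<Rightarrow> complex) \<Rightarrow> bool" where
  "is_adjoint h A B \<longleftrightarrow> (\<forall>f\<in>schwartz h. \<forall>g\<in>schwartz h.
     (\<lambda>k. A f k * cnj (g k)) summable_on hlattice h \<and>
     (\<lambda>k. f k * cnj (B g k)) summable_on hlattice h \<and>
     hinner h (A f) g = hinner h f (B g))"

lemma is_adjoint_unique:
  fixes g :: "real ^ 'n \<Rightarrow> complex"
  assumes "is_adjoint h A B" and "is_adjoint h A B'"
    and g: "g \<in> schwartz h" and l: "l \<in> hlattice h"
  shows "B g l = B' g l"
proof -
  define d :: "real ^ 'n \<Rightarrow> complex" where "d = (\<lambda>k. if k = l then 1 else 0)"
  have d: "d \<in> schwartz h"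
    unfolding schwartz_def
  proof (intro CollectI allI)
    fix N :: nat
    show "bdd_above ((\<lambda>k. (1 + norm k) ^ N * norm (d k)) ` hlattice h)"
      by (rule bdd_aboveI[where M = "(1 + norm l) ^ N"]) (auto simp: d_def)
  qed
  have eval: "hinner h d F = cnj (F l)" for F
  proof -
    have "hinner h d F = (\<Sum>\<^sub>\<infinity>k\<in>{l}. d k * cnj (F k))"
      unfolding hinner_def by (rule infsum_cong_neutral) (use l in \<open>auto simp: d_def\<close>)
    then show ?thesis by (simp add: d_def)
  qed
  have "hinner h d (B g) = hinner h d (B' g)"
    using assms(1,2) g d unfolding is_adjoint_def by metis
  then show ?thesis by (simp add: eval)
qed

lemma finite_mabs_less: "finite {\<alpha> :: 'n::finite \<Rightarrow> nat. mabs \<alpha> < N}"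
proof (rule finite_subset)
  show "{\<alpha> :: 'n \<Rightarrow> nat. mabs \<alpha> < N} \<subseteq> Pi\<^sub>E UNIV (\<lambda>_. {..<N})"
  proof
    fix \<alpha> :: "'n \<Rightarrow> nat" assume a: "\<alpha> \<in> {\<alpha>. mabs \<alpha> < N}"
    have "\<alpha> j \<le> mabs \<alpha>" for j
      unfolding mabs_def by (rule member_le_sum) auto
    then show "\<alpha> \<in> Pi\<^sub>E UNIV (\<lambda>_. {..<N})"
      using a by (auto simp: PiE_iff intro: le_less_trans)
  qed
  show "finite (Pi\<^sub>E (UNIV :: 'n set) (\<lambda>_. {..<N}))" by (rule finite_PiE) auto
qed

end

theory Submission
  imports Defs
begin

text \<open>
  With \<open>a\<^sub>m k\<close> the Fourier coefficients of \<open>cnj (\<sigma> k)\<close>, comparison of kernels forces the adjoint symbol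
  to have the Fourier coefficients \<open>a\<^sub>m (k + h m)\<close> in \<open>\<theta>\<close>. Expanding them by Newton's forward difference
  formula in the shift \<open>h m\<close> gives the asymptotic expansion, because multiplication by the falling
  factorials of \<open>m\<close> is the action of the toroidal derivatives. The remainder is controlled by the decay of
  \<open>a\<^sub>m\<close> in \<open>m\<close> together with Peetre's inequality; it is of arbitrarily negative order once
  sufficiently many terms are split off, and the surplus terms are symbols of the correct order.
  Fourier inversion enters only through the uniqueness of the coefficients of a continuous function.
\<close>

subsection \<open>Characters and Fourier coefficients on the torus\<close>

text \<open>Write \<open>K k l\<close> for the coefficient of \<open>\<sigma> k\<close> at (l - k) /
  h; this is the kernel of \<open>hOp h \<sigma>\<close>. The adjoint kernel at (k, l) is the
  conjugate of \<open>K l k\<close>, and putting l = k + h m turns it into the conjugated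
  coefficient of index -m of \<sigma> (k + h m), which is
  \<open>acoef m (k + h *\<^sub>R m)\<close>. The obstacle is that the base point moves with the
  frequency. Decay of order M in m costs a factor (1 + |k|) to the power \<delta> M, and undoing the
  shift costs (1 + |m|) to the power |s|, where s = \<mu> - \<rho> N + \<delta> M is the order
  reached. Estimated this way, the remainder after N terms in general falls short of the order \<mu>
  - N (\<rho> - \<delta>); hence the detour through a much longer expansion. Identities between
  toroidal derivatives are verified on coefficients. Conjugation exchanges m and -m, so falling
  factorials at -m have to be rewritten through those at m before the bounds of the symbol class
  apply. Since h is fixed, all constants may depend on it.\<close>

lemma zero_in_int_lattice [simp]: "0 \<in> int_lattice"
  and int_lattice_add [simp]: "m \<in> int_lattice \<Longrightarrow> z \<in> int_lattice \<Longrightarrow> m + z \<in> int_lattice"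
  and int_lattice_diff [simp]: "m \<in> int_lattice \<Longrightarrow> z \<in> int_lattice \<Longrightarrow> m - z \<in> int_lattice"
  and int_lattice_uminus [simp]: "m \<in> int_lattice \<Longrightarrow> - m \<in> int_lattice"
  and axis_in_int_lattice [simp]: "axis j 1 \<in> int_lattice"
  by (auto simp: int_lattice_def axis_def)

lemma int_lattice_inner: "m \<in> int_lattice \<Longrightarrow> z \<in> int_lattice \<Longrightarrow> m \<bullet> z \<in> \<int>"
  by (auto simp: int_lattice_def inner_vec_def intro!: Ints_sum)

lemma hlattice_shift: "k \<in> hlattice h \<Longrightarrow> m \<in> int_lattice \<Longrightarrow> k + h *\<^sub>R m \<in> hlattice h"
  unfolding hlattice_def by (auto simp: image_iff scaleR_add_right[symmetric] intro: int_lattice_add)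

text \<open>Characters in the integer frequency m = k / h. \<open>exp_tchar\<close> translates the
  exponentials of \<open>hOp\<close> into them, so that the theory of Fourier series below is free
  of \<open>h\<close>.\<close>

definition tchar :: "real ^ 'n \<Rightarrow> real ^ 'n \<Rightarrow> complex" where
  "tchar m \<theta> = cis (2 * pi * (m \<bullet> \<theta>))"

lemma tchar_0 [simp]: "tchar 0 \<theta> = 1"
  and tchar_add: "tchar (m + l) \<theta> = tchar m \<theta> * tchar l \<theta>"
  and tchar_add_right: "tchar m (\<theta> + \<eta>) = tchar m \<theta> * tchar m \<eta>"
  and norm_tchar [simp]: "norm (tchar m \<theta>) = 1"
  and cnj_tchar: "cnj (tchar m \<theta>) = tchar (- m) \<theta>"
  by (simp_all add: tchar_def cis_mult cis_cnj inner_add_left inner_add_right algebra_simps)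

lemma tchar_int: "m \<in> int_lattice \<Longrightarrow> z \<in> int_lattice \<Longrightarrow> tchar m z = 1"
  unfolding tchar_def by (rule cis_multiple_2pi) (rule int_lattice_inner)

lemma continuous_on_tchar [continuous_intros]: "continuous_on S (tchar m)"
  unfolding tchar_def cis_conv_exp by (intro continuous_intros)

lemma has_vector_derivative_cis:
  "((\<lambda>t. cis (a + b * t)) has_vector_derivative (\<i> * of_real b * cis (a + b * t))) (at t within S)"
proof -
  have "((\<lambda>t. a + b * t) has_real_derivative b) (at t within S)"
    by (auto intro!: derivative_eq_intros)
  note 1 = has_vector_derivative_of_real[OF this, where 'a = complex]
  have "((\<lambda>z. exp (\<i> * z)) has_field_derivative \<i> * exp (\<i> * z)) (at z within A)" for z A
    by (auto intro!: derivative_eq_intros)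
  from field_vector_diff_chain_within[OF 1 this]
  have "((\<lambda>t. cis (a + b * t)) has_vector_derivative of_real b * (\<i> * cis (a + b * t))) (at t within S)"
    by (simp only: o_def cis_conv_exp)
  then show ?thesis by (simp only: mult.left_commute mult.assoc)
qed

lemma tchar_line:
  "tchar m (x + t *\<^sub>R axis j 1) = cis (2 * pi * (m \<bullet> x) + 2 * pi * (m $ j) * t)"
  by (simp add: tchar_def inner_add_right inner_axis algebra_simps)

lemma has_vector_derivative_tchar:
  "((\<lambda>t. tchar m (x + t *\<^sub>R axis j 1)) has_vector_derivative
     (2 * pi * \<i> * of_real (m $ j) * tchar m (x + s *\<^sub>R axis j 1))) (at s)"
  unfolding tchar_line by (rule has_vector_derivative_eq_rhs[OF has_vector_derivative_cis]) simp

section \<open>Continuous periodic functions and their Fourier coefficients\<close>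

definition torus_fun :: "(real ^ 'n \<Rightarrow> complex) \<Rightarrow> bool" where
  "torus_fun f \<longleftrightarrow> continuous_on UNIV f \<and> (\<forall>\<theta>. \<forall>z\<in>int_lattice. f (\<theta> + z) = f \<theta>)"

lemma torus_funD:
  assumes "torus_fun f"
  shows "continuous_on S f" and "z \<in> int_lattice \<Longrightarrow> f (\<theta> + z) = f \<theta>"
  using assms unfolding torus_fun_def by (auto intro: continuous_on_subset)

lemma torus_fun_add: "torus_fun f \<Longrightarrow> torus_fun g \<Longrightarrow> torus_fun (\<lambda>x. f x + g x)"
  and torus_fun_diff: "torus_fun f \<Longrightarrow> torus_fun g \<Longrightarrow> torus_fun (\<lambda>x. f x - g x)"
  and torus_fun_mult: "torus_fun f \<Longrightarrow> torus_fun g \<Longrightarrow> torus_fun (\<lambda>x. f x * g x)"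
  and torus_fun_const: "torus_fun (\<lambda>x. c)"
  and torus_fun_cnj: "torus_fun f \<Longrightarrow> torus_fun (\<lambda>x. cnj (f x))"
  unfolding torus_fun_def by (auto intro!: continuous_intros)

lemma torus_fun_tchar: "m \<in> int_lattice \<Longrightarrow> torus_fun (tchar m)"
  unfolding torus_fun_def by (auto intro!: continuous_intros simp: tchar_add_right tchar_int)

lemma torus_fun_integrable: "torus_fun f \<Longrightarrow> f integrable_on cbox a b"
  by (rule integrable_continuous) (rule torus_funD)

text \<open>A gauge integral over the unit cube; the Lebesgue integral in \<open>hOp\<close> is
  converted to it once, in \<open>hOp_eq\<close>.\<close>

definition tcoef :: "(real ^ 'n \<Rightarrow> complex) \<Rightarrow> real ^ 'n \<Rightarrow> complex" where
  "tcoef f m = integral (cbox 0 1) (\<lambda>\<theta>. f \<theta> * tchar (- m) \<theta>)"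

lemma tcoef_add: "torus_fun f \<Longrightarrow> torus_fun g \<Longrightarrow> m \<in> int_lattice \<Longrightarrow>
    tcoef (\<lambda>x. f x + g x) m = tcoef f m + tcoef g m"
  and tcoef_diff: "torus_fun f \<Longrightarrow> torus_fun g \<Longrightarrow> m \<in> int_lattice \<Longrightarrow>
    tcoef (\<lambda>x. f x - g x) m = tcoef f m - tcoef g m"
  and tcoef_cmult: "tcoef (\<lambda>x. c * f x) m = c * tcoef f m"
  unfolding tcoef_def
  by (simp_all add: ring_distribs integral_add integral_diff torus_fun_integrable torus_fun_mult
      torus_fun_tchar mult.assoc)

lemma tcoef_cnj: "tcoef (\<lambda>x. cnj (f x)) m = cnj (tcoef f (- m))"
  unfolding tcoef_def by (simp add: integral_cnj cnj_tchar)

lemma tcoef_mult_tchar: "tcoef (\<lambda>x. f x * tchar l x) m = tcoef f (m - l)"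
  unfolding tcoef_def by (simp add: mult.assoc tchar_add[symmetric])

lemma content_unit_cube: "measure lborel (cbox 0 (1 :: real ^ 'n)) = 1"
  by (simp add: content_cbox_if_cart interval_eq_empty_cart not_less)

lemma norm_tcoef_le:
  fixes f :: "real ^ 'n \<Rightarrow> complex"
  assumes "torus_fun f" "m \<in> int_lattice" "\<And>\<theta>. norm (f \<theta>) \<le> B"
  shows "norm (tcoef f m) \<le> B"
proof -
  have "norm (integral (cbox 0 1) (\<lambda>\<theta>. f \<theta> * tchar (- m) \<theta>)) \<le> B * measure lborel (cbox 0 (1 :: real ^ 'n))"
  proof (rule has_integral_bound)
    show "0 \<le> B" using assms(3)[of 0] norm_ge_zero order_trans by blast
    show "((\<lambda>\<theta>. f \<theta> * tchar (- m) \<theta>) has_integral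
        integral (cbox 0 1) (\<lambda>\<theta>. f \<theta> * tchar (- m) \<theta>)) (cbox 0 1)"
      using assms by (intro integrable_integral torus_fun_integrable torus_fun_mult torus_fun_tchar) auto
  qed (simp add: norm_mult assms)
  then show ?thesis by (simp add: tcoef_def content_unit_cube)
qed

text \<open>Translation along one axis pushes a slab of the cube out through the face where the
  coordinate is 1; periodicity moves that slab back to the opposite face.\<close>

lemma integral_cube_shift:
  fixes f :: "real ^ 'n \<Rightarrow> complex"
  assumes f: "torus_fun f" and t: "0 \<le> t" "t \<le> 1"
  shows "integral (cbox 0 1) (\<lambda>x. f (x + t *\<^sub>R axis j 1)) = integral (cbox 0 1) f"
proof -
  define e :: "real ^ 'n" where "e = axis j 1"
  have e: "e \<in> Basis" by (simp add: e_def)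
  have ei: "e $ i = (if i = j then 1 else 0)" for i by (simp add: e_def axis_def)
  have cb: "x \<in> cbox a b \<longleftrightarrow> (a $ j \<le> x $ j \<and> x $ j \<le> b $ j) \<and>
      (\<forall>i. i \<noteq> j \<longrightarrow> a $ i \<le> x $ i \<and> x $ i \<le> b $ i)" for x a b :: "real ^ 'n"
  proof -
    have "(\<forall>i. Q i) \<longleftrightarrow> Q j \<and> (\<forall>i. i \<noteq> j \<longrightarrow> Q i)" for Q :: "'n \<Rightarrow> bool"
      by metis
    then show ?thesis unfolding mem_box_cart .
  qed
  have xe: "x \<bullet> e = x $ j" for x by (simp add: e_def inner_axis)
  note int = torus_fun_integrable[OF f]
  have "integral (cbox 0 1) (\<lambda>x. f (x + t *\<^sub>R e)) = integral (cbox (t *\<^sub>R e) (1 + t *\<^sub>R e)) f"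
    using integral_shift_cbox[of "t *\<^sub>R e" "t *\<^sub>R e" "1 + t *\<^sub>R e" f] by simp
  also have "\<dots> = integral (cbox (t *\<^sub>R e) (1 + t *\<^sub>R e) \<inter> {x. x \<bullet> e \<le> 1}) f
      + integral (cbox (t *\<^sub>R e) (1 + t *\<^sub>R e) \<inter> {x. x \<bullet> e \<ge> 1}) f"
    by (rule integral_split[OF int e])
  also have "cbox (t *\<^sub>R e) (1 + t *\<^sub>R e) \<inter> {x. x \<bullet> e \<le> 1} = cbox (t *\<^sub>R e) 1"
    using t by (auto simp: cb ei xe)
  also have "cbox (t *\<^sub>R e) (1 + t *\<^sub>R e) \<inter> {x. x \<bullet> e \<ge> 1} = cbox e (1 + t *\<^sub>R e)"
    using t by (auto simp: cb ei xe)
  also have "integral (cbox e (1 + t *\<^sub>R e)) f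
      = integral (cbox (e - e) (1 + t *\<^sub>R e - e)) (\<lambda>x. f (x + e))"
    by (rule integral_shift_cbox[symmetric])
  also have "(\<lambda>x. f (x + e)) = f"
    using f by (auto simp: e_def torus_funD(2))
  also have "e - e = 0" by simp
  also have "integral (cbox (t *\<^sub>R e) 1) f + integral (cbox 0 (1 + t *\<^sub>R e - e)) f = integral (cbox 0 1) f"
  proof -
    have "cbox 0 1 \<inter> {x. x \<bullet> e \<le> t} = cbox 0 (1 + t *\<^sub>R e - e)"
      using t by (auto simp: cb ei xe)
    moreover have "cbox 0 1 \<inter> {x. x \<bullet> e \<ge> t} = cbox (t *\<^sub>R e) 1"
      using t by (auto simp: cb ei xe)
    ultimately show ?thesis
      using integral_split[OF int e, of 0 1 t] by simp
  qed
  finally show ?thesis by (simp add: e_def)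
qed

text \<open>\<open>partial_deriv\<close> differentiates along a line only at the parameter 0;
  re-basing the line at its point with parameter \<open>s\<close> gives the derivative at
  \<open>s\<close>.\<close>

lemma has_partial_deriv_line:
  assumes "\<And>x. (\<lambda>t. f (x + t *\<^sub>R axis j 1)) differentiable (at (0::real))"
  shows "((\<lambda>t. f (x + t *\<^sub>R axis j 1)) has_vector_derivative partial_deriv j f (x + s *\<^sub>R axis j 1)) (at s)"
proof -
  have "((\<lambda>t. f ((x + s *\<^sub>R axis j 1) + t *\<^sub>R axis j 1)) has_vector_derivative
      partial_deriv j f (x + s *\<^sub>R axis j 1)) (at (s - s))"
    unfolding partial_deriv_def using assms vector_derivative_works by auto
  from vector_diff_chain_at[where f = "\<lambda>t. t - s" and x = s and f' = 1, OF _ this]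
  show ?thesis
    by (simp add: o_def scaleR_diff_left has_vector_derivative_diff_const)
qed

lemma has_partial_derivI:
  assumes "\<And>x. ((\<lambda>t. f (x + t *\<^sub>R axis j 1)) has_vector_derivative g x) (at 0)"
  shows "partial_deriv j f = g" and "(\<lambda>t. f (x + t *\<^sub>R axis j 1)) differentiable (at (0::real))"
  using assms by (auto simp: partial_deriv_def vector_derivative_at intro: differentiableI_vector)

lemma torus_fun_partial_deriv:
  assumes "torus_fun f" and "continuous_on UNIV (partial_deriv j f)"
  shows "torus_fun (partial_deriv j f)"
proof -
  have "f (\<theta> + z + t *\<^sub>R axis j 1) = f (\<theta> + t *\<^sub>R axis j 1)" if "z \<in> int_lattice" for \<theta> z t
    using torus_funD(2)[OF assms(1) that, of "\<theta> + t *\<^sub>R axis j 1"] by (simp add: algebra_simps)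
  then show ?thesis
    using assms(2) unfolding torus_fun_def by (simp add: partial_deriv_def)
qed

text \<open>The integral of a translate is constant in the translation parameter, and
  differentiating it under the integral sign produces the integral of the partial derivative. This
  takes the place of iterated integration.\<close>

lemma integral_partial_deriv:
  fixes f :: "real ^ 'n \<Rightarrow> complex"
  assumes f: "torus_fun f"
    and d: "\<And>x. (\<lambda>t. f (x + t *\<^sub>R axis j 1)) differentiable (at (0::real))"
    and c: "continuous_on UNIV (partial_deriv j f)"
  shows "integral (cbox 0 1) (partial_deriv j f) = 0"
proof -
  \<comment> \<open>The derivative at 0 is taken within [0, 1] because
    \<open>integral_cube_shift\<close> covers only these shifts; it is still unique at the
    endpoint.\<close>
  have "((\<lambda>t. integral (cbox 0 1) (\<lambda>x. f (x + t *\<^sub>R axis j 1))) has_vector_derivative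
      integral (cbox 0 1) (\<lambda>x. partial_deriv j f (x + 0 *\<^sub>R axis j 1))) (at 0 within {0..1})"
  proof (rule leibniz_rule_vector_derivative)
    show "((\<lambda>t. f (y + t *\<^sub>R axis j 1)) has_vector_derivative partial_deriv j f (y + s *\<^sub>R axis j 1))
        (at s within {0..1})" for s y
      by (rule has_vector_derivative_at_within) (rule has_partial_deriv_line[OF d])
    show "(\<lambda>x. f (x + t *\<^sub>R axis j 1)) integrable_on cbox 0 1" for t
      by (intro integrable_continuous continuous_on_compose2[OF torus_funD(1)[OF f, of UNIV]] continuous_intros) auto
    show "continuous_on ({0..1} \<times> cbox 0 1) (\<lambda>(t, x). partial_deriv j f (x + t *\<^sub>R axis j 1))"
      unfolding case_prod_unfold
      by (intro continuous_on_compose2[OF c] continuous_intros) auto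
  qed auto
  moreover have "((\<lambda>t. integral (cbox 0 1) (\<lambda>x. f (x + t *\<^sub>R axis j 1))) has_vector_derivative 0)
      (at 0 within {0..1})"
    by (rule has_vector_derivative_transform[of 0 _ _ "\<lambda>_. integral (cbox 0 1) f"])
      (auto simp: integral_cube_shift[OF f])
  ultimately show ?thesis
    by (simp add: vector_derivative_unique_within[of 0 "{0..1::real}"] trivial_limit_within)
qed

text \<open>Integration by parts: the product of \<open>f\<close> with a character is periodic, so
  the integral of its partial derivative vanishes.\<close>

lemma tcoef_partial_deriv:
  fixes f :: "real ^ 'n \<Rightarrow> complex"
  assumes f: "torus_fun f"
    and d: "\<And>x. (\<lambda>t. f (x + t *\<^sub>R axis j 1)) differentiable (at (0::real))"
    and c: "continuous_on UNIV (partial_deriv j f)" and m: "m \<in> int_lattice"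
  shows "tcoef (partial_deriv j f) m = 2 * pi * \<i> * of_real (m $ j) * tcoef f m"
proof -
  let ?g = "\<lambda>x. f x * tchar (- m) x"
  let ?h = "\<lambda>x. partial_deriv j f x * tchar (- m) x - 2 * pi * \<i> * of_real (m $ j) * ?g x"
  have "((\<lambda>t. ?g (x + t *\<^sub>R axis j 1)) has_vector_derivative ?h x) (at 0)" for x
    using has_vector_derivative_mult[OF has_partial_deriv_line[OF d, of x 0]
        has_vector_derivative_tchar[of "- m" x j 0]]
    by (simp add: algebra_simps)
  note g = has_partial_derivI[OF this]
  have gc: "torus_fun ?g" using f m by (simp add: torus_fun_mult torus_fun_tchar)
  have hc: "continuous_on UNIV ?h"
    by (intro continuous_intros c torus_funD[OF f])
  have "integral (cbox 0 1) ?h = 0"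
    using integral_partial_deriv[OF gc g(2)] g(1) hc by simp
  moreover have "integral (cbox 0 1) ?h = tcoef (partial_deriv j f) m
      - 2 * pi * \<i> * of_real (m $ j) * tcoef f m"
    unfolding tcoef_def
    by (subst integral_diff)
      (auto intro!: integrable_continuous continuous_intros continuous_on_subset[OF c] torus_funD[OF f])
  ultimately show ?thesis by simp
qed

text \<open>Off the diagonal, the coefficient of \<open>partial_deriv j (tchar l)\<close> is
  computed in two ways, from the eigenvalue of \<open>tchar l\<close> and from
  \<open>tcoef_partial_deriv\<close>. The two factors differ when
  \<open>m $ j \<noteq> l $ j\<close>, so the coefficient is 0.\<close>

lemma tcoef_tchar:
  assumes "m \<in> int_lattice" "l \<in> int_lattice"
  shows "tcoef (tchar l) m = (if m = l then 1 else 0)"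
proof (cases "m = l")
  case True
  then show ?thesis by (simp add: tcoef_def content_unit_cube flip: tchar_add)
next
  case False
  then obtain j where j: "m $ j \<noteq> l $ j" by (metis vec_eq_iff)
  have "((\<lambda>t. tchar l (x + t *\<^sub>R axis j 1)) has_vector_derivative
      (2 * pi * \<i> * of_real (l $ j)) * tchar l x) (at 0)" for x
    using has_vector_derivative_tchar[of l x j 0] by simp
  note g = has_partial_derivI[OF this]
  have "tcoef (partial_deriv j (tchar l)) m = 2 * pi * \<i> * of_real (m $ j) * tcoef (tchar l) m"
    using g by (intro tcoef_partial_deriv torus_fun_tchar assms) (auto intro!: continuous_intros)
  then show ?thesis using j False by (simp add: g(1) tcoef_cmult del: of_real_mult)
qed

subsection \<open>Uniqueness of Fourier coefficients\<close>

lemma tcoef_sum: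
  assumes "finite A" "\<And>i. i \<in> A \<Longrightarrow> torus_fun (f i)" "m \<in> int_lattice"
  shows "torus_fun (\<lambda>x. \<Sum>i\<in>A. f i x)" and "tcoef (\<lambda>x. \<Sum>i\<in>A. f i x) m = (\<Sum>i\<in>A. tcoef (f i) m)"
  using assms(1,2)
proof (induction A rule: finite_induct)
  case empty
  case 1 show ?case by (simp add: torus_fun_const)
  case 2 show ?case by (simp add: tcoef_def)
next
  case (insert i A)
  case 1 show ?case using insert 1 by (auto simp: intro!: torus_fun_add)
  case 2 show ?case using insert 2 assms(3) by (simp add: tcoef_add)
qed

text \<open>The kernel of the classical uniqueness proof for Fourier coefficients. For
  \<open>\<epsilon> = 0\<close> and \<open>c\<close> inside the unit cube its maximum on the cube is
  1, attained only at \<open>c\<close>; a small positive \<open>\<epsilon>\<close> lifts only a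
  neighbourhood of that peak above 1.\<close>

definition cos_kernel :: "real \<Rightarrow> real ^ 'n \<Rightarrow> real ^ 'n \<Rightarrow> real" where
  "cos_kernel \<epsilon> c \<theta> = \<epsilon> + (\<Sum>j\<in>UNIV. cos (2 * pi * (\<theta> $ j - c $ j))) / CARD('n)"

lemma cos_kernel_tchar:
  "complex_of_real (cos_kernel \<epsilon> c \<theta>) = of_real \<epsilon> + (\<Sum>j\<in>UNIV.
     (cis (- (2 * pi * c $ j)) / (2 * CARD('n))) * tchar (axis j 1) \<theta>
     + (cis (2 * pi * c $ j) / (2 * CARD('n))) * tchar (- axis j 1) (\<theta> :: real ^ 'n))"
proof -
  have c: "complex_of_real (cos y) / CARD('n) = cis y / (2 * CARD('n)) + cis (- y) / (2 * CARD('n))" for y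
  proof -
    have "complex_of_real (cos y) = (cis y + cis (- y)) / 2" by (simp add: complex_eq_iff)
    then show ?thesis by (simp only: add_divide_distrib divide_divide_eq_left of_nat_mult of_nat_numeral)
  qed
  have "of_real (cos (2 * pi * (\<theta> $ j - c $ j))) / CARD('n)
      = (cis (- (2 * pi * c $ j)) / (2 * CARD('n))) * tchar (axis j 1) \<theta>
      + (cis (2 * pi * c $ j) / (2 * CARD('n))) * tchar (- axis j 1) \<theta>" for j
    using c[of "2 * pi * (\<theta> $ j - c $ j)"]
    by (simp add: tchar_def cis_mult inner_axis' algebra_simps)
  then show ?thesis
    by (simp add: cos_kernel_def sum_divide_distrib)
qed

text \<open>The kernel is a trigonometric polynomial with frequencies 0 and plus or minus
  \<open>axis j 1\<close>, so multiplication by it combines shifted coefficients. Vanishing of all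
  coefficients is thereby inherited by products with any power of the kernel.\<close>

lemma tcoef_cos_kernel_mult:
  fixes f :: "real ^ 'n \<Rightarrow> complex"
  assumes f: "torus_fun f" and 0: "\<And>m. m \<in> int_lattice \<Longrightarrow> tcoef f m = 0"
  shows "torus_fun (\<lambda>x. f x * of_real (cos_kernel \<epsilon> c x))"
    and "m \<in> int_lattice \<Longrightarrow> tcoef (\<lambda>x. f x * of_real (cos_kernel \<epsilon> c x)) m = 0"
proof -
  define a b where "a j = cis (- (2 * pi * c $ j)) / (2 * CARD('n))"
    and "b j = cis (2 * pi * c $ j) / (2 * CARD('n))" for j
  have eq: "(\<lambda>x. f x * of_real (cos_kernel \<epsilon> c x)) = (\<lambda>x. of_real \<epsilon> * f x + (\<Sum>j\<in>UNIV.
      a j * (f x * tchar (axis j 1) x) + b j * (f x * tchar (- axis j 1) x)))"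
    unfolding cos_kernel_tchar a_def[symmetric] b_def[symmetric]
    by (simp add: fun_eq_iff algebra_simps sum_distrib_left)
  have t: "torus_fun (\<lambda>x. a j * (f x * tchar (axis j 1) x))"
      "torus_fun (\<lambda>x. b j * (f x * tchar (- axis j 1) x))" for j
    by (intro torus_fun_mult torus_fun_const f torus_fun_tchar; simp)+
  have s: "torus_fun (\<lambda>x. \<Sum>j\<in>UNIV. a j * (f x * tchar (axis j 1) x) + b j * (f x * tchar (- axis j 1) x))"
    by (rule tcoef_sum[OF _ torus_fun_add[OF t] zero_in_int_lattice]) simp
  show "torus_fun (\<lambda>x. f x * of_real (cos_kernel \<epsilon> c x))"
    unfolding eq by (intro torus_fun_add[OF _ s] torus_fun_mult torus_fun_const f)
  show "tcoef (\<lambda>x. f x * of_real (cos_kernel \<epsilon> c x)) m = 0" if m: "m \<in> int_lattice"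
    unfolding eq using m
    by (simp add: tcoef_add torus_fun_mult torus_fun_const f s tcoef_sum(2) torus_fun_add t
        tcoef_cmult tcoef_mult_tchar 0 del: mult_minus_left)
qed

lemma cos_kernel_le:
  fixes c \<theta> :: "real ^ 'n"
  shows "\<bar>cos_kernel 0 c \<theta>\<bar> \<le> 1"
proof -
  have "\<bar>\<Sum>j\<in>UNIV. cos (2 * pi * (\<theta> $ j - c $ j))\<bar> \<le> (\<Sum>j\<in>(UNIV :: 'n set). 1)"
    by (rule order_trans[OF sum_abs sum_mono]) simp
  then show ?thesis by (simp add: cos_kernel_def abs_divide)
qed

text \<open>An average of cosines equals 1 only if each cosine does, so the coordinates differ by
  integers. For \<open>c\<close> in the open cube the differences are below 1 in modulus; for
  \<open>c\<close> on a face, the opposite face would give the value 1 as well.\<close>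

lemma cos_kernel_eq_1:
  fixes c \<theta> :: "real ^ 'n"
  assumes 1: "cos_kernel 0 c \<theta> = 1" and \<theta>: "\<theta> \<in> cbox 0 1" and c: "c \<in> box 0 1"
  shows "\<theta> = c"
proof -
  have "(\<Sum>j\<in>UNIV. 1 - cos (2 * pi * (\<theta> $ j - c $ j))) = 0"
    using 1 by (simp add: cos_kernel_def sum_subtractf)
  then have "cos (2 * pi * (\<theta> $ j - c $ j)) = 1" for j
    by (subst (asm) sum_nonneg_eq_0_iff) auto
  then have "\<exists>i::int. \<theta> $ j - c $ j = of_int i" for j
    by (simp add: cos_one_2pi_int mult.commute[of "2 * pi"] mult.assoc)
  then have *: "\<theta> $ j - c $ j \<in> \<int>" for j
    by (metis Ints_of_int)
  have "\<theta> $ j = c $ j" for j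
  proof -
    have "\<bar>\<theta> $ j - c $ j\<bar> < 1"
      using \<theta> c by (simp add: mem_box_cart) (smt (verit))
    then show ?thesis using *[of j] Ints_nonzero_abs_less1 by fastforce
  qed
  then show ?thesis by (simp add: vec_eq_iff)
qed

lemma continuous_on_cos_kernel: "continuous_on S (cos_kernel \<epsilon> c)"
  unfolding cos_kernel_def by (intro continuous_intros) simp

text \<open>If \<open>f c \<noteq> 0\<close>, the integrals of \<open>f\<close> against high powers of a trigonometric polynomial that
  exceeds \<open>1\<close> only near \<open>c\<close> are unbounded.\<close>

lemma torus_fun_eq_0_interior:
  fixes f :: "real ^ 'n \<Rightarrow> complex"
  assumes f: "torus_fun f" and 0: "\<And>m. m \<in> int_lattice \<Longrightarrow> tcoef f m = 0" and c: "c \<in> box 0 1"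
  shows "f c = 0"
proof (rule ccontr)
  assume fc: "f c \<noteq> 0"
  \<comment> \<open>This normalisation makes the value at \<open>c\<close> the positive number |f
    c|^2, so that the sign of the real part can be exploited near \<open>c\<close>.\<close>
  define g where "g = (\<lambda>x. cnj (f c) * f x)"
  have g: "torus_fun g" unfolding g_def by (intro torus_fun_mult torus_fun_const f)
  have g0: "tcoef g m = 0" if "m \<in> int_lattice" for m
    using 0 that by (simp add: g_def tcoef_cmult)
  define r where "r = (cmod (f c))\<^sup>2 / 2"
  have r: "r > 0" "Re (g c) > r"
    using fc by (auto simp: r_def g_def complex_mult_cnj mult.commute[of "cnj (f c)"] cmod_power2[symmetric])
  have Reg: "continuous_on UNIV (\<lambda>x. Re (g x))"
    by (intro continuous_intros torus_funD[OF g])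
  define U where "U = box 0 1 \<inter> {x. Re (g x) > r}"
  have U: "open U" "c \<in> U"
    unfolding U_def using c r by (auto intro!: open_Int open_Collect_less Reg continuous_intros)
  define K where "K = cbox 0 1 - U"
  have K: "compact K" unfolding K_def by (intro compact_diff compact_cbox U)
  \<comment> \<open>Compactness of the part of the cube outside \<open>U\<close> yields a uniform
    gap below the maximum 1.\<close>
  obtain \<eta> where \<eta>: "\<eta> > 0" "\<And>x. x \<in> K \<Longrightarrow> cos_kernel 0 c x \<le> 1 - \<eta>"
  proof (cases "K = {}")
    case False
    obtain x where x: "x \<in> K" "\<And>y. y \<in> K \<Longrightarrow> cos_kernel 0 c y \<le> cos_kernel 0 c x"
      using continuous_attains_sup[OF K False continuous_on_cos_kernel] by metis
    have "cos_kernel 0 c x \<noteq> 1"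
      using cos_kernel_eq_1[of c x] x(1) c U(2) by (auto simp: K_def)
    then show thesis
      using that[of "1 - cos_kernel 0 c x"] x cos_kernel_le[of c x] by auto
  qed (use that[of 1] in auto)
  \<comment> \<open>With half of the gap added, \<open>P\<close> stays within [-1, 1] on
    \<open>K\<close> but equals 1 + \<eta> / 2 at \<open>c\<close>.\<close>
  define P where "P = cos_kernel (\<eta> / 2) c"
  have Pdef: "P x = \<eta> / 2 + cos_kernel 0 c x" for x by (simp add: P_def cos_kernel_def)
  have Pc: "P c = 1 + \<eta> / 2" by (simp add: Pdef) (simp add: cos_kernel_def)
  have "continuous_on UNIV P" unfolding P_def by (rule continuous_on_cos_kernel)
  then have "open (U \<inter> {x. P x > 1 + \<eta> / 4})"
    by (intro open_Int U open_Collect_less continuous_intros)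
  moreover have "c \<in> U \<inter> {x. P x > 1 + \<eta> / 4}" using U \<eta>(1) Pc by auto
  ultimately obtain a b where ab: "c \<in> box a b" "cbox a b \<subseteq> U \<inter> {x. P x > 1 + \<eta> / 4}"
    using open_contains_cbox by meson
  have "bounded (g ` cbox 0 1)"
    by (intro compact_imp_bounded compact_continuous_image torus_funD[OF g] compact_cbox)
  then obtain B where B: "\<And>x. x \<in> cbox 0 1 \<Longrightarrow> cmod (g x) \<le> B"
    unfolding bounded_iff by blast
  have zero: "torus_fun (\<lambda>x. g x * of_real (P x) ^ N) \<and>
      (\<forall>m\<in>int_lattice. tcoef (\<lambda>x. g x * of_real (P x) ^ N) m = 0)" for N
  proof (induction N)
    case 0 then show ?case using g g0 by simp
  next
    case (Suc N)
    then show ?case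
      using tcoef_cos_kernel_mult[where f = "\<lambda>x. g x * of_real (P x) ^ N" and \<epsilon> = "\<eta> / 2" and c = c]
      by (simp add: P_def mult_ac)
  qed
  have bound: "measure lborel (cbox a b) * (r * (1 + \<eta> / 4) ^ N) \<le> B" for N
  proof -
    \<comment> \<open>Adding \<open>B\<close> makes the integrand nonnegative on the cube: where
      \<open>P\<close> exceeds 1 the real part of \<open>g\<close> is nonnegative, and elsewhere the
      power of \<open>P\<close> has modulus at most 1. The integral over the small box is then at
      most the integral over the cube, and the latter is \<open>B\<close> because the coefficient at
      0 vanishes.\<close>
    define F where "F x = Re (g x * of_real (P x) ^ N) + B" for x
    have Fc: "continuous_on UNIV F"
      unfolding F_def using zero[of N] by (intro continuous_intros torus_funD) auto
    have F0: "F x \<ge> 0" if x: "x \<in> cbox 0 1" for x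
    proof (cases "P x > 1")
      case True
      then have "x \<in> U" using \<eta>(2)[of x] \<eta>(1) x by (force simp: K_def Pdef)
      then have "Re (g x) \<ge> 0" using r by (simp add: U_def)
      then have "Re (g x * of_real (P x) ^ N) \<ge> 0"
        using True by (simp flip: of_real_power)
      then show ?thesis using order_trans[OF norm_ge_zero B[OF x]] by (simp add: F_def)
    next
      case False
      have "\<bar>P x\<bar> \<le> 1" using False cos_kernel_le[of c x] \<eta>(1) unfolding Pdef by linarith
      then have "norm (g x * of_real (P x) ^ N) \<le> B * 1"
        unfolding norm_mult norm_power norm_of_real
        by (intro mult_mono B x power_le_one) (use order_trans[OF norm_ge_zero B[OF x]] in auto)
      then show ?thesis
        using abs_Re_le_cmod[of "g x * of_real (P x) ^ N"] by (simp add: F_def)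
    qed
    have FS: "F x \<ge> r * (1 + \<eta> / 4) ^ N" if x: "x \<in> cbox a b" for x
    proof -
      have "Re (g x) \<ge> r" "P x \<ge> 1 + \<eta> / 4" "x \<in> cbox 0 1"
        using x ab(2) box_subset_cbox[of 0 "1 :: real ^ 'n"] by (auto simp: U_def)
      then have "Re (g x) * P x ^ N \<ge> r * (1 + \<eta> / 4) ^ N"
        using r \<eta>(1) by (intro mult_mono power_mono) auto
      then show ?thesis
        using order_trans[OF norm_ge_zero B[OF \<open>x \<in> cbox 0 1\<close>]] by (simp add: F_def flip: of_real_power)
    qed
    have "measure lborel (cbox a b) * (r * (1 + \<eta> / 4) ^ N) = integral (cbox a b) (\<lambda>x. r * (1 + \<eta> / 4) ^ N)"
      by simp
    also have "\<dots> \<le> integral (cbox a b) F"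
      by (intro integral_le integrable_continuous continuous_on_subset[OF Fc] FS) auto
    also have "\<dots> \<le> integral (cbox 0 1) F"
      using ab(2) box_subset_cbox[of 0 "1 :: real ^ 'n"]
      by (intro integral_subset_le integrable_continuous continuous_on_subset[OF Fc]) (auto simp: U_def F0)
    also have "integral (cbox 0 1) F = Re (integral (cbox 0 1) (\<lambda>x. g x * of_real (P x) ^ N)) + B"
    proof -
      have i: "(\<lambda>x. g x * of_real (P x) ^ N) integrable_on cbox 0 1"
        using zero[of N] by (intro torus_fun_integrable) auto
      have "((\<lambda>x. Re (g x * of_real (P x) ^ N)) has_integral Re (integral (cbox 0 1) (\<lambda>x. g x * of_real (P x) ^ N))) (cbox 0 1)"
        using has_integral_linear[OF integrable_integral[OF i] bounded_linear_Re] by (simp add: o_def)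
      from has_integral_add[OF this has_integral_const[of B]] show ?thesis
        unfolding F_def by (intro integral_unique) (simp add: content_unit_cube)
    qed
    also have "integral (cbox 0 1) (\<lambda>x. g x * of_real (P x) ^ N) = 0"
      using bspec[OF conjunct2[OF zero[of N]] zero_in_int_lattice] by (simp add: tcoef_def)
    finally show ?thesis by simp
  qed
  have "measure lborel (cbox a b) > 0"
    using ab(1) by (subst content_pos_lt_eq) (auto simp: mem_box intro: less_trans)
  then have m: "measure lborel (cbox a b) * r > 0" using r by simp
  obtain N where "B / (measure lborel (cbox a b) * r) < (1 + \<eta> / 4) ^ N"
    using real_arch_pow[of "1 + \<eta> / 4"] \<eta>(1) by auto
  then show False using bound[of N] m by (simp add: field_simps not_le)
qed

text \<open>The kernel argument reaches only interior points of the unit cube; continuity extends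
  the result to the closed cube and periodicity to the whole space.\<close>

theorem torus_fun_eqI:
  fixes f g :: "real ^ 'n \<Rightarrow> complex"
  assumes f: "torus_fun f" and g: "torus_fun g"
    and eq: "\<And>m. m \<in> int_lattice \<Longrightarrow> tcoef f m = tcoef g m"
  shows "f = g"
proof -
  define d where "d = (\<lambda>x. f x - g x)"
  have d: "torus_fun d" unfolding d_def by (rule torus_fun_diff[OF f g])
  have "tcoef d m = 0" if "m \<in> int_lattice" for m
    using that f g eq by (simp add: d_def tcoef_diff)
  note z = torus_fun_eq_0_interior[OF d this]
  have ne: "box 0 (1 :: real ^ 'n) \<noteq> {}" by (simp add: interval_eq_empty_cart not_le)
  have cube: "d x = 0" if "x \<in> cbox 0 1" for x
  proof -
    have "x \<in> closure (box 0 1)" using that closure_box[OF ne] by simp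
    then show ?thesis
      using continuous_constant_on_closure[OF torus_funD(1)[OF d] z] by blast
  qed
  have "d x = 0" for x
  proof -
    have "(\<chi> j. of_int \<lfloor>x $ j\<rfloor>) \<in> int_lattice" by (simp add: int_lattice_def)
    from torus_funD(2)[OF d this, of "\<chi> j. frac (x $ j)"]
    have "d x = d (\<chi> j. frac (x $ j))"
      by (simp add: frac_def plus_vec_def)
    then show ?thesis
      using cube[of "\<chi> j. frac (x $ j)"] by (simp add: mem_box_cart frac_lt_1 less_imp_le)
  qed
  then show ?thesis by (auto simp: d_def fun_eq_iff)
qed

subsection \<open>Rapidly convergent Fourier series\<close>

text \<open>The exponent is twice the dimension because (1 + |m|)^(2n) dominates the product of the
  squares of 1 + |m_j|, which reduces summability to dimension one.\<close>

definition lattice_decay :: "real ^ 'n \<Rightarrow> real" where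
  "lattice_decay m = inverse ((1 + norm m) ^ (2 * CARD('n)))"

lemma summable_on_Ints_inverse_square:
  "(\<lambda>x::real. inverse ((1 + \<bar>x\<bar>)\<^sup>2)) summable_on \<int>"
proof -
  have "summable (\<lambda>n. inverse (real (Suc n)) ^ 2)"
    using inverse_power_summable[of 2, where 'a = real] by (subst summable_Suc_iff) (simp add: power_inverse)
  then have "(\<lambda>n. inverse ((1 + real n)\<^sup>2)) summable_on UNIV"
    by (subst summable_on_UNIV_nonneg_real_iff) (auto simp: power_inverse add_ac)
  then have 1: "(\<lambda>x::real. inverse ((1 + \<bar>x\<bar>)\<^sup>2)) summable_on (range real)"
    and 2: "(\<lambda>x::real. inverse ((1 + \<bar>x\<bar>)\<^sup>2)) summable_on (range (\<lambda>n. - real n))"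
    by (subst summable_on_reindex; force simp: o_def inj_on_def)+
  have "(\<lambda>x::real. inverse ((1 + \<bar>x\<bar>)\<^sup>2)) summable_on (range real \<union> range (\<lambda>n. - real n))"
    by (rule summable_on_union[OF 1 2])
  moreover have "\<int> \<subseteq> range real \<union> range (\<lambda>n. - real n)"
  proof
    fix x :: real assume "x \<in> \<int>"
    then obtain i where "x = of_int i" by (auto elim: Ints_cases)
    then show "x \<in> range real \<union> range (\<lambda>n. - real n)"
      by (cases i rule: int_cases2) auto
  qed
  ultimately show ?thesis by (rule summable_on_subset)
qed

text \<open>Once a finite set of lattice points is enlarged to the full grid over the coordinates
  occurring in it, the sum of products becomes a product of one-dimensional sums over
  \<open>\<int>\<close>, each bounded by the same convergent series.\<close>

lemma summable_on_lattice_decay: "(lattice_decay :: real ^ 'n \<Rightarrow> real) summable_on int_lattice"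
proof -
  define w where "w x = inverse ((1 + \<bar>x\<bar>)\<^sup>2)" for x :: real
  define B where "B = infsum w \<int>"
  have w: "w summable_on \<int>"
    unfolding w_def by (rule summable_on_Ints_inverse_square)
  have w0: "w x \<ge> 0" for x by (simp add: w_def)
  have dw: "lattice_decay m \<le> (\<Prod>j\<in>UNIV. w (m $ j))" for m :: "real ^ 'n"
  proof -
    have "(\<Prod>j\<in>UNIV. (1 + \<bar>m $ j\<bar>)\<^sup>2) \<le> (\<Prod>j\<in>(UNIV :: 'n set). (1 + norm m)\<^sup>2)"
      by (intro prod_mono conjI power_mono add_left_mono) (auto simp: component_le_norm_cart)
    also have "\<dots> = (1 + norm m) ^ (2 * CARD('n))"
      by (simp add: power_mult)
    finally have "inverse ((1 + norm m) ^ (2 * CARD('n))) \<le> inverse (\<Prod>j\<in>UNIV. (1 + \<bar>m $ j\<bar>)\<^sup>2)"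
      by (intro le_imp_inverse_le prod_pos) (auto simp: add_pos_nonneg)
    then show ?thesis
      using prod_inversef[of "\<lambda>j. (1 + \<bar>m $ j\<bar>)\<^sup>2" UNIV]
      by (simp add: lattice_decay_def w_def o_def)
  qed
  show ?thesis
  proof (rule nonneg_bdd_above_summable_on)
    show "bdd_above (sum lattice_decay ` {F. F \<subseteq> (int_lattice :: (real ^ 'n) set) \<and> finite F})"
    proof (rule bdd_aboveI2)
      fix F assume "F \<in> {F. F \<subseteq> (int_lattice :: (real ^ 'n) set) \<and> finite F}"
      then have F: "F \<subseteq> int_lattice" "finite F" by auto
      define W where "W = (\<lambda>(m, j). m $ j) ` (F \<times> UNIV)"
      have W: "finite W" "W \<subseteq> \<int>" using F by (auto simp: W_def int_lattice_def)
      have "sum lattice_decay F \<le> (\<Sum>m\<in>F. \<Prod>j\<in>UNIV. w (m $ j))"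
        by (intro sum_mono dw)
      also have "\<dots> = (\<Sum>g\<in>vec_nth ` F. \<Prod>j\<in>UNIV. w (g j))"
        by (subst sum.reindex) (auto simp: inj_on_def vec_nth_inject)
      also have "\<dots> \<le> (\<Sum>g\<in>Pi\<^sub>E (UNIV :: 'n set) (\<lambda>_. W). \<Prod>j\<in>UNIV. w (g j))"
        by (rule sum_mono2) (auto simp: W_def w0 F intro!: finite_PiE prod_nonneg)
      also have "\<dots> = (\<Prod>j\<in>(UNIV :: 'n set). \<Sum>x\<in>W. w x)"
        by (rule prod_sum_PiE[symmetric]) (auto simp: W)
      also have "\<dots> \<le> (\<Prod>j\<in>(UNIV :: 'n set). B)"
        unfolding B_def using W w w0 by (intro prod_mono conjI sum_nonneg finite_sum_le_infsum) auto
      finally show "sum lattice_decay F \<le> (\<Prod>j\<in>(UNIV :: 'n set). B)" .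
    qed
  qed (simp add: lattice_decay_def)
qed

definition fseries :: "(real ^ 'n \<Rightarrow> complex) \<Rightarrow> real ^ 'n \<Rightarrow> complex" where
  "fseries c \<theta> = (\<Sum>\<^sub>\<infinity>m\<in>int_lattice. c m * tchar m \<theta>)"

text \<open>The Weierstrass test makes the unordered sum converge uniformly, which allows termwise
  integration. It is used both for the coefficients of a Fourier series and for the kernel of
  \<open>hOp\<close>.\<close>

lemma has_sum_integral:
  fixes F :: "'a \<Rightarrow> 'b::euclidean_space \<Rightarrow> 'c::banach"
  assumes c: "\<And>m. continuous_on (cbox a b) (F m)"
    and M: "\<And>m \<theta>. m \<in> A \<Longrightarrow> \<theta> \<in> cbox a b \<Longrightarrow> norm (F m \<theta>) \<le> M m" "M summable_on A"
  shows "((\<lambda>m. integral (cbox a b) (F m)) has_sum integral (cbox a b) (\<lambda>\<theta>. \<Sum>\<^sub>\<infinity>m\<in>A. F m \<theta>)) A"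
proof -
  have u: "uniform_limit (cbox a b) (\<lambda>X \<theta>. \<Sum>m\<in>X. F m \<theta>) (\<lambda>\<theta>. \<Sum>\<^sub>\<infinity>m\<in>A. F m \<theta>) (finite_subsets_at_top A)"
    using M by (rule Weierstrass_m_test_general)
  have cs: "continuous_on (cbox a b) (\<lambda>\<theta>. \<Sum>m\<in>X. F m \<theta>)" for X
    by (intro continuous_intros c)
  obtain I J where IJ: "\<And>X. ((\<lambda>\<theta>. \<Sum>m\<in>X. F m \<theta>) has_integral I X) (cbox a b)"
      "((\<lambda>\<theta>. \<Sum>\<^sub>\<infinity>m\<in>A. F m \<theta>) has_integral J) (cbox a b)"
      "(I \<longlongrightarrow> J) (finite_subsets_at_top A)"
    using uniform_limit_integral_cbox[OF u cs] by auto
  have "I X = (\<Sum>m\<in>X. integral (cbox a b) (F m))" if "finite X" for X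
    using that integral_unique[OF IJ(1)] integral_sum[of X F "cbox a b"] integrable_continuous[OF c] by metis
  then have "eventually (\<lambda>X. I X = (\<Sum>m\<in>X. integral (cbox a b) (F m))) (finite_subsets_at_top A)"
    by (intro eventually_finite_subsets_at_top_weakI)
  from Lim_transform_eventually[OF IJ(3) this]
  have "((\<lambda>X. \<Sum>m\<in>X. integral (cbox a b) (F m)) \<longlongrightarrow> J) (finite_subsets_at_top A)" .
  then show ?thesis
    using integral_unique[OF IJ(2)] by (simp add: has_sum_def)
qed

lemma
  fixes c :: "real ^ 'n \<Rightarrow> complex"
  assumes c: "(\<lambda>m. norm (c m)) summable_on int_lattice"
  shows torus_fun_fseries: "torus_fun (fseries c)"
    and tcoef_fseries: "l \<in> int_lattice \<Longrightarrow> tcoef (fseries c) l = c l"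
proof -
  have "uniform_limit UNIV (\<lambda>X \<theta>. \<Sum>m\<in>X. c m * tchar m \<theta>) (fseries c) (finite_subsets_at_top int_lattice)"
    unfolding fseries_def by (rule Weierstrass_m_test_general[OF _ c]) (simp add: norm_mult)
  then have "continuous_on UNIV (fseries c)"
    by (rule uniform_limit_theorem[rotated]) (auto intro!: always_eventually continuous_intros)
  moreover have "fseries c (\<theta> + z) = fseries c \<theta>" if "z \<in> int_lattice" for \<theta> z
    unfolding fseries_def using that by (intro infsum_cong) (simp add: tchar_add_right tchar_int)
  ultimately show "torus_fun (fseries c)" by (simp add: torus_fun_def)
  assume l: "l \<in> int_lattice"
  have "((\<lambda>m. integral (cbox 0 1) (\<lambda>\<theta>. c m * tchar m \<theta> * tchar (- l) \<theta>)) has_sum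
      integral (cbox 0 1) (\<lambda>\<theta>. \<Sum>\<^sub>\<infinity>m\<in>int_lattice. c m * tchar m \<theta> * tchar (- l) \<theta>)) int_lattice"
    by (rule has_sum_integral[OF _ _ c]) (auto simp: norm_mult intro!: continuous_intros)
  also have "(\<lambda>\<theta>. \<Sum>\<^sub>\<infinity>m\<in>int_lattice. c m * tchar m \<theta> * tchar (- l) \<theta>) = (\<lambda>\<theta>. fseries c \<theta> * tchar (- l) \<theta>)"
    unfolding fseries_def by (simp add: infsum_cmult_left')
  also have "integral (cbox 0 1) \<dots> = tcoef (fseries c) l" by (simp add: tcoef_def)
  also have "((\<lambda>m. integral (cbox 0 1) (\<lambda>\<theta>. c m * tchar m \<theta> * tchar (- l) \<theta>)) has_sum tcoef (fseries c) l)
      int_lattice \<longleftrightarrow> ((\<lambda>m. if m = l then c l else 0) has_sum tcoef (fseries c) l) int_lattice"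
  proof (rule has_sum_cong)
    fix m :: "real ^ 'n" assume "m \<in> int_lattice"
    then show "integral (cbox 0 1) (\<lambda>\<theta>. c m * tchar m \<theta> * tchar (- l) \<theta>) = (if m = l then c l else 0)"
      using tcoef_tchar[OF l, of m] tcoef_cmult[of "c m" "tchar m" l] by (auto simp: tcoef_def)
  qed
  finally have "((\<lambda>m. if m = l then c l else 0) has_sum tcoef (fseries c) l) int_lattice" .
  moreover have "((\<lambda>m. if m = l then c l else 0) has_sum c l) int_lattice"
    by (rule has_sum_finite_neutralI[of "{l}"]) (use l in auto)
  ultimately show "tcoef (fseries c) l = c l"
    by (rule has_sum_unique)
qed

text \<open>\<open>g\<close> and the series of its coefficients are continuous with equal
  coefficients, hence equal, and the series is bounded termwise. This is the way back from
  coefficients to the pointwise bounds of the symbol class.\<close>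

lemma norm_le_of_tcoef_bound:
  fixes g :: "real ^ 'n \<Rightarrow> complex"
  assumes g: "torus_fun g" and b: "\<And>m. m \<in> int_lattice \<Longrightarrow> norm (tcoef g m) \<le> K * lattice_decay m"
  shows "norm (g \<theta>) \<le> K * infsum lattice_decay (int_lattice :: (real ^ 'n) set)"
proof -
  have K: "(\<lambda>m::real^'n. K * lattice_decay m) summable_on int_lattice"
    by (rule summable_on_cmult_right[OF summable_on_lattice_decay])
  then have s: "(\<lambda>m. norm (tcoef g m)) summable_on int_lattice"
    by (rule summable_on_comparison_test) (simp_all add: b)
  have "g = fseries (tcoef g)"
    by (rule torus_fun_eqI[OF g torus_fun_fseries[OF s]]) (simp add: tcoef_fseries[OF s])
  then have "norm (g \<theta>) = norm (fseries (tcoef g) \<theta>)" by (rule arg_cong)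
  also have "norm (fseries (tcoef g) \<theta>) \<le> (\<Sum>\<^sub>\<infinity>m\<in>(int_lattice :: (real^'n) set). K * lattice_decay m)"
    unfolding fseries_def
  proof (rule norm_infsum_le[OF has_sum_infsum has_sum_infsum[OF K]])
    show "(\<lambda>m. tcoef g m * tchar m \<theta>) summable_on int_lattice"
      by (rule abs_summable_summable) (simp add: norm_mult s)
  qed (simp add: norm_mult b)
  finally show ?thesis by (simp add: infsum_cmult_right')
qed

definition rapid :: "(real ^ 'n \<Rightarrow> complex) \<Rightarrow> bool" where
  "rapid c \<longleftrightarrow> (\<forall>p::nat. \<exists>K. \<forall>m\<in>int_lattice. norm (c m) * (1 + norm m) ^ p \<le> K)"

lemma rapid_summable:
  fixes c :: "real ^ 'n \<Rightarrow> complex"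
  assumes "rapid c"
  shows "(\<lambda>m. norm (c m) * (1 + norm m) ^ p) summable_on int_lattice"
proof -
  \<comment> \<open>The additional 2n powers are spent on the summable weight
    \<open>lattice_decay\<close>.\<close>
  obtain K where K: "\<forall>m\<in>int_lattice. norm (c m) * (1 + norm m) ^ (p + 2 * CARD('n)) \<le> K"
    using assms unfolding rapid_def by metis
  have "norm (c m) * (1 + norm m) ^ p \<le> K * lattice_decay m" if m: "m \<in> int_lattice" for m
  proof -
    have "(1 + norm m) ^ (2 * CARD('n)) > 0" by (simp add: add_pos_nonneg)
    then show ?thesis using bspec[OF K m]
      by (simp add: lattice_decay_def power_add field_simps)
  qed
  then show ?thesis
    by (intro summable_on_comparison_test[OF summable_on_cmult_right[OF summable_on_lattice_decay]]) auto
qed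

lemma norm_cis_taylor: "norm (cis y - 1 - \<i> * of_real y) \<le> y\<^sup>2"
  using Taylor_exp[of "\<i> * of_real y" 1] by (simp add: cis_conv_exp norm_mult diff_diff_eq power2_eq_square)

lemma norm_tchar_taylor:
  "norm (tchar m (x + t *\<^sub>R axis j 1) - tchar m x - t *\<^sub>R (2 * pi * \<i> * of_real (m $ j) * tchar m x))
     \<le> t\<^sup>2 * (4 * pi\<^sup>2 * (1 + norm m)\<^sup>2)"
proof -
  let ?y = "2 * pi * (m $ j) * t"
  have "tchar m (x + t *\<^sub>R axis j 1) - tchar m x - t *\<^sub>R (2 * pi * \<i> * of_real (m $ j) * tchar m x)
      = tchar m x * (cis ?y - 1 - \<i> * of_real ?y)"
    unfolding tchar_line by (simp add: tchar_def cis_mult[symmetric] algebra_simps scaleR_conv_of_real)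
  also have "norm \<dots> \<le> 1 * ?y\<^sup>2"
    unfolding norm_mult norm_tchar using norm_cis_taylor[of ?y] by (simp only: mult_1)
  also have "\<dots> = t\<^sup>2 * (4 * pi\<^sup>2 * \<bar>m $ j\<bar>\<^sup>2)" by (simp add: power_mult_distrib)
  also have "\<dots> \<le> t\<^sup>2 * (4 * pi\<^sup>2 * (1 + norm m)\<^sup>2)"
    using component_le_norm_cart[of m j] by (intro mult_left_mono power_mono) auto
  finally show ?thesis .
qed

text \<open>The second-order Taylor error of each character is t^2 times a weight that stays
  summable against rapidly decaying coefficients. Summing these errors shows that the difference
  quotient is off by at most \<open>\<bar>t\<bar> * Q\<close>.\<close>

lemma
  fixes c :: "real ^ 'n \<Rightarrow> complex"
  assumes c: "rapid c"
  defines "c' \<equiv> \<lambda>j m. 2 * pi * \<i> * of_real (m $ j) * c m"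
  shows rapid_deriv: "rapid (c' j)"
    and has_vector_derivative_fseries:
      "((\<lambda>t. fseries c (x + t *\<^sub>R axis j 1)) has_vector_derivative fseries (c' j) x) (at 0)"
proof -
  show c': "rapid (c' j)"
    unfolding rapid_def
  proof
    fix p
    obtain K where K: "\<forall>m\<in>int_lattice. norm (c m) * (1 + norm m) ^ Suc p \<le> K"
      using c unfolding rapid_def by metis
    have "norm (c' j m) * (1 + norm m) ^ p \<le> 2 * pi * K" if m: "m \<in> int_lattice" for m
    proof -
      have "norm (c' j m) * (1 + norm m) ^ p = 2 * pi * (norm (c m) * (\<bar>m $ j\<bar> * (1 + norm m) ^ p))"
        by (simp add: c'_def norm_mult)
      also have "\<dots> \<le> 2 * pi * (norm (c m) * ((1 + norm m) * (1 + norm m) ^ p))"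
        using component_le_norm_cart[of m j] by (intro mult_left_mono mult_right_mono) auto
      also have "\<dots> \<le> 2 * pi * K" using bspec[OF K m] by simp
      finally show ?thesis .
    qed
    then show "\<exists>K. \<forall>m\<in>int_lattice. norm (c' j m) * (1 + norm m) ^ p \<le> K" by blast
  qed
  have sum: "(\<lambda>m. d m * tchar m \<theta>) summable_on int_lattice" if "rapid d" for d :: "real ^ 'n \<Rightarrow> complex" and \<theta>
    by (rule abs_summable_summable) (use rapid_summable[OF that, of 0] in \<open>simp add: norm_mult\<close>)
  have diff: "((\<lambda>m. u m - v m) has_sum (a - b)) A" if "(u has_sum a) A" "(v has_sum b) A"
    for u v :: "real ^ 'n \<Rightarrow> complex" and a b A
    using has_sum_add[OF that(1), of "\<lambda>m. - v m" "- b"] that(2) by (simp add: has_sum_uminus)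
  define Q where "Q = (\<Sum>\<^sub>\<infinity>m\<in>(int_lattice :: (real ^ 'n) set). norm (c m) * (4 * pi\<^sup>2 * (1 + norm m)\<^sup>2))"
  have Qs: "(\<lambda>m. norm (c m) * (4 * pi\<^sup>2 * (1 + norm m)\<^sup>2)) summable_on int_lattice"
    using summable_on_cmult_right[OF rapid_summable[OF c, of 2], of "4 * pi\<^sup>2"] by (simp add: mult_ac)
  have bound: "norm (fseries c (x + t *\<^sub>R axis j 1) - fseries c x - t *\<^sub>R fseries (c' j) x) \<le> t\<^sup>2 * Q" for t
  proof (rule norm_infsum_le)
    show "((\<lambda>m. c m * tchar m (x + t *\<^sub>R axis j 1) - c m * tchar m x - t *\<^sub>R (c' j m * tchar m x)) has_sum
        (fseries c (x + t *\<^sub>R axis j 1) - fseries c x - t *\<^sub>R fseries (c' j) x)) int_lattice"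
      unfolding fseries_def scaleR_conv_of_real
      by (intro diff has_sum_cmult_right has_sum_infsum sum c c')
    show "((\<lambda>m. t\<^sup>2 * (norm (c m) * (4 * pi\<^sup>2 * (1 + norm m)\<^sup>2))) has_sum t\<^sup>2 * Q) int_lattice"
      unfolding Q_def by (intro has_sum_cmult_right has_sum_infsum Qs)
    fix m :: "real ^ 'n" assume "m \<in> int_lattice"
    have "c m * tchar m (x + t *\<^sub>R axis j 1) - c m * tchar m x - t *\<^sub>R (c' j m * tchar m x)
        = c m * (tchar m (x + t *\<^sub>R axis j 1) - tchar m x - t *\<^sub>R (2 * pi * \<i> * of_real (m $ j) * tchar m x))"
      by (simp add: c'_def algebra_simps scaleR_conv_of_real)
    then show "norm (c m * tchar m (x + t *\<^sub>R axis j 1) - c m * tchar m x - t *\<^sub>R (c' j m * tchar m x))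
        \<le> t\<^sup>2 * (norm (c m) * (4 * pi\<^sup>2 * (1 + norm m)\<^sup>2))"
      using mult_left_mono[OF norm_tchar_taylor[of m x t j] norm_ge_zero[of "c m"]]
      by (simp only: norm_mult mult.left_commute)
  qed
  show "((\<lambda>t. fseries c (x + t *\<^sub>R axis j 1)) has_vector_derivative fseries (c' j) x) (at 0)"
    unfolding has_vector_derivative_def
  proof (rule has_derivativeI_sandwich[of 1])
    show "((\<lambda>t. \<bar>t\<bar> * Q) \<longlongrightarrow> 0) (at 0)"
      by (rule tendsto_eq_intros refl)+ auto
    fix t :: real assume t: "t \<noteq> 0"
    have "t\<^sup>2 * Q = \<bar>t\<bar> * Q * \<bar>t\<bar>" by (simp add: power2_eq_square)
    with bound[of t] have "norm (fseries c (x + t *\<^sub>R axis j 1) - fseries c x - t *\<^sub>R fseries (c' j) x)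
        \<le> \<bar>t\<bar> * Q * \<bar>t\<bar>" by (simp only:)
    then show "norm (fseries c (x + t *\<^sub>R axis j 1) - fseries c (x + 0 *\<^sub>R axis j 1) - (t - 0) *\<^sub>R fseries (c' j) x)
        / norm (t - 0) \<le> \<bar>t\<bar> * Q"
      using t by (simp add: divide_le_eq)
  qed (auto intro: bounded_linear_scaleR_left)
qed

subsection \<open>Smooth functions on the torus\<close>

lemma Ck_imp_continuous: "Ck m f \<Longrightarrow> continuous_on UNIV f"
  by (cases m) auto

lemma smooth_torus_iff_torus_fun: "smooth_torus f \<longleftrightarrow> torus_fun f \<and> (\<forall>m. Ck m f)"
  unfolding smooth_torus_def torus_fun_def using Ck_imp_continuous by blast

lemma smooth_torus_torus_fun: "smooth_torus f \<Longrightarrow> torus_fun f"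
  by (simp add: smooth_torus_iff_torus_fun)

lemma smooth_torus_differentiable:
  "smooth_torus f \<Longrightarrow> (\<lambda>t. f (x + t *\<^sub>R axis j 1)) differentiable (at (0::real))"
  using Ck.simps(2)[of 0 f] unfolding smooth_torus_def by blast

lemma smooth_torus_partial_deriv:
  assumes "smooth_torus f"
  shows "smooth_torus (partial_deriv j f)"
proof -
  have "Ck m (partial_deriv j f)" for m
    using assms Ck.simps(2)[of m f] unfolding smooth_torus_def by blast
  then show ?thesis
    using assms torus_fun_partial_deriv Ck.simps(1) unfolding smooth_torus_iff_torus_fun by blast
qed

lemma smooth_torus_tcoef_partial_deriv:
  assumes "smooth_torus f" "m \<in> int_lattice"
  shows "tcoef (partial_deriv j f) m = 2 * pi * \<i> * of_real (m $ j) * tcoef f m"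
  using assms smooth_torus_torus_fun[OF smooth_torus_partial_deriv[OF assms(1)]]
  by (intro tcoef_partial_deriv smooth_torus_differentiable torus_funD(1)) (auto intro: smooth_torus_torus_fun)

text \<open>Real linearity is the right generality: one induction covers sums, complex multiples and
  conjugation, the last of which is not complex linear.\<close>

lemma Ck_real_linear:
  fixes L :: "complex \<Rightarrow> complex \<Rightarrow> complex"
  assumes L: "bounded_linear (\<lambda>(u, v). L u v)"
  shows "Ck m f \<Longrightarrow> Ck m g \<Longrightarrow> Ck m (\<lambda>x. L (f x) (g x))"
proof (induction m arbitrary: f g)
  case 0
  then show ?case
    using bounded_linear.continuous_on[OF L, of UNIV "\<lambda>x. (f x, g x)"] by (auto intro: continuous_on_Pair)
next
  case (Suc m)
  have "((\<lambda>t. L (f (x + t *\<^sub>R axis j 1)) (g (x + t *\<^sub>R axis j 1))) has_vector_derivative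
      L (partial_deriv j f x) (partial_deriv j g x)) (at 0)" for x j
  proof -
    have "((\<lambda>t. f (x + t *\<^sub>R axis j 1)) has_vector_derivative partial_deriv j f x) (at 0)"
      "((\<lambda>t. g (x + t *\<^sub>R axis j 1)) has_vector_derivative partial_deriv j g x) (at 0)"
      using Suc.prems by (simp_all add: partial_deriv_def vector_derivative_works[symmetric])
    from has_vector_derivative_Pair[OF this]
    show ?thesis
      using bounded_linear.has_vector_derivative[OF L] by fastforce
  qed
  note d = has_partial_derivI[OF this]
  have "continuous_on UNIV (\<lambda>x. L (f x) (g x))"
    using bounded_linear.continuous_on[OF L, of UNIV "\<lambda>x. (f x, g x)"] Suc.prems
    by (auto intro: continuous_on_Pair)
  then show ?case
    using Suc d by auto
qed

lemma smooth_torus_add: "smooth_torus f \<Longrightarrow> smooth_torus g \<Longrightarrow> smooth_torus (\<lambda>x. f x + g x)"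
  unfolding smooth_torus_iff_torus_fun
  by (auto intro!: torus_fun_add Ck_real_linear[where L = "(+)"] bounded_linear_intros simp: case_prod_unfold)

lemma smooth_torus_cmult: "smooth_torus f \<Longrightarrow> smooth_torus (\<lambda>x. c * f x)"
proof -
  have "bounded_linear (\<lambda>(u :: complex, v :: complex). c * u)"
    unfolding case_prod_unfold by (intro bounded_linear_const_mult bounded_linear_fst)
  from Ck_real_linear[OF this] show "smooth_torus f \<Longrightarrow> smooth_torus (\<lambda>x. c * f x)"
    unfolding smooth_torus_iff_torus_fun by (auto intro!: torus_fun_mult torus_fun_const)
qed

lemma smooth_torus_cnj: "smooth_torus f \<Longrightarrow> smooth_torus (\<lambda>x. cnj (f x))"
proof -
  have "bounded_linear (\<lambda>(u, v :: complex). cnj u)"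
    unfolding case_prod_unfold by (intro bounded_linear_compose[OF bounded_linear_cnj] bounded_linear_fst)
  from Ck_real_linear[OF this] show "smooth_torus f \<Longrightarrow> smooth_torus (\<lambda>x. cnj (f x))"
    unfolding smooth_torus_iff_torus_fun by (auto intro!: torus_fun_cnj)
qed

lemma smooth_torus_diff: "smooth_torus f \<Longrightarrow> smooth_torus g \<Longrightarrow> smooth_torus (\<lambda>x. f x - g x)"
  using smooth_torus_add[OF _ smooth_torus_cmult[of g "-1"]] by simp

lemma smooth_torus_0: "smooth_torus (\<lambda>x. 0)"
proof -
  have "Ck m (\<lambda>x. 0)" for m
    by (induction m) (auto simp: partial_deriv_def)
  then show ?thesis unfolding smooth_torus_iff_torus_fun by (auto intro: torus_fun_const)
qed

lemma smooth_torus_sum: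
  "(\<And>i. i \<in> A \<Longrightarrow> smooth_torus (f i)) \<Longrightarrow> smooth_torus (\<lambda>x. \<Sum>i\<in>A. f i x)"
  by (induction A rule: infinite_finite_induct) (auto intro!: smooth_torus_0 smooth_torus_add)

text \<open>Each partial derivative is again a series with rapidly decaying coefficients, so the
  induction on the order runs with the coefficients generalised.\<close>

lemma smooth_torus_fseries:
  assumes "rapid c"
  shows "smooth_torus (fseries c)"
proof -
  have "Ck m (fseries c)" for m
    using assms
  proof (induction m arbitrary: c)
    case 0
    then show ?case
      using torus_fun_fseries[of c] rapid_summable[of c 0] by (simp add: torus_fun_def)
  next
    case (Suc m)
    then show ?case
      using torus_fun_fseries[of c] rapid_summable[of c 0] has_partial_derivI[OF has_vector_derivative_fseries[OF Suc.prems]]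
        Suc.IH[OF rapid_deriv[OF Suc.prems]]
      by (simp add: torus_fun_def)
  qed
  then show ?thesis
    using torus_fun_fseries[of c] rapid_summable[OF assms, of 0] by (simp add: smooth_torus_iff_torus_fun)
qed

subsection \<open>Multi-indices and toroidal derivatives\<close>

abbreviation incr :: "'n \<Rightarrow> ('n \<Rightarrow> nat) \<Rightarrow> 'n \<Rightarrow> nat" where
  "incr j \<alpha> \<equiv> \<alpha>(j := Suc (\<alpha> j))"

lemma prod_incr:
  fixes f :: "'n::finite \<Rightarrow> nat \<Rightarrow> 'a::comm_monoid_mult"
  shows "(\<Prod>i\<in>UNIV. f i ((\<alpha>(j := a)) i)) = f j a * (\<Prod>i\<in>UNIV - {j}. f i (\<alpha> i))"
  by (subst prod.remove[of _ j]) (auto intro!: prod.cong)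

lemma mabs_incr [simp]: "mabs (incr j \<alpha>) = Suc (mabs (\<alpha> :: 'n::finite \<Rightarrow> nat))"
  by (simp add: mabs_def sum.remove[of UNIV j])

lemma mabs_0 [simp]: "mabs (\<lambda>_. 0) = 0"
  by (simp add: mabs_def)

lemma mabs_add: "mabs (\<lambda>j. \<alpha> j + \<beta> j) = mabs \<alpha> + mabs \<beta>"
  by (simp add: mabs_def sum.distrib)

lemma mabs_eq_0_iff [simp]: "mabs \<alpha> = 0 \<longleftrightarrow> \<alpha> = (\<lambda>_. 0)"
  by (auto simp: mabs_def)

lemma mindex_induct [case_names zero incr]:
  fixes \<alpha> :: "'n::finite \<Rightarrow> nat"
  assumes "P (\<lambda>_. 0)" and "\<And>\<alpha> j. P \<alpha> \<Longrightarrow> P (incr j \<alpha>)"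
  shows "P \<alpha>"
proof (induction "mabs \<alpha>" arbitrary: \<alpha>)
  case 0
  then have "\<alpha> = (\<lambda>_. 0)" by (simp only: mabs_eq_0_iff[symmetric])
  then show ?case using assms(1) by simp
next
  case (Suc n)
  then have "\<alpha> \<noteq> (\<lambda>_. 0)" using mabs_0 by (metis nat.distinct(1))
  then obtain j where j: "\<alpha> j \<noteq> 0" by (auto simp: fun_eq_iff)
  define \<beta> where "\<beta> = \<alpha>(j := \<alpha> j - 1)"
  have \<alpha>: "\<alpha> = incr j \<beta>" using j by (auto simp: \<beta>_def)
  then have "mabs \<beta> = n" using Suc(2) by simp
  then show ?case using Suc(1)[of \<beta>] assms(2) \<alpha> by simp
qed

text \<open>Up to the factor \<open>h ^ mabs \<alpha>\<close> this is the Fourier multiplier of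
  \<open>torus_D h \<alpha>\<close>, see \<open>tcoef_torus_D\<close>.\<close>

definition ffact :: "real ^ 'n \<Rightarrow> ('n \<Rightarrow> nat) \<Rightarrow> real" where
  "ffact m \<alpha> = (\<Prod>j\<in>UNIV. \<Prod>l<\<alpha> j. m $ j - real l)"

lemma ffact_0 [simp]: "ffact m (\<lambda>_. 0) = 1"
  by (simp add: ffact_def)

lemma ffact_incr: "ffact m (incr j \<alpha>) = (m $ j - real (\<alpha> j)) * ffact m \<alpha>"
proof -
  have "ffact m (\<alpha>(j := a)) = (\<Prod>l<a. m $ j - real l) * (\<Prod>i\<in>UNIV - {j}. \<Prod>l<\<alpha> i. m $ i - real l)" for a
    unfolding ffact_def by (rule prod_incr)
  from this[of "\<alpha> j"] this[of "Suc (\<alpha> j)"] show ?thesis by simp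
qed

text \<open>Coefficients of Newton's formula; the generalised binomial is taken because the entries
  of a lattice point may be negative.\<close>

definition mbinom :: "real ^ 'n \<Rightarrow> ('n \<Rightarrow> nat) \<Rightarrow> real" where
  "mbinom m \<alpha> = (\<Prod>j\<in>UNIV. m $ j gchoose \<alpha> j)"

lemma mbinom_ffact: "mbinom m \<alpha> = ffact m \<alpha> / real (mfact \<alpha>)"
  unfolding mbinom_def ffact_def mfact_def of_nat_prod prod_dividef[symmetric]
  by (intro prod.cong refl) (simp add: gbinomial_prod_rev lessThan_atLeast0)

lemma mbinom_at_0: "mbinom 0 \<alpha> = (if \<alpha> = (\<lambda>_. 0) then 1 else 0)"
proof (cases "\<alpha> = (\<lambda>_. 0)")
  case False
  then obtain j where "\<alpha> j \<noteq> 0" by (auto simp: fun_eq_iff)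
  then have "(0 :: real) gchoose \<alpha> j = 0" by (cases "\<alpha> j") auto
  then show ?thesis using False by (auto simp: mbinom_def)
qed (simp add: mbinom_def)

text \<open>Pascal's rule in the coordinate \<open>j\<close>, the other coordinates being untouched;
  the second fact is its degenerate case at entry 0.\<close>

lemma mbinom_plus_axis: "mbinom (m + axis j 1) (incr j \<alpha>) = mbinom m (incr j \<alpha>) + mbinom m \<alpha>"
  and mbinom_plus_axis_0: "\<alpha> j = 0 \<Longrightarrow> mbinom (m + axis j 1) \<alpha> = mbinom m \<alpha>"
proof -
  have m: "mbinom m (\<alpha>(j := a)) = (m $ j gchoose a) * (\<Prod>i\<in>UNIV - {j}. m $ i gchoose \<alpha> i)" for m a
    unfolding mbinom_def using prod_incr[of "\<lambda>i a. m $ i gchoose a" \<alpha> j a] .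
  have e: "(\<Prod>i\<in>UNIV - {j}. (m + axis j 1) $ i gchoose \<alpha> i) = (\<Prod>i\<in>UNIV - {j}. m $ i gchoose \<alpha> i)"
    by (intro prod.cong) (auto simp: axis_def)
  show "mbinom (m + axis j 1) (incr j \<alpha>) = mbinom m (incr j \<alpha>) + mbinom m \<alpha>"
  proof -
    have "(m + axis j 1) $ j gchoose Suc (\<alpha> j) = (m $ j gchoose \<alpha> j) + (m $ j gchoose Suc (\<alpha> j))"
      using gbinomial_Suc_Suc[of "m $ j" "\<alpha> j"] by (simp add: axis_def)
    moreover have "mbinom m \<alpha> = (m $ j gchoose \<alpha> j) * (\<Prod>i\<in>UNIV - {j}. m $ i gchoose \<alpha> i)"
      using m[of m "\<alpha> j"] by simp
    ultimately show ?thesis unfolding m e by (simp only: ring_distribs add.commute)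
  qed
  show "mbinom (m + axis j 1) \<alpha> = mbinom m \<alpha>" if "\<alpha> j = 0"
    using m[of m 0] m[of "m + axis j 1" 0] fun_upd_triv[of \<alpha> j] unfolding e that by simp
qed

lemma smooth_torus_torus_factor:
  assumes "smooth_torus f"
  shows "smooth_torus (torus_factor j l f)"
    and "m \<in> int_lattice \<Longrightarrow> tcoef (torus_factor j l f) m = of_real (m $ j - real l) * tcoef f m"
proof -
  note d = smooth_torus_partial_deriv[OF assms, of j]
  note s = smooth_torus_cmult[OF d] smooth_torus_cmult[OF assms]
  show "smooth_torus (torus_factor j l f)"
    unfolding torus_factor_def by (intro smooth_torus_diff s)
  assume m: "m \<in> int_lattice"
  show "tcoef (torus_factor j l f) m = of_real (m $ j - real l) * tcoef f m"
    unfolding torus_factor_def tcoef_diff[OF s[THEN smooth_torus_torus_fun] m] tcoef_cmult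
      smooth_torus_tcoef_partial_deriv[OF assms m]
    by (simp add: ring_distribs)
qed

text \<open>Fourier multipliers compose by multiplication. The fold is kept general because
  \<open>torus_D\<close> nests two of them, over the coordinates and over the shifts
  \<open>l\<close>.\<close>

lemma smooth_torus_foldr:
  assumes F: "\<And>x f. smooth_torus f \<Longrightarrow> smooth_torus (F x f) \<and>
      (\<forall>m\<in>int_lattice. tcoef (F x f) m = of_real (u x m) * tcoef f m)"
    and f: "smooth_torus f"
  shows "smooth_torus (foldr F xs f) \<and>
    (\<forall>m\<in>int_lattice. tcoef (foldr F xs f) m = of_real (\<Prod>x\<leftarrow>xs. u x m) * tcoef f m)"
proof (induction xs)
  case (Cons x xs)
  then show ?case using F[of "foldr F xs f" x] by simp
qed (simp add: f)

lemma
  fixes f :: "real ^ 'n::{finite,linorder} \<Rightarrow> complex"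
  assumes f: "smooth_torus f"
  shows smooth_torus_torus_D: "smooth_torus (torus_D h \<beta> f)"
    and tcoef_torus_D: "m \<in> int_lattice \<Longrightarrow>
      tcoef (torus_D h \<beta> f) m = of_real (h ^ mabs \<beta> * ffact m \<beta>) * tcoef f m"
proof -
  let ?F = "\<lambda>j. foldr (torus_factor j) [0..<\<beta> j]"
  have "smooth_torus (?F j f) \<and>
      (\<forall>m\<in>int_lattice. tcoef (?F j f) m = of_real (\<Prod>l\<leftarrow>[0..<\<beta> j]. m $ j - real l) * tcoef f m)"
    if "smooth_torus f" for j and f :: "real ^ 'n::_ \<Rightarrow> complex"
    by (rule smooth_torus_foldr[OF _ that]) (simp add: smooth_torus_torus_factor)
  note * = smooth_torus_foldr[of ?F, OF this f, of "sorted_list_of_set UNIV"]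
  have "(\<Prod>j\<leftarrow>sorted_list_of_set UNIV. \<Prod>l\<leftarrow>[0..<\<beta> j]. m $ j - real l) = ffact m \<beta>" for m
    unfolding ffact_def
    by (simp add: lessThan_atLeast0 flip: prod.distinct_set_conv_list)
  then show "smooth_torus (torus_D h \<beta> f)" "m \<in> int_lattice \<Longrightarrow>
      tcoef (torus_D h \<beta> f) m = of_real (h ^ mabs \<beta> * ffact m \<beta>) * tcoef f m"
    unfolding torus_D_def using * by (auto simp: tcoef_cmult smooth_torus_cmult)
qed

text \<open>Smooth functions are determined by their coefficients, so that identities between toroidal
  derivatives reduce to identities between falling factorials.\<close>

lemma smooth_torus_eqI:
  "smooth_torus f \<Longrightarrow> smooth_torus g \<Longrightarrow> (\<And>m. m \<in> int_lattice \<Longrightarrow> tcoef f m = tcoef g m) \<Longrightarrow> f = g"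
  by (rule torus_fun_eqI) (auto intro: smooth_torus_torus_fun)

subsection \<open>Difference operators\<close>

lemma hdiff_commute: "hdiff h i (hdiff h j g) = hdiff h j (hdiff h i g)"
  by (simp add: hdiff_def fun_eq_iff algebra_simps diff_divide_distrib)

lemma hdiff_funpow_commute: "(hdiff h i ^^ n) (hdiff h j g) = hdiff h j ((hdiff h i ^^ n) g)"
  by (induction n) (simp_all add: hdiff_commute)

lemma hdiff_foldr_commute:
  "foldr (\<lambda>i. hdiff h i ^^ \<alpha> i) xs (hdiff h j g) = hdiff h j (foldr (\<lambda>i. hdiff h i ^^ \<alpha> i) xs g)"
  by (induction xs) (simp_all add: hdiff_funpow_commute)

lemma hDelta_0 [simp]: "hDelta h (\<lambda>_. 0) g = g"
proof -
  have "foldr (\<lambda>j::'a. id) xs g = g" for xs by (induction xs) auto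
  then show ?thesis by (simp add: hDelta_def id_def)
qed

text \<open>The operators \<open>hdiff h i\<close> commute and \<open>j\<close> occurs exactly once
  among the coordinates, so the additional factor can be moved to either end of the product.\<close>

lemma hDelta_incr: "hDelta h (incr j \<alpha>) g = hdiff h j (hDelta h \<alpha> g)"
  and hDelta_incr': "hDelta h (incr j \<alpha>) g = hDelta h \<alpha> (hdiff h j g)"
proof -
  have 1: "foldr (\<lambda>i. hdiff h i ^^ incr j \<alpha> i) xs g = foldr (\<lambda>i. hdiff h i ^^ \<alpha> i) xs g"
    if "j \<notin> set xs" for xs g
    using that by (induction xs) auto
  have "foldr (\<lambda>i. hdiff h i ^^ incr j \<alpha> i) xs g = hdiff h j (foldr (\<lambda>i. hdiff h i ^^ \<alpha> i) xs g)"
    if "distinct xs" "j \<in> set xs" for xs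
    using that
    by (induction xs) (auto simp: 1 hdiff_funpow_commute hdiff_foldr_commute simp del: fun_upd_apply,
        auto simp: hdiff_funpow_commute)
  then show "hDelta h (incr j \<alpha>) g = hdiff h j (hDelta h \<alpha> g)"
    unfolding hDelta_def by simp
  then show "hDelta h (incr j \<alpha>) g = hDelta h \<alpha> (hdiff h j g)"
    unfolding hDelta_def hdiff_foldr_commute .
qed

lemma hDelta_add: "hDelta h (\<lambda>j. \<alpha> j + \<gamma> j) g = hDelta h \<alpha> (hDelta h \<gamma> g)"
proof (induction \<alpha> rule: mindex_induct)
  case (incr \<alpha> j)
  have "(\<lambda>i. (incr j \<alpha>) i + \<gamma> i) = incr j (\<lambda>i. \<alpha> i + \<gamma> i)" by auto
  then show ?case
    using incr hDelta_incr[where \<alpha> = "\<lambda>i. \<alpha> i + \<gamma> i" and j = j] by (simp only: hDelta_incr)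
qed simp

text \<open>A finite combination of lattice translates with real weights that depend neither on
  \<open>g\<close> nor on \<open>k\<close>. Hence \<open>hDelta\<close> commutes with everything
  linear, such as taking coefficients, and with conjugation, and it sees only values on the
  lattice.\<close>

lemma hDelta_repr:
  obtains n :: nat and w :: "nat \<Rightarrow> real" and p :: "nat \<Rightarrow> real ^ 'n::{finite,linorder}"
  where "\<And>i. p i \<in> int_lattice"
    and "\<And>g k. hDelta h \<alpha> g k = (\<Sum>i<n. of_real (w i) * g (k + h *\<^sub>R p i))"
proof -
  have "\<exists>ws :: (real \<times> (real ^ 'n::_)) list. (\<forall>x\<in>set ws. snd x \<in> int_lattice) \<and>
      (\<forall>g k. hDelta h \<alpha> g k = (\<Sum>x\<leftarrow>ws. of_real (fst x) * g (k + h *\<^sub>R snd x)))"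
  proof (induction \<alpha> rule: mindex_induct)
    case zero
    show ?case by (rule exI[of _ "[(1, 0)]"]) simp
  next
    case (incr \<alpha> j)
    then obtain ws :: "(real \<times> (real ^ 'n::_)) list" where ws: "\<forall>x\<in>set ws. snd x \<in> int_lattice"
      "\<And>g k. hDelta h \<alpha> g k = (\<Sum>x\<leftarrow>ws. of_real (fst x) * g (k + h *\<^sub>R snd x))" by blast
    let ?vs = "map (\<lambda>x. (fst x / h, axis j 1 + snd x)) ws @ map (\<lambda>x. (- fst x / h, snd x)) ws"
    have "(\<Sum>x\<leftarrow>vs. complex_of_real (fst x / h) * g (k + h *\<^sub>R (axis j 1 + snd x)))
        + (\<Sum>x\<leftarrow>vs. complex_of_real (- fst x / h) * g (k + h *\<^sub>R snd x))
        = ((\<Sum>x\<leftarrow>vs. complex_of_real (fst x) * g (k + h *\<^sub>R axis j 1 + h *\<^sub>R snd x))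
        - (\<Sum>x\<leftarrow>vs. complex_of_real (fst x) * g (k + h *\<^sub>R snd x))) / of_real h"
      for g k and vs :: "(real \<times> (real ^ 'n::_)) list"
      by (induction vs) (simp_all add: scaleR_add_right add.assoc[symmetric] add_divide_distrib diff_divide_distrib)
    then have "hDelta h (incr j \<alpha>) g k = (\<Sum>x\<leftarrow>?vs. of_real (fst x) * g (k + h *\<^sub>R snd x))" for g k
      unfolding hDelta_incr by (subst hdiff_def) (simp add: ws(2) o_def)
    moreover have "\<forall>x\<in>set ?vs. snd x \<in> int_lattice" using ws(1) by auto
    ultimately show ?case by blast
  qed
  then obtain ws :: "(real \<times> (real ^ 'n::_)) list" where ws: "\<forall>x\<in>set ws. snd x \<in> int_lattice"
    "\<And>g k. hDelta h \<alpha> g k = (\<Sum>x\<leftarrow>ws. of_real (fst x) * g (k + h *\<^sub>R snd x))" by blast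
  \<comment> \<open>Indices beyond the list receive the node 0, so that \<open>p i\<close> lies in
    the lattice for every \<open>i\<close>.\<close>
  show thesis
    by (rule that[of "\<lambda>i. if i < length ws then snd (ws ! i) else 0" "\<lambda>i. fst (ws ! i)" "length ws"])
      (use ws in \<open>auto simp: sum_list_sum_nth atLeast0LessThan intro!: sum.cong\<close>)
qed

lemma hDelta_cong:
  assumes "k \<in> hlattice h" "\<And>k. k \<in> hlattice h \<Longrightarrow> f k = g k"
  shows "hDelta h \<alpha> f k = hDelta h \<alpha> g k"
  by (rule hDelta_repr[of h \<alpha>]) (simp add: assms hlattice_shift)

lemma hDelta_cmult: "hDelta h \<alpha> (\<lambda>k. c * g k) k = c * hDelta h \<alpha> g k"
  by (rule hDelta_repr[of h \<alpha>]) (simp add: sum_distrib_left mult.left_commute)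

lemma hDelta_plus: "hDelta h \<alpha> (\<lambda>k. f k + g k) k = hDelta h \<alpha> f k + hDelta h \<alpha> g k"
  by (rule hDelta_repr[of h \<alpha>]) (simp add: sum.distrib distrib_left)

lemma hDelta_cnj: "hDelta h \<alpha> (\<lambda>k. cnj (g k)) k = cnj (hDelta h \<alpha> g k)"
  by (rule hDelta_repr[of h \<alpha>]) simp

lemma
  fixes \<tau> :: "real ^ 'n::{finite,linorder} \<Rightarrow> real ^ 'n::_ \<Rightarrow> complex"
  assumes k: "k \<in> hlattice h" and \<tau>: "\<And>k. k \<in> hlattice h \<Longrightarrow> smooth_torus (\<tau> k)"
  shows smooth_torus_hDelta: "smooth_torus (\<lambda>\<theta>. hDelta h \<alpha> (\<lambda>k'. \<tau> k' \<theta>) k)"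
    and tcoef_hDelta: "m \<in> int_lattice \<Longrightarrow>
      tcoef (\<lambda>\<theta>. hDelta h \<alpha> (\<lambda>k'. \<tau> k' \<theta>) k) m = hDelta h \<alpha> (\<lambda>k'. tcoef (\<tau> k') m) k"
proof -
  obtain p w n where p: "\<And>i. p i \<in> int_lattice"
    and r: "\<And>g k. hDelta h \<alpha> g k = (\<Sum>i<n::nat. of_real (w i) * g (k + h *\<^sub>R p i))"
    by (rule hDelta_repr[of h \<alpha>]) (rule that)
  have s: "smooth_torus (\<lambda>\<theta>. of_real (w i) * \<tau> (k + h *\<^sub>R p i) \<theta>)" for i
    by (intro smooth_torus_cmult \<tau> hlattice_shift k p)
  then show "smooth_torus (\<lambda>\<theta>. hDelta h \<alpha> (\<lambda>k'. \<tau> k' \<theta>) k)"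
    unfolding r by (rule smooth_torus_sum)
  show "tcoef (\<lambda>\<theta>. hDelta h \<alpha> (\<lambda>k'. \<tau> k' \<theta>) k) m = hDelta h \<alpha> (\<lambda>k'. tcoef (\<tau> k') m) k"
    if "m \<in> int_lattice"
    unfolding r using that smooth_torus_torus_fun[OF s]
    by (subst tcoef_sum(2)) (simp_all add: tcoef_cmult)
qed

subsection \<open>The Newton expansion\<close>

text \<open>The remainder of the multivariate Newton forward difference formula at the shift
  \<open>h *\<^sub>R m\<close>; the powers of \<open>h\<close> cancel the denominators in
  \<open>hDelta\<close>.\<close>

definition newton_rem :: "real \<Rightarrow> nat \<Rightarrow> (real ^ 'n::{finite,linorder} \<Rightarrow> complex) \<Rightarrow> real ^ 'n::_ \<Rightarrow> real ^ 'n::_ \<Rightarrow> complex" where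
  "newton_rem h N g k m = g (k + h *\<^sub>R m) -
     (\<Sum>\<gamma> | mabs \<gamma> < N. of_real (h ^ mabs \<gamma> * mbinom m \<gamma>) * hDelta h \<gamma> g k)"

lemma newton_rem_at_0: "newton_rem h (Suc N) g k 0 = 0"
proof -
  have "(\<Sum>\<gamma> | mabs \<gamma> < Suc N. of_real (h ^ mabs \<gamma> * mbinom 0 \<gamma>) * hDelta h \<gamma> g k)
      = (\<Sum>\<gamma>\<in>{\<lambda>_. 0}. of_real (h ^ mabs \<gamma> * mbinom 0 \<gamma>) * hDelta h \<gamma> g k)"
    by (rule sum.mono_neutral_right) (auto simp: finite_mabs_less mbinom_at_0)
  then show ?thesis by (simp add: newton_rem_def mbinom_at_0)
qed

text \<open>Pascal's rule telescopes the Newton sum: a unit step in \<open>m\<close> changes a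
  remainder of order N + 1 by \<open>h\<close> times a remainder of order N of the difference of
  \<open>g\<close>.\<close>

lemma newton_rem_step:
  assumes h: "h \<noteq> 0"
  shows "newton_rem h (Suc N) g k (m + axis j 1)
    = newton_rem h (Suc N) g k m + of_real h * newton_rem h N (hdiff h j g) k m"
proof -
  let ?t = "\<lambda>\<gamma>. of_real (h ^ mabs \<gamma> * (mbinom (m + axis j 1) \<gamma> - mbinom m \<gamma>)) * hDelta h \<gamma> g k"
  \<comment> \<open>Terms with \<open>\<gamma> j = 0\<close> do not change under the step; every
    other index is \<open>incr j\<close> of an index of order below \<open>N\<close>.\<close>
  have "(\<Sum>\<gamma> | mabs \<gamma> < Suc N. ?t \<gamma>) = (\<Sum>\<gamma> | mabs \<gamma> < Suc N \<and> \<gamma> j \<noteq> 0. ?t \<gamma>)"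
    by (rule sum.mono_neutral_right) (auto simp: finite_mabs_less mbinom_plus_axis_0)
  also have "\<dots> = (\<Sum>\<gamma> | mabs \<gamma> < N. of_real (h * (h ^ mabs \<gamma> * mbinom m \<gamma>)) * hDelta h \<gamma> (hdiff h j g) k)"
  proof (rule sum.reindex_bij_witness[where j = "\<lambda>\<gamma>. \<gamma>(j := \<gamma> j - 1)" and i = "incr j"])
    fix \<gamma> :: "'a \<Rightarrow> nat" assume \<gamma>: "\<gamma> \<in> {\<gamma>. mabs \<gamma> < Suc N \<and> \<gamma> j \<noteq> 0}"
    define \<beta> where "\<beta> = \<gamma>(j := \<gamma> j - 1)"
    have \<beta>: "\<gamma> = incr j \<beta>" using \<gamma> by (auto simp: \<beta>_def)
    show "incr j (\<gamma>(j := \<gamma> j - 1)) = \<gamma>" "\<gamma>(j := \<gamma> j - 1) \<in> {\<gamma>. mabs \<gamma> < N}"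
      "of_real (h * (h ^ mabs (\<gamma>(j := \<gamma> j - 1)) * mbinom m (\<gamma>(j := \<gamma> j - 1)))) *
        hDelta h (\<gamma>(j := \<gamma> j - 1)) (hdiff h j g) k = ?t \<gamma>"
      using \<gamma> unfolding \<beta> by (simp_all add: mbinom_plus_axis hDelta_incr')
  qed auto
  finally have "(\<Sum>\<gamma> | mabs \<gamma> < Suc N. ?t \<gamma>) = of_real h *
      (\<Sum>\<gamma> | mabs \<gamma> < N. of_real (h ^ mabs \<gamma> * mbinom m \<gamma>) * hDelta h \<gamma> (hdiff h j g) k)"
    by (simp add: sum_distrib_left mult.assoc)
  moreover have "g (k + h *\<^sub>R (m + axis j 1)) - g (k + h *\<^sub>R m) = of_real h * hdiff h j g (k + h *\<^sub>R m)"
    using h by (simp add: hdiff_def scaleR_add_right add.assoc)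
  ultimately show ?thesis
    unfolding newton_rem_def by (simp add: algebra_simps sum_subtractf)
qed

text \<open>The remainder of order N + 1 vanishes at m = 0. Walking from 0 to \<open>m\<close> by
  unit steps inside the l1 ball of radius \<open>R\<close> takes at most \<open>R\<close> steps, and
  each costs \<open>h\<close> times a remainder of order N. Iterating over the order gives the power
  of \<open>h * R\<close>.\<close>

lemma newton_rem_bound:
  fixes R :: nat
  assumes h: "h > 0" and B: "B \<ge> 0"
    and g: "\<And>\<gamma> z. mabs \<gamma> = N \<Longrightarrow> z \<in> int_lattice \<Longrightarrow> (\<Sum>j\<in>UNIV. \<bar>z $ j\<bar>) \<le> R \<Longrightarrow>
      norm (hDelta h \<gamma> g (k + h *\<^sub>R z)) \<le> B"
    and m: "m \<in> int_lattice" "(\<Sum>j\<in>UNIV. \<bar>m $ j\<bar>) \<le> R"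
  shows "norm (newton_rem h N g k m) \<le> (h * R) ^ N * B"
  using g m
proof (induction N arbitrary: g m)
  case 0
  then show ?case using 0(1)[of "\<lambda>_. 0" m] by (simp add: newton_rem_def)
next
  case (Suc N)
  define l1 :: "real ^ 'a::_ \<Rightarrow> real" where "l1 m = (\<Sum>j\<in>UNIV. \<bar>m $ j\<bar>)" for m
  have IH: "norm (newton_rem h N (hdiff h j g) k m) \<le> (h * R) ^ N * B"
    if "m \<in> int_lattice" "l1 m \<le> R" for j m
  proof (rule Suc.IH)
    show "norm (hDelta h \<gamma> (hdiff h j g) (k + h *\<^sub>R z)) \<le> B"
      if "mabs \<gamma> = N" "z \<in> int_lattice" "(\<Sum>j\<in>UNIV. \<bar>z $ j\<bar>) \<le> R" for \<gamma> z
      using Suc.prems(1)[of "incr j \<gamma>" z] that by (simp add: hDelta_incr' del: fun_upd_apply)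
  qed (use that in \<open>auto simp: l1_def\<close>)
  \<comment> \<open>Here \<open>n\<close> bounds the number of remaining steps, while the fixed
    \<open>R\<close> confines the walk to the ball where the bounds of order N hold.\<close>
  have "norm (newton_rem h (Suc N) g k m) \<le> n * (h * ((h * R) ^ N * B))"
    if "m \<in> int_lattice" "l1 m \<le> n" "l1 m \<le> R" for n :: nat and m
    using that
  proof (induction n arbitrary: m)
    case 0
    then have "(\<Sum>j\<in>UNIV. \<bar>m $ j\<bar>) = 0" by (simp add: l1_def antisym sum_nonneg)
    then have "m = 0" by (simp add: sum_nonneg_eq_0_iff vec_eq_iff)
    then show ?case by (simp add: newton_rem_at_0)
  next
    case (Suc n)
    show ?case
    proof (cases "m = 0")
      case True
      then show ?thesis using h B by (simp add: newton_rem_at_0)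
    next
      case False
      then obtain j where j: "m $ j \<noteq> 0" by (auto simp: vec_eq_iff)
      have mj: "m $ j \<in> \<int>" using Suc.prems(1) by (simp add: int_lattice_def)
      have l1: "l1 (m + c *\<^sub>R axis j 1) = l1 m - \<bar>m $ j\<bar> + \<bar>m $ j + c\<bar>" for c
      proof -
        have "(\<Sum>i\<in>UNIV - {j}. \<bar>(m + c *\<^sub>R axis j 1) $ i\<bar>) = (\<Sum>i\<in>UNIV - {j}. \<bar>m $ i\<bar>)"
          by (intro sum.cong) (auto simp: axis_def)
        then show ?thesis by (simp add: l1_def sum.remove[of UNIV j])
      qed
      show ?thesis
      proof (cases "m $ j > 0")
        case True
        then have "m $ j \<ge> 1" using mj by (metis Ints_cases of_int_0_less_iff of_int_1_le_iff zless_imp_add1_zle add_0)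
        then have l: "l1 (m - axis j 1) = l1 m - 1" using l1[of "-1"] by simp
        have m': "m - axis j 1 \<in> int_lattice" using Suc.prems by simp
        have "newton_rem h (Suc N) g k m = newton_rem h (Suc N) g k (m - axis j 1)
            + of_real h * newton_rem h N (hdiff h j g) k (m - axis j 1)"
          using newton_rem_step[of h N g k "m - axis j 1" j] h by simp
        also have "norm \<dots> \<le> n * (h * ((h * R) ^ N * B)) + h * ((h * R) ^ N * B)"
          using h Suc.prems l
          by (intro norm_triangle_le add_mono Suc.IH m') (auto simp: norm_mult intro!: IH m')
        finally show ?thesis by (simp add: algebra_simps)
      next
        case False
        then have "m $ j \<le> -1" using mj j
          by (metis Ints_cases linorder_neqE_linordered_idom of_int_less_0_iff of_int_le_iff of_int_minus of_int_1 zle_add1_eq_le add.left_inverse)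
        then have l: "l1 (m + axis j 1) = l1 m - 1" using l1[of 1] by simp
        have m': "m + axis j 1 \<in> int_lattice" using Suc.prems by simp
        \<comment> \<open>For a negative coordinate the step identity is solved for its start
          \<open>m\<close> instead, so the remainder of order N sits at \<open>m\<close>
          itself.\<close>
        have "newton_rem h (Suc N) g k m = newton_rem h (Suc N) g k (m + axis j 1)
            - of_real h * newton_rem h N (hdiff h j g) k m"
          using newton_rem_step[of h N g k m j] h by simp
        also have "norm \<dots> \<le> n * (h * ((h * R) ^ N * B)) + h * ((h * R) ^ N * B)"
          using h Suc.prems l
          by (intro norm_triangle_le_diff add_mono Suc.IH m') (auto simp: norm_mult intro!: IH)
        finally show ?thesis by (simp add: algebra_simps)
      qed
    qed
  qed
  from this[of m R] show ?case
    using Suc.prems by (simp add: l1_def mult_ac)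
qed

subsection \<open>Polynomial weights and falling factorials\<close>

text \<open>The span of the falling factorials of order at most \<open>d\<close>. Multipliers are
  kept in this form because each summand is realised by a toroidal derivative of order at most
  \<open>d\<close>, to which the bounds of the symbol class apply.\<close>

inductive ffact_comb :: "nat \<Rightarrow> (real ^ 'n \<Rightarrow> real) \<Rightarrow> bool" for d where
  ffact_comb_base: "mabs \<nu> \<le> d \<Longrightarrow> ffact_comb d (\<lambda>m. c * ffact m \<nu>)"
| ffact_comb_add: "ffact_comb d p \<Longrightarrow> ffact_comb d q \<Longrightarrow> ffact_comb d (\<lambda>m. p m + q m)"

text \<open>Writing m_j as (m_j - \<nu>_j) + \<nu>_j expresses the product of m_j with a falling
  factorial by two falling factorials, and the order rises by at most one.\<close>

lemma ffact_comb_linear: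
  "ffact_comb d p \<Longrightarrow> ffact_comb (Suc d) (\<lambda>m. (a * m $ j + b) * p m)"
proof (induction rule: ffact_comb.induct)
  case (ffact_comb_base \<nu> c)
  have "(\<lambda>m. (a * m $ j + b) * (c * ffact m \<nu>))
      = (\<lambda>m. (a * c) * ffact m (incr j \<nu>) + ((b + a * real (\<nu> j)) * c) * ffact m \<nu>)"
    unfolding ffact_incr by (simp add: fun_eq_iff algebra_simps)
  moreover have "ffact_comb (Suc d) \<dots>"
    using ffact_comb_base by (intro ffact_comb.intros) auto
  ultimately show ?case by simp
next
  case (ffact_comb_add p q)
  then show ?case
    using ffact_comb.ffact_comb_add[OF ffact_comb_add.IH] by (simp add: distrib_left)
qed

text \<open>The reflection comes from conjugation, which exchanges the frequencies m and -m. Each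
  factor of \<open>ffact (- m) \<beta>\<close> is affine in one coordinate, so
  \<open>ffact_comb_linear\<close> applies repeatedly.\<close>

lemma ffact_comb_ffact_minus:
  assumes "ffact_comb d p"
  shows "ffact_comb (d + mabs \<beta>) (\<lambda>m. ffact (- m) \<beta> * p m)"
proof (induction \<beta> rule: mindex_induct)
  case zero
  then show ?case using assms by simp
next
  case (incr \<beta> j)
  from ffact_comb_linear[OF this, of "-1" j "- real (\<beta> j)"]
  show ?case by (simp add: ffact_incr mult.assoc del: fun_upd_apply)
qed

lemma ffact_bound:
  obtains C where "C \<ge> 0" "\<And>m :: real ^ 'n. \<bar>ffact m \<beta>\<bar> \<le> C * (1 + norm m) ^ mabs \<beta>"
proof -
  have "\<exists>C\<ge>0. \<forall>m :: real ^ 'n. \<bar>ffact m \<beta>\<bar> \<le> C * (1 + norm m) ^ mabs \<beta>"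
  proof (induction \<beta> rule: mindex_induct)
    case zero
    then show ?case by (intro exI[of _ 1]) simp
  next
    case (incr \<beta> j)
    then obtain C where C: "C \<ge> 0" "\<And>m :: real ^ 'n. \<bar>ffact m \<beta>\<bar> \<le> C * (1 + norm m) ^ mabs \<beta>" by blast
    have "\<bar>ffact m (incr j \<beta>)\<bar> \<le> ((1 + real (\<beta> j)) * C) * (1 + norm m) ^ mabs (incr j \<beta>)" for m :: "real ^ 'n"
    proof -
      have "\<bar>m $ j - real (\<beta> j)\<bar> \<le> \<bar>m $ j\<bar> + real (\<beta> j)" by simp
      also have "\<dots> \<le> (1 + norm m) * (1 + real (\<beta> j))"
        using component_le_norm_cart[of m j] mult_nonneg_nonneg[OF norm_ge_zero[of m] of_nat_0_le_iff[of "\<beta> j"]]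
        unfolding ring_distribs by linarith
      finally have "\<bar>m $ j - real (\<beta> j)\<bar> \<le> (1 + norm m) * (1 + real (\<beta> j))" .
      then have "\<bar>m $ j - real (\<beta> j)\<bar> * \<bar>ffact m \<beta>\<bar> \<le> ((1 + norm m) * (1 + real (\<beta> j))) * (C * (1 + norm m) ^ mabs \<beta>)"
        using C by (intro mult_mono) auto
      then show ?thesis
        unfolding ffact_incr by (simp add: abs_mult mult_ac)
    qed
    moreover have "(1 + real (\<beta> j)) * C \<ge> 0" using C(1) by simp
    ultimately show ?case by blast
  qed
  then show thesis using that by blast
qed

text \<open>A single falling factorial vanishes at many lattice points, so the weight is controlled
  by all of them up to order \<open>M\<close> together. In the application \<open>X\<close> is the
  modulus of a coefficient and \<open>K\<close> bounds the coefficients of its toroidal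
  derivatives.\<close>

lemma power_le_ffact:
  obtains C where "C \<ge> 0"
    and "\<And>(m :: real ^ 'n) X K. X \<ge> 0 \<Longrightarrow> (\<And>\<nu>. mabs \<nu> \<le> M \<Longrightarrow> X * \<bar>ffact m \<nu>\<bar> \<le> K) \<Longrightarrow>
      X * (1 + norm m) ^ M \<le> C * K"
proof -
  have "\<exists>C\<ge>0. \<forall>(m :: real ^ 'n) X K. X \<ge> 0 \<longrightarrow> (\<forall>\<nu>. mabs \<nu> \<le> M \<longrightarrow> X * \<bar>ffact m \<nu>\<bar> \<le> K) \<longrightarrow>
      X * (1 + norm m) ^ M \<le> C * K"
  proof (induction M)
    case 0
    show ?case
    proof (intro exI[of _ 1] conjI allI impI)
      fix m :: "real ^ 'n" and X K :: real assume "\<forall>\<nu>. mabs \<nu> \<le> 0 \<longrightarrow> X * \<bar>ffact m \<nu>\<bar> \<le> K"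
      from this[rule_format, of "\<lambda>_. 0"] show "X * (1 + norm m) ^ 0 \<le> 1 * K" by simp
    qed simp
  next
    case (Suc M)
    then obtain C where C: "C \<ge> 0" and CM: "\<And>(m :: real ^ 'n) X K. X \<ge> 0 \<Longrightarrow>
      (\<And>\<nu>. mabs \<nu> \<le> M \<Longrightarrow> X * \<bar>ffact m \<nu>\<bar> \<le> K) \<Longrightarrow> X * (1 + norm m) ^ M \<le> C * K" by blast
    \<comment> \<open>The norm is at most the sum of the moduli of the coordinates, and by
      \<open>ffact_incr\<close> multiplying by one coordinate costs at most the factor
      \<open>1 + real M\<close>.\<close>
    let ?c = "1 + real CARD('n) * (1 + real M)"
    have "X * (1 + norm m) ^ Suc M \<le> (C * ?c) * K"
      if X: "X \<ge> 0" and K: "\<And>\<nu>. mabs \<nu> \<le> Suc M \<Longrightarrow> X * \<bar>ffact m \<nu>\<bar> \<le> K"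
      for m :: "real ^ 'n" and X K
    proof -
      have "(X * (1 + norm m)) * (1 + norm m) ^ M \<le> C * (?c * K)"
      proof (rule CM)
        fix \<nu> :: "'n \<Rightarrow> nat" assume \<nu>: "mabs \<nu> \<le> M"
        have j: "X * (\<bar>m $ j\<bar> * \<bar>ffact m \<nu>\<bar>) \<le> (1 + real M) * K" for j
        proof -
          have "\<nu> j \<le> mabs \<nu>" unfolding mabs_def by (rule member_le_sum) auto
          then have nj: "real (\<nu> j) \<le> real M" using \<nu> by simp
          have "\<bar>m $ j\<bar> * \<bar>ffact m \<nu>\<bar> \<le> (\<bar>m $ j - real (\<nu> j)\<bar> + real (\<nu> j)) * \<bar>ffact m \<nu>\<bar>"
            by (intro mult_right_mono) auto
          also have "\<dots> = \<bar>ffact m (incr j \<nu>)\<bar> + real (\<nu> j) * \<bar>ffact m \<nu>\<bar>"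
            unfolding ffact_incr by (simp add: abs_mult distrib_right)
          finally have "X * (\<bar>m $ j\<bar> * \<bar>ffact m \<nu>\<bar>) \<le> X * \<bar>ffact m (incr j \<nu>)\<bar> + real (\<nu> j) * (X * \<bar>ffact m \<nu>\<bar>)"
            using X by (metis distrib_left mult.left_commute mult_left_mono)
          also have "\<dots> \<le> K + real M * K"
            using nj \<nu> X by (intro add_mono mult_mono K) auto
          finally show ?thesis by (simp add: algebra_simps)
        qed
        have "X * (1 + norm m) * \<bar>ffact m \<nu>\<bar> \<le> X * (1 + (\<Sum>j\<in>UNIV. \<bar>m $ j\<bar>)) * \<bar>ffact m \<nu>\<bar>"
          using X norm_le_l1_cart[of m] by (intro mult_right_mono mult_left_mono) auto
        also have "\<dots> = X * \<bar>ffact m \<nu>\<bar> + (\<Sum>j\<in>UNIV. X * (\<bar>m $ j\<bar> * \<bar>ffact m \<nu>\<bar>))"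
          by (simp add: algebra_simps sum_distrib_left sum_distrib_right)
        also have "\<dots> \<le> K + (\<Sum>j\<in>(UNIV :: 'n set). (1 + real M) * K)"
          using \<nu> by (intro add_mono K sum_mono j) auto
        also have "\<dots> = ?c * K" by (simp add: algebra_simps)
        finally show "X * (1 + norm m) * \<bar>ffact m \<nu>\<bar> \<le> ?c * K" .
      qed (use X in simp)
      then show ?thesis by (simp add: mult_ac)
    qed
    then show ?case using C by (intro exI[of _ "C * ?c"]) simp
  qed
  then show thesis using that by blast
qed

text \<open>For \<open>s \<ge> 0\<close> this is the triangle inequality for k + v; for negative
  \<open>s\<close> it is the triangle inequality for k = (k + v) - v, with the factor of
  \<open>v\<close> moved across.\<close>

lemma peetre:
  fixes k v :: "'a::real_normed_vector"
  shows "(1 + norm (k + v)) powr s \<le> (1 + norm k) powr s * (1 + norm v) powr \<bar>s\<bar>"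
proof (cases "s \<ge> 0")
  case True
  have "1 + norm (k + v) \<le> (1 + norm k) * (1 + norm v)"
    using norm_triangle_ineq[of k v] mult_nonneg_nonneg[OF norm_ge_zero[of k] norm_ge_zero[of v]]
    unfolding ring_distribs by linarith
  then have "(1 + norm (k + v)) powr s \<le> ((1 + norm k) * (1 + norm v)) powr s"
    using True by (intro powr_mono2) auto
  then show ?thesis using True by (simp add: powr_mult)
next
  case False
  have "norm k \<le> norm (k + v) + norm v"
    using norm_triangle_ineq4[of "k + v" v] by simp
  then have "1 + norm k \<le> (1 + norm (k + v)) * (1 + norm v)"
    using mult_nonneg_nonneg[OF norm_ge_zero[of "k + v"] norm_ge_zero[of v]]
    unfolding ring_distribs by linarith
  then have "((1 + norm (k + v)) * (1 + norm v)) powr s \<le> (1 + norm k) powr s"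
    using False by (intro powr_mono2') (auto simp: add_pos_nonneg)
  then have "(1 + norm (k + v)) powr s * (1 + norm v) powr s \<le> (1 + norm k) powr s"
    by (simp add: powr_mult)
  then have "(1 + norm (k + v)) powr s * (1 + norm v) powr s * (1 + norm v) powr (- s)
      \<le> (1 + norm k) powr s * (1 + norm v) powr (- s)"
    by (rule mult_right_mono) simp
  moreover have "(1 + norm v) powr s * (1 + norm v) powr (- s) = 1"
    by (simp add: powr_add[symmetric] add_nonneg_eq_0_iff)
  ultimately show ?thesis using False by (simp add: mult.assoc)
qed

subsection \<open>Estimates for the adjoint symbol\<close>

locale adjoint_symbol =
  fixes h \<mu> \<rho> \<delta> :: real and \<sigma> :: "real ^ 'n::{finite,linorder} \<Rightarrow> real ^ 'n::_ \<Rightarrow> complex"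
  assumes h: "0 < h" "h \<le> 1" and \<delta>: "0 \<le> \<delta>" "\<delta> < \<rho>" "\<rho> \<le> 1"
    and \<sigma>: "\<sigma> \<in> symbol_class h \<mu> \<rho> \<delta>"
begin

lemma smooth_\<sigma>: "k \<in> hlattice h \<Longrightarrow> smooth_torus (\<sigma> k)"
  using \<sigma> by (simp add: symbol_class_def)

text \<open>The frequency comes first so that \<open>acoef m\<close> is a function of
  \<open>k\<close> to which \<open>hDelta\<close> applies.\<close>

definition acoef :: "real ^ 'n::_ \<Rightarrow> real ^ 'n::_ \<Rightarrow> complex" where
  "acoef m k = tcoef (\<lambda>\<theta>. cnj (\<sigma> k \<theta>)) m"

lemma acoef_eq: "acoef m k = cnj (tcoef (\<sigma> k) (- m))"
  by (simp add: acoef_def tcoef_cnj)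

text \<open>A falling factorial times a coefficient is, up to a power of \<open>h\<close>, a
  coefficient of a toroidal derivative and so bounded by the supremum of that derivative. Each power
  of decay in \<open>m\<close> thus costs \<open>\<delta>\<close> in the exponent of 1 +
  |k|.\<close>

lemma coefficient_decay:
  obtains C where "C \<ge> 0"
    and "\<And>k m. k \<in> hlattice h \<Longrightarrow> m \<in> int_lattice \<Longrightarrow>
      norm (hDelta h \<alpha> (acoef m) k) * (1 + norm m) ^ M
      \<le> C * (1 + norm k) powr (\<mu> - \<rho> * real (mabs \<alpha>) + \<delta> * real M)"
proof -
  obtain B where B0: "\<And>\<beta>. B \<beta> > 0" and B: "\<And>\<beta> k \<theta>. k \<in> hlattice h \<Longrightarrow>
      norm (torus_D h \<beta> (\<lambda>\<theta>'. hDelta h \<alpha> (\<lambda>k'. \<sigma> k' \<theta>') k) \<theta>)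
        \<le> B \<beta> * (1 + norm k) powr (\<mu> - \<rho> * real (mabs \<alpha>) + \<delta> * real (mabs \<beta>))"
    using \<sigma> unfolding symbol_class_def mem_Collect_eq by metis
  obtain C where C: "C \<ge> 0" "\<And>(m :: real ^ 'n::_) X K. X \<ge> 0 \<Longrightarrow>
      (\<And>\<nu>. mabs \<nu> \<le> M \<Longrightarrow> X * \<bar>ffact m \<nu>\<bar> \<le> K) \<Longrightarrow> X * (1 + norm m) ^ M \<le> C * K"
    using power_le_ffact[of M] by metis
  \<comment> \<open>Dividing by \<open>h ^ mabs \<nu>\<close> removes the factor built into
    \<open>torus_D\<close>; the sum serves as one constant for all orders up to
    \<open>M\<close>.\<close>
  define D where "D = (\<Sum>\<nu> | mabs \<nu> < Suc M. B \<nu> / h ^ mabs \<nu>)"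
  have "norm (hDelta h \<alpha> (acoef m) k) * (1 + norm m) ^ M
      \<le> (C * D) * (1 + norm k) powr (\<mu> - \<rho> * real (mabs \<alpha>) + \<delta> * real M)"
    if k: "k \<in> hlattice h" and m: "m \<in> int_lattice" for k m
  proof -
    let ?f = "\<lambda>\<theta>'. hDelta h \<alpha> (\<lambda>k'. \<sigma> k' \<theta>') k"
    let ?p = "(1 + norm k) powr (\<mu> - \<rho> * real (mabs \<alpha>) + \<delta> * real M)"
    have f: "smooth_torus ?f" by (rule smooth_torus_hDelta[OF k smooth_\<sigma>])
    have am: "norm (hDelta h \<alpha> (acoef m) k) = norm (tcoef ?f (- m))"
      using m by (simp add: acoef_eq[abs_def] hDelta_cnj tcoef_hDelta[OF k smooth_\<sigma>])
    have "norm (tcoef ?f (- m)) * (1 + norm (- m)) ^ M \<le> C * (D * ?p)"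
    proof (rule C(2))
      fix \<nu> :: "'n \<Rightarrow> nat" assume \<nu>: "mabs \<nu> \<le> M"
      have "norm (tcoef (torus_D h \<nu> ?f) (- m))
          \<le> B \<nu> * (1 + norm k) powr (\<mu> - \<rho> * real (mabs \<alpha>) + \<delta> * real (mabs \<nu>))"
        using m by (intro norm_tcoef_le smooth_torus_torus_fun smooth_torus_torus_D f B k) simp
      also have "\<dots> \<le> B \<nu> * ?p"
        using \<nu> \<delta> B0[of \<nu>] by (intro mult_left_mono powr_mono add_left_mono) auto
      also have "norm (tcoef (torus_D h \<nu> ?f) (- m)) = h ^ mabs \<nu> * (norm (tcoef ?f (- m)) * \<bar>ffact (- m) \<nu>\<bar>)"
        using m h by (simp add: tcoef_torus_D[OF f] norm_mult norm_power)
      finally have "norm (tcoef ?f (- m)) * \<bar>ffact (- m) \<nu>\<bar> \<le> B \<nu> / h ^ mabs \<nu> * ?p"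
        using h by (simp add: field_simps)
      also have "\<dots> \<le> D * ?p"
        unfolding D_def using \<nu> h B0
        by (intro mult_right_mono member_le_sum) (auto simp: finite_mabs_less less_imp_le)
      finally show "norm (tcoef ?f (- m)) * \<bar>ffact (- m) \<nu>\<bar> \<le> D * ?p" .
    qed simp
    then show ?thesis by (simp add: am mult.assoc)
  qed
  moreover have "C * D \<ge> 0"
    unfolding D_def using C(1) B0 h by (intro mult_nonneg_nonneg sum_nonneg divide_nonneg_nonneg) (auto simp: less_imp_le)
  ultimately show thesis using that by blast
qed

text \<open>In the exponent of 1 + |m|, the summand N counts the lattice steps of
  \<open>newton_rem_bound\<close>, |s| is Peetre's price for returning from the shifted base points
  to \<open>k\<close>, and -M is the decay of the coefficients.\<close>

lemma newton_rem_decay: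
  defines "s \<equiv> \<lambda>N M. \<mu> - \<rho> * real N + \<delta> * real M"
  obtains C where "C \<ge> 0"
    and "\<And>k m. k \<in> hlattice h \<Longrightarrow> m \<in> int_lattice \<Longrightarrow>
      norm (newton_rem h N (acoef m) k m)
      \<le> C * (1 + norm m) powr (real N + \<bar>s N M\<bar> - real M) * (1 + norm k) powr (s N M)"
proof -
  define s where "s = \<mu> - \<rho> * real N + \<delta> * real M"
  have "\<forall>\<gamma> :: 'n \<Rightarrow> nat. \<exists>C\<ge>0. \<forall>k m. k \<in> hlattice h \<longrightarrow> m \<in> int_lattice \<longrightarrow>
      norm (hDelta h \<gamma> (acoef m) k) * (1 + norm m) ^ M
      \<le> C * (1 + norm k) powr (\<mu> - \<rho> * real (mabs \<gamma>) + \<delta> * real M)"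
    by (rule allI) (metis coefficient_decay)
  then obtain C where C0: "\<And>\<gamma>. C \<gamma> \<ge> 0" and C: "\<And>\<gamma> k m. k \<in> hlattice h \<Longrightarrow> m \<in> int_lattice \<Longrightarrow>
      norm (hDelta h \<gamma> (acoef m) k) * (1 + norm m) ^ M
      \<le> C \<gamma> * (1 + norm k) powr (\<mu> - \<rho> * real (mabs \<gamma>) + \<delta> * real M)"
    by metis
  define D where "D = (\<Sum>\<gamma> | mabs \<gamma> < Suc N. C \<gamma>)"
  have D0: "D \<ge> 0" unfolding D_def by (intro sum_nonneg C0)
  \<comment> \<open>Chosen such that 1 + R, which is at most n |m| + 2, is bounded by c (1 + |m|);
    this controls the number of steps as well as the length of all shifts.\<close>
  define c where "c = real CARD('n) + 2"
  have "norm (newton_rem h N (acoef m) k m)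
      \<le> (c ^ N * c powr \<bar>s\<bar> * D) * (1 + norm m) powr (real N + \<bar>s\<bar> - real M) * (1 + norm k) powr s"
    if k: "k \<in> hlattice h" and m: "m \<in> int_lattice" for k m
  proof -
    define R where "R = nat \<lceil>\<Sum>j\<in>UNIV. \<bar>m $ j\<bar>\<rceil>"
    have l1: "(\<Sum>j\<in>UNIV. \<bar>m $ j\<bar>) \<le> real CARD('n) * norm m"
      using sum_bounded_above[of "UNIV :: 'n set" "\<lambda>j. \<bar>m $ j\<bar>" "norm m"] component_le_norm_cart by force
    have l0: "0 \<le> (\<Sum>j\<in>UNIV. \<bar>m $ j\<bar>)" by (intro sum_nonneg) simp
    have R1: "(\<Sum>j\<in>UNIV. \<bar>m $ j\<bar>) \<le> R" unfolding R_def by linarith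
    have "real R \<le> (\<Sum>j\<in>UNIV. \<bar>m $ j\<bar>) + 1" unfolding R_def using l0 by linarith
    then have R2: "1 + real R \<le> c * (1 + norm m)"
    proof -
      have "c * (1 + norm m) = real CARD('n) * norm m + 2 * norm m + real CARD('n) + 2"
        by (simp add: c_def algebra_simps)
      then show ?thesis using l1 norm_ge_zero[of m] \<open>real R \<le> _\<close> by linarith
    qed
    define B where "B = D / (1 + norm m) ^ M * ((1 + norm k) powr s * (c * (1 + norm m)) powr \<bar>s\<bar>)"
    have B0: "B \<ge> 0" using D0 by (simp add: B_def)
    have "norm (newton_rem h N (acoef m) k m) \<le> (h * R) ^ N * B"
    proof (rule newton_rem_bound[OF h(1) B0 _ m R1])
      fix \<gamma> :: "'n \<Rightarrow> nat" and z :: "real ^ 'n::_"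
      assume \<gamma>: "mabs \<gamma> = N" and z: "z \<in> int_lattice" "(\<Sum>j\<in>UNIV. \<bar>z $ j\<bar>) \<le> R"
      have "norm (h *\<^sub>R z) \<le> norm z" using h by (simp add: mult_left_le_one_le)
      also have "\<dots> \<le> R" using z(2) norm_le_l1_cart[of z] by linarith
      finally have hz: "1 + norm (h *\<^sub>R z) \<le> c * (1 + norm m)" using R2 by linarith
      have "(1 + norm (k + h *\<^sub>R z)) powr s \<le> (1 + norm k) powr s * (1 + norm (h *\<^sub>R z)) powr \<bar>s\<bar>"
        by (rule peetre)
      also have "\<dots> \<le> (1 + norm k) powr s * (c * (1 + norm m)) powr \<bar>s\<bar>"
        using hz by (intro mult_left_mono powr_mono2) auto
      finally have p: "(1 + norm (k + h *\<^sub>R z)) powr s \<le> (1 + norm k) powr s * (c * (1 + norm m)) powr \<bar>s\<bar>" .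
      have "norm (hDelta h \<gamma> (acoef m) (k + h *\<^sub>R z)) * (1 + norm m) ^ M \<le> C \<gamma> * (1 + norm (k + h *\<^sub>R z)) powr s"
        using C[OF hlattice_shift[OF k z(1)] m, of \<gamma>] by (simp add: \<gamma> s_def)
      also have "\<dots> \<le> D * ((1 + norm k) powr s * (c * (1 + norm m)) powr \<bar>s\<bar>)"
        using C0 p D0 \<gamma> unfolding D_def
        by (intro mult_mono member_le_sum) (auto simp: finite_mabs_less)
      finally show "norm (hDelta h \<gamma> (acoef m) (k + h *\<^sub>R z)) \<le> B"
        unfolding B_def by (simp add: field_simps add_pos_nonneg)
    qed
    also have "\<dots> \<le> (c * (1 + norm m)) ^ N * B"
    proof (intro mult_right_mono power_mono B0)
      have "h * R \<le> R" using h by (simp add: mult_left_le_one_le)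
      then show "h * real R \<le> c * (1 + norm m)" using R2 by linarith
    qed (use h in simp)
    also have "\<dots> = (c ^ N * c powr \<bar>s\<bar> * D) * ((1 + norm m) ^ N * (1 + norm m) powr \<bar>s\<bar> / (1 + norm m) ^ M) * (1 + norm k) powr s"
      by (simp add: B_def power_mult_distrib powr_mult c_def)
    also have "(1 + norm m) ^ N * (1 + norm m) powr \<bar>s\<bar> / (1 + norm m) ^ M = (1 + norm m) powr (real N + \<bar>s\<bar> - real M)"
      by (simp add: powr_add powr_diff powr_realpow add_pos_nonneg)
    finally show ?thesis .
  qed
  moreover have "c ^ N * c powr \<bar>s\<bar> * D \<ge> 0" using D0 by (simp add: c_def)
  ultimately show thesis using that unfolding s_def assms by blast
qed

text \<open>Since \<open>(1 + \<delta>) M\<close> has to exceed \<open>(1 + \<rho>) N\<close>, the exponent of \<open>1 + |k|\<close> is about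
  \<open>- N (\<rho> - \<delta>) / (1 + \<delta>)\<close>; this is why Peetre's inequality suffices and no splitting into small
  and large frequencies is needed.\<close>

lemma exponent_choice:
  obtains N M :: nat where "N \<ge> N0" "\<mu> - \<rho> * real N + \<delta> * real M \<le> - A"
    "real N + \<bar>\<mu> - \<rho> * real N + \<delta> * real M\<bar> - real M \<le> - P"
proof -
  define c where "c = (\<rho> - \<delta>) / (1 + \<delta>)"
  have c: "c > 0" using \<delta> by (simp add: c_def)
  \<comment> \<open>Everything in the final order that does not depend on \<open>N\<close>; the last
    summand pays for rounding \<open>x\<close> up to an integer.\<close>
  define \<kappa> where "\<kappa> = \<mu> + \<delta> * ((P - \<mu>) / (1 + \<delta>)) + \<delta>"
  \<comment> \<open>The bound by \<mu> - P makes \<open>x\<close> nonnegative, and the bound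
    involving \<open>A\<close> makes the final order at most - max A 0.\<close>
  define N where "N = max N0 (nat \<lceil>max (max 0 (\<mu> - P)) ((\<kappa> + max A 0) / c)\<rceil>)"
  have N: "real N \<ge> \<mu> - P" "real N \<ge> (\<kappa> + max A 0) / c" "N \<ge> N0"
    unfolding N_def by linarith+
  \<comment> \<open>The real solution of (1 + \<delta>) x = (1 + \<rho>) N + P - \<mu>, which is the
    third claim with equality once the absolute value is resolved.\<close>
  define x where "x = (real N * (1 + \<rho>) + P - \<mu>) / (1 + \<delta>)"
  have "real N * \<rho> \<ge> 0" using \<delta> by simp
  then have "real N * (1 + \<rho>) + P - \<mu> \<ge> 0" using N(1) unfolding ring_distribs by linarith
  then have x0: "x \<ge> 0" unfolding x_def using \<delta> by simp
  define M where "M = nat \<lceil>x\<rceil>"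
  have M: "x \<le> real M" "real M \<le> x + 1" unfolding M_def using x0 by linarith+
  have "\<mu> - \<rho> * real N + \<delta> * real M \<le> \<mu> - \<rho> * real N + \<delta> * (x + 1)"
    using M(2) \<delta> by (intro add_left_mono mult_left_mono) auto
  also have "\<dots> = \<kappa> - c * real N"
  proof -
    have "x = real N * ((1 + \<rho>) / (1 + \<delta>)) + (P - \<mu>) / (1 + \<delta>)"
      by (simp add: x_def add_diff_eq flip: add_divide_distrib)
    moreover have "\<delta> * ((1 + \<rho>) / (1 + \<delta>)) = \<rho> - c"
      using \<delta> by (simp add: c_def field_simps)
    ultimately have "\<delta> * x = real N * (\<rho> - c) + \<delta> * ((P - \<mu>) / (1 + \<delta>))"
      by (metis distrib_left mult.left_commute)
    then show ?thesis unfolding \<kappa>_def by (simp add: algebra_simps)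
  qed
  also have "\<dots> \<le> - max A 0"
    using N(2) c by (simp add: field_simps)
  \<comment> \<open>The maximum with 0 ensures that the order is not positive, so that the absolute
    value opens with a minus sign.\<close>
  finally have s: "\<mu> - \<rho> * real N + \<delta> * real M \<le> - max A 0" .
  have "(1 + \<delta>) * x = real N * (1 + \<rho>) + P - \<mu>" using \<delta> by (simp add: x_def)
  moreover have "(1 + \<delta>) * x \<le> (1 + \<delta>) * real M" using M(1) \<delta> by (intro mult_left_mono) auto
  ultimately have "real N * (1 + \<rho>) + P - \<mu> \<le> (1 + \<delta>) * real M" by simp
  then have e: "real N + \<bar>\<mu> - \<rho> * real N + \<delta> * real M\<bar> - real M \<le> - P"
    using s by (simp add: algebra_simps)
  have "\<mu> - \<rho> * real N + \<delta> * real M \<le> - A" using s by linarith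
  from that[OF N(3) this e] show thesis .
qed

definition adj :: "real ^ 'n::_ \<Rightarrow> real ^ 'n::_ \<Rightarrow> complex" where
  "adj k = fseries (\<lambda>m. acoef m (k + h *\<^sub>R m))"

text \<open>The remainder with \<open>N = 0\<close> is the shifted coefficient itself. The price of
  the shift is at most |\<mu>| + \<delta> M, and since \<delta> < 1 the decay of order
  \<open>M\<close> outweighs it for large \<open>M\<close>.\<close>

lemma rapid_adj:
  assumes k: "k \<in> hlattice h"
  shows "rapid (\<lambda>m. acoef m (k + h *\<^sub>R m))"
  unfolding rapid_def
proof
  fix p :: nat
  define M where "M = nat \<lceil>(real p + \<bar>\<mu>\<bar>) / (1 - \<delta>)\<rceil>"
  have "(real p + \<bar>\<mu>\<bar>) / (1 - \<delta>) \<le> M" unfolding M_def by linarith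
  then have M: "real p + \<bar>\<mu>\<bar> \<le> M * (1 - \<delta>)" using \<delta> by (simp add: field_simps)
  have "\<bar>\<mu> + \<delta> * real M\<bar> \<le> \<bar>\<mu>\<bar> + \<delta> * real M" using \<delta> by (simp add: abs_triangle_ineq[THEN order_trans])
  then have e: "\<bar>\<mu> + \<delta> * real M\<bar> - real M \<le> - real p" using M by (simp add: algebra_simps)
  obtain C where C: "C \<ge> 0" "\<And>k m. k \<in> hlattice h \<Longrightarrow> m \<in> int_lattice \<Longrightarrow>
      norm (newton_rem h 0 (acoef m) k m)
      \<le> C * (1 + norm m) powr (real 0 + \<bar>\<mu> - \<rho> * real 0 + \<delta> * real M\<bar> - real M)
        * (1 + norm k) powr (\<mu> - \<rho> * real 0 + \<delta> * real M)"
    using newton_rem_decay[of 0 M] by blast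
  have "norm (acoef m (k + h *\<^sub>R m)) * (1 + norm m) ^ p \<le> C * (1 + norm k) powr (\<mu> + \<delta> * real M)"
    if m: "m \<in> int_lattice" for m
  proof -
    have "norm (acoef m (k + h *\<^sub>R m)) \<le> C * (1 + norm m) powr (\<bar>\<mu> + \<delta> * real M\<bar> - real M) * (1 + norm k) powr (\<mu> + \<delta> * real M)"
      using C(2)[OF k m] by (simp add: newton_rem_def)
    also have "\<dots> \<le> C * (1 + norm m) powr (- real p) * (1 + norm k) powr (\<mu> + \<delta> * real M)"
      using C(1) e by (intro mult_left_mono mult_right_mono powr_mono) auto
    finally show ?thesis
      by (simp add: powr_minus powr_realpow add_pos_nonneg field_simps)
  qed
  then show "\<exists>K. \<forall>m\<in>int_lattice. norm (acoef m (k + h *\<^sub>R m)) * (1 + norm m) ^ p \<le> K" by blast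
qed

lemma smooth_adj: "k \<in> hlattice h \<Longrightarrow> smooth_torus (adj k)"
  unfolding adj_def by (intro smooth_torus_fseries rapid_adj)

lemma tcoef_adj: "k \<in> hlattice h \<Longrightarrow> m \<in> int_lattice \<Longrightarrow> tcoef (adj k) m = acoef m (k + h *\<^sub>R m)"
  unfolding adj_def using rapid_summable[OF rapid_adj, of k 0] by (subst tcoef_fseries) auto

definition expansion_term :: "('n \<Rightarrow> nat) \<Rightarrow> real ^ 'n::_ \<Rightarrow> real ^ 'n::_ \<Rightarrow> complex" where
  "expansion_term \<gamma> k \<theta> = 1 / of_nat (mfact \<gamma>) *
     hDelta h \<gamma> (\<lambda>k'. torus_D h \<gamma> (\<lambda>\<theta>'. cnj (\<sigma> k' \<theta>')) \<theta>) k"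

definition expansion_rem :: "nat \<Rightarrow> real ^ 'n::_ \<Rightarrow> real ^ 'n::_ \<Rightarrow> complex" where
  "expansion_rem N k \<theta> = adj k \<theta> - (\<Sum>\<gamma> | mabs \<gamma> < N. expansion_term \<gamma> k \<theta>)"

lemma smooth_torus_D_cnj: "k \<in> hlattice h \<Longrightarrow> smooth_torus (torus_D h \<gamma> (\<lambda>\<theta>. cnj (\<sigma> k \<theta>)))"
  by (intro smooth_torus_torus_D smooth_torus_cnj smooth_\<sigma>)

lemma
  assumes k: "k \<in> hlattice h"
  shows smooth_expansion_term: "smooth_torus (expansion_term \<gamma> k)"
    and tcoef_expansion_term: "m \<in> int_lattice \<Longrightarrow> tcoef (expansion_term \<gamma> k) m
      = of_real (h ^ mabs \<gamma> * mbinom m \<gamma>) * hDelta h \<gamma> (acoef m) k"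
proof -
  note s = smooth_torus_hDelta[OF k smooth_torus_D_cnj[where \<gamma> = \<gamma>], where \<alpha> = \<gamma>]
  have e: "expansion_term \<gamma> k = (\<lambda>\<theta>. 1 / of_nat (mfact \<gamma>) *
     hDelta h \<gamma> (\<lambda>k'. torus_D h \<gamma> (\<lambda>\<theta>'. cnj (\<sigma> k' \<theta>')) \<theta>) k)"
    by (simp add: expansion_term_def fun_eq_iff)
  show "smooth_torus (expansion_term \<gamma> k)"
    unfolding e by (rule smooth_torus_cmult[OF s])
  assume m: "m \<in> int_lattice"
  have "hDelta h \<gamma> (\<lambda>k'. tcoef (torus_D h \<gamma> (\<lambda>\<theta>'. cnj (\<sigma> k' \<theta>'))) m) k
      = hDelta h \<gamma> (\<lambda>k'. of_real (h ^ mabs \<gamma> * ffact m \<gamma>) * acoef m k') k"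
    by (rule hDelta_cong[OF k]) (simp add: tcoef_torus_D smooth_torus_cnj smooth_\<sigma> m acoef_def)
  then have "tcoef (\<lambda>\<theta>. hDelta h \<gamma> (\<lambda>k'. torus_D h \<gamma> (\<lambda>\<theta>'. cnj (\<sigma> k' \<theta>')) \<theta>) k) m
      = of_real (h ^ mabs \<gamma> * ffact m \<gamma>) * hDelta h \<gamma> (acoef m) k"
    using tcoef_hDelta[OF k smooth_torus_D_cnj[where \<gamma> = \<gamma>] m, where \<alpha> = \<gamma>] by (simp only: hDelta_cmult)
  then have "tcoef (expansion_term \<gamma> k) m
      = 1 / of_nat (mfact \<gamma>) * (of_real (h ^ mabs \<gamma> * ffact m \<gamma>) * hDelta h \<gamma> (acoef m) k)"
    unfolding e tcoef_cmult by simp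
  then show "tcoef (expansion_term \<gamma> k) m = of_real (h ^ mabs \<gamma> * mbinom m \<gamma>) * hDelta h \<gamma> (acoef m) k"
    by (simp add: mbinom_ffact)
qed

lemma
  assumes k: "k \<in> hlattice h"
  shows smooth_expansion_rem: "smooth_torus (expansion_rem N k)"
    and tcoef_expansion_rem: "m \<in> int_lattice \<Longrightarrow> tcoef (expansion_rem N k) m = newton_rem h N (acoef m) k m"
proof -
  note t = smooth_expansion_term[OF k]
  have s: "smooth_torus (\<lambda>\<theta>. \<Sum>\<gamma> | mabs \<gamma> < N. expansion_term \<gamma> k \<theta>)"
    by (intro smooth_torus_sum t)
  have e: "expansion_rem N k = (\<lambda>\<theta>. adj k \<theta> - (\<Sum>\<gamma> | mabs \<gamma> < N. expansion_term \<gamma> k \<theta>))"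
    by (simp add: expansion_rem_def fun_eq_iff)
  show "smooth_torus (expansion_rem N k)"
    unfolding e by (intro smooth_torus_diff smooth_adj k s)
  assume m: "m \<in> int_lattice"
  show "tcoef (expansion_rem N k) m = newton_rem h N (acoef m) k m"
    unfolding e newton_rem_def
    using smooth_torus_torus_fun[OF smooth_adj[OF k]] smooth_torus_torus_fun[OF s] smooth_torus_torus_fun[OF t] m k
    by (simp add: tcoef_diff tcoef_sum(2) finite_mabs_less tcoef_adj tcoef_expansion_term)
qed

end

section \<open>Symbol estimates for the expansion terms and the remainder\<close>

context adjoint_symbol
begin

text \<open>One seminorm bound of the symbol class with the exponent as a free parameter, so that
  terms of different orders can be weakened to a common exponent and added.\<close>

definition estimate :: "real \<Rightarrow> ('n \<Rightarrow> nat) \<Rightarrow> ('n \<Rightarrow> nat) \<Rightarrow> (real ^ 'n::_ \<Rightarrow> real ^ 'n::_ \<Rightarrow> complex) \<Rightarrow> bool" where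
  "estimate s \<alpha> \<beta> \<tau> \<longleftrightarrow> (\<exists>C>0. \<forall>k\<in>hlattice h. \<forall>\<theta>.
     norm (torus_D h \<beta> (\<lambda>\<theta>'. hDelta h \<alpha> (\<lambda>k'. \<tau> k' \<theta>') k) \<theta>) \<le> C * (1 + norm k) powr s)"

lemma estimateI:
  assumes "\<And>k \<theta>. k \<in> hlattice h \<Longrightarrow>
    norm (torus_D h \<beta> (\<lambda>\<theta>'. hDelta h \<alpha> (\<lambda>k'. \<tau> k' \<theta>') k) \<theta>) \<le> C * (1 + norm k) powr s"
  shows "estimate s \<alpha> \<beta> \<tau>"
  unfolding estimate_def
proof (intro exI[of _ "\<bar>C\<bar> + 1"] conjI ballI allI)
  fix k :: "real ^ 'n::_" and \<theta> assume "k \<in> hlattice h"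
  note assms[OF this, of \<theta>]
  also have "C * (1 + norm k) powr s \<le> (\<bar>C\<bar> + 1) * (1 + norm k) powr s"
    by (rule mult_right_mono) auto
  finally show "norm (torus_D h \<beta> (\<lambda>\<theta>'. hDelta h \<alpha> (\<lambda>k'. \<tau> k' \<theta>') k) \<theta>) \<le> (\<bar>C\<bar> + 1) * (1 + norm k) powr s" .
qed simp

lemma estimate_mono:
  assumes "estimate s \<alpha> \<beta> \<tau>" "s \<le> t"
  shows "estimate t \<alpha> \<beta> \<tau>"
proof -
  obtain C where C: "C > 0" "\<And>k \<theta>. k \<in> hlattice h \<Longrightarrow>
     norm (torus_D h \<beta> (\<lambda>\<theta>'. hDelta h \<alpha> (\<lambda>k'. \<tau> k' \<theta>') k) \<theta>) \<le> C * (1 + norm k) powr s"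
    using assms(1) unfolding estimate_def by blast
  show ?thesis
  proof (rule estimateI)
    fix k :: "real ^ 'n::_" and \<theta> assume "k \<in> hlattice h"
    note C(2)[OF this, of \<theta>]
    also have "C * (1 + norm k) powr s \<le> C * (1 + norm k) powr t"
      using C(1) assms(2) by (intro mult_left_mono powr_mono) auto
    finally show "norm (torus_D h \<beta> (\<lambda>\<theta>'. hDelta h \<alpha> (\<lambda>k'. \<tau> k' \<theta>') k) \<theta>) \<le> C * (1 + norm k) powr t" .
  qed
qed

lemma estimate_add:
  assumes s1: "\<And>k. k \<in> hlattice h \<Longrightarrow> smooth_torus (\<tau>1 k)" and s2: "\<And>k. k \<in> hlattice h \<Longrightarrow> smooth_torus (\<tau>2 k)"
    and e: "estimate s \<alpha> \<beta> \<tau>1" "estimate s \<alpha> \<beta> \<tau>2"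
  shows "estimate s \<alpha> \<beta> (\<lambda>k \<theta>. \<tau>1 k \<theta> + \<tau>2 k \<theta>)"
proof -
  obtain C D where C: "\<And>k \<theta>. k \<in> hlattice h \<Longrightarrow>
     norm (torus_D h \<beta> (\<lambda>\<theta>'. hDelta h \<alpha> (\<lambda>k'. \<tau>1 k' \<theta>') k) \<theta>) \<le> C * (1 + norm k) powr s"
    and D: "\<And>k \<theta>. k \<in> hlattice h \<Longrightarrow>
     norm (torus_D h \<beta> (\<lambda>\<theta>'. hDelta h \<alpha> (\<lambda>k'. \<tau>2 k' \<theta>') k) \<theta>) \<le> D * (1 + norm k) powr s"
    using e unfolding estimate_def by blast
  show ?thesis
  proof (rule estimateI)
    fix k :: "real ^ 'n::_" and \<theta> assume k: "k \<in> hlattice h"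
    let ?f1 = "\<lambda>\<theta>'. hDelta h \<alpha> (\<lambda>k'. \<tau>1 k' \<theta>') k" and ?f2 = "\<lambda>\<theta>'. hDelta h \<alpha> (\<lambda>k'. \<tau>2 k' \<theta>') k"
    have f: "smooth_torus ?f1" "smooth_torus ?f2" by (intro smooth_torus_hDelta k s1 s2; assumption)+
    have "torus_D h \<beta> (\<lambda>\<theta>'. ?f1 \<theta>' + ?f2 \<theta>') = (\<lambda>\<theta>. torus_D h \<beta> ?f1 \<theta> + torus_D h \<beta> ?f2 \<theta>)"
    proof (rule smooth_torus_eqI)
      fix m :: "real ^ 'n::_" assume "m \<in> int_lattice"
      then show "tcoef (torus_D h \<beta> (\<lambda>\<theta>'. ?f1 \<theta>' + ?f2 \<theta>')) m = tcoef (\<lambda>\<theta>. torus_D h \<beta> ?f1 \<theta> + torus_D h \<beta> ?f2 \<theta>) m"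
        using f by (simp add: tcoef_torus_D smooth_torus_add tcoef_add smooth_torus_torus_fun smooth_torus_torus_D distrib_left)
    qed (intro smooth_torus_torus_D smooth_torus_add f)+
    then have "norm (torus_D h \<beta> (\<lambda>\<theta>'. hDelta h \<alpha> (\<lambda>k'. \<tau>1 k' \<theta>' + \<tau>2 k' \<theta>') k) \<theta>)
        = norm (torus_D h \<beta> ?f1 \<theta> + torus_D h \<beta> ?f2 \<theta>)"
      by (simp add: hDelta_plus)
    also have "\<dots> \<le> (C + D) * (1 + norm k) powr s"
      unfolding distrib_right using C[OF k] D[OF k] by (intro norm_triangle_le add_mono)
    finally show "norm (torus_D h \<beta> (\<lambda>\<theta>'. hDelta h \<alpha> (\<lambda>k'. \<tau>1 k' \<theta>' + \<tau>2 k' \<theta>') k) \<theta>) \<le> (C + D) * (1 + norm k) powr s" .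
  qed
qed

lemma torus_D_zero_fun: "torus_D h \<beta> (\<lambda>_. 0) = (\<lambda>_ :: real ^ 'n::_. 0)"
proof (rule smooth_torus_eqI)
  fix m :: "real ^ 'n::_" assume "m \<in> int_lattice"
  moreover have "tcoef (\<lambda>_ :: real ^ 'n::_. 0) m = 0" by (simp add: tcoef_def)
  ultimately show "tcoef (torus_D h \<beta> (\<lambda>_. 0)) m = tcoef (\<lambda>_. 0) m"
    by (simp add: tcoef_torus_D smooth_torus_0)
qed (intro smooth_torus_torus_D smooth_torus_0)+

lemma estimate_sum:
  assumes "finite A" "\<And>i k. i \<in> A \<Longrightarrow> k \<in> hlattice h \<Longrightarrow> smooth_torus (\<tau> i k)"
    and "\<And>i. i \<in> A \<Longrightarrow> estimate s \<alpha> \<beta> (\<tau> i)"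
  shows "estimate s \<alpha> \<beta> (\<lambda>k \<theta>. \<Sum>i\<in>A. \<tau> i k \<theta>)"
  using assms
proof (induction A rule: finite_induct)
  case empty
  show ?case
    \<comment> \<open>Multiplication by 0 shows that \<open>hDelta\<close> annihilates the zero
      function.\<close>
    using hDelta_cmult[of h \<alpha> 0 "\<lambda>_. 0"]
    by (intro estimateI[of _ _ _ 0]) (simp add: torus_D_zero_fun)
next
  case (insert i A)
  then have "estimate s \<alpha> \<beta> (\<lambda>k \<theta>. \<tau> i k \<theta> + (\<Sum>i\<in>A. \<tau> i k \<theta>))"
    by (intro estimate_add smooth_torus_sum) auto
  then show ?case using insert by simp
qed

text \<open>Composed toroidal derivatives of \<open>cnj \<circ> \<sigma>\<close> are conjugates of linear combinations of toroidal
  derivatives of \<open>\<sigma>\<close>.\<close>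

lemma ffact_comb_estimate:
  assumes "ffact_comb d q"
  shows "\<exists>C g. \<forall>k\<in>hlattice h. smooth_torus (g k) \<and>
    (\<forall>m\<in>int_lattice. tcoef (g k) m = of_real (q m) * tcoef (\<lambda>\<theta>'. hDelta h \<alpha> (\<lambda>k'. \<sigma> k' \<theta>') k) m) \<and>
    (\<forall>\<theta>. norm (g k \<theta>) \<le> C * (1 + norm k) powr (\<mu> - \<rho> * real (mabs \<alpha>) + \<delta> * real d))"
  using assms
proof (induction rule: ffact_comb.induct)
  case (ffact_comb_base \<nu> c)
  let ?f = "\<lambda>k \<theta>'. hDelta h \<alpha> (\<lambda>k'. \<sigma> k' \<theta>') k"
  have f: "smooth_torus (?f k)" if "k \<in> hlattice h" for k
    using that by (rule smooth_torus_hDelta[OF _ smooth_\<sigma>])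
  obtain B where B: "B > 0" "\<And>k \<theta>. k \<in> hlattice h \<Longrightarrow> norm (torus_D h \<nu> (?f k) \<theta>)
        \<le> B * (1 + norm k) powr (\<mu> - \<rho> * real (mabs \<alpha>) + \<delta> * real (mabs \<nu>))"
    using \<sigma> unfolding symbol_class_def mem_Collect_eq by metis
  \<comment> \<open>The quotient cancels the power of \<open>h\<close> in the multiplier of
    \<open>torus_D h \<nu>\<close>.\<close>
  let ?c = "complex_of_real (c / h ^ mabs \<nu>)"
  show ?case
  proof (rule exI[of _ "norm ?c * B"], rule exI[of _ "\<lambda>k \<theta>. ?c * torus_D h \<nu> (?f k) \<theta>"], intro ballI conjI allI)
    fix k :: "real ^ 'n::_" and \<theta> assume k: "k \<in> hlattice h"
    show "smooth_torus (\<lambda>\<theta>. ?c * torus_D h \<nu> (?f k) \<theta>)"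
      by (intro smooth_torus_cmult smooth_torus_torus_D f k)
    show "tcoef (\<lambda>\<theta>. ?c * torus_D h \<nu> (?f k) \<theta>) m = of_real (c * ffact m \<nu>) * tcoef (?f k) m"
      if "m \<in> int_lattice" for m
      unfolding tcoef_cmult tcoef_torus_D[OF f[OF k] that] using h by simp
    have "norm (?c * torus_D h \<nu> (?f k) \<theta>) \<le> norm ?c * (B * (1 + norm k) powr (\<mu> - \<rho> * real (mabs \<alpha>) + \<delta> * real (mabs \<nu>)))"
      unfolding norm_mult by (intro mult_left_mono B k) simp
    also have "\<dots> \<le> norm ?c * (B * (1 + norm k) powr (\<mu> - \<rho> * real (mabs \<alpha>) + \<delta> * real d))"
      using ffact_comb_base \<delta> B(1) by (intro mult_left_mono powr_mono add_left_mono) auto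
    finally show "norm (?c * torus_D h \<nu> (?f k) \<theta>)
        \<le> (norm ?c * B) * (1 + norm k) powr (\<mu> - \<rho> * real (mabs \<alpha>) + \<delta> * real d)"
      by (simp only: mult.assoc)
  qed
next
  case (ffact_comb_add p q)
  let ?f = "\<lambda>k \<theta>'. hDelta h \<alpha> (\<lambda>k'. \<sigma> k' \<theta>') k"
  let ?w = "\<lambda>k :: real ^ 'n::_. (1 + norm k) powr (\<mu> - \<rho> * real (mabs \<alpha>) + \<delta> * real d)"
  from ffact_comb_add.IH obtain C1 g1 C2 g2 where
    g1: "\<forall>k\<in>hlattice h. smooth_torus (g1 k) \<and>
      (\<forall>m\<in>int_lattice. tcoef (g1 k) m = of_real (p m) * tcoef (?f k) m) \<and> (\<forall>\<theta>. norm (g1 k \<theta>) \<le> C1 * ?w k)"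
    and g2: "\<forall>k\<in>hlattice h. smooth_torus (g2 k) \<and>
      (\<forall>m\<in>int_lattice. tcoef (g2 k) m = of_real (q m) * tcoef (?f k) m) \<and> (\<forall>\<theta>. norm (g2 k \<theta>) \<le> C2 * ?w k)"
    by blast
  show ?case
  proof (rule exI[of _ "C1 + C2"], rule exI[of _ "\<lambda>k \<theta>. g1 k \<theta> + g2 k \<theta>"], intro ballI conjI allI)
    fix k :: "real ^ 'n::_" and \<theta> assume k: "k \<in> hlattice h"
    note 1 = bspec[OF g1 k] and 2 = bspec[OF g2 k]
    show "smooth_torus (\<lambda>\<theta>. g1 k \<theta> + g2 k \<theta>)" using 1 2 by (intro smooth_torus_add) auto
    show "tcoef (\<lambda>\<theta>. g1 k \<theta> + g2 k \<theta>) m = of_real (p m + q m) * tcoef (?f k) m" if "m \<in> int_lattice" for m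
      using that 1 2 by (simp add: tcoef_add smooth_torus_torus_fun distrib_right)
    show "norm (g1 k \<theta> + g2 k \<theta>) \<le> (C1 + C2) * ?w k"
      unfolding distrib_right using 1 2 by (intro norm_triangle_le add_mono) auto
  qed
qed

text \<open>The differences of order \<open>\<gamma>\<close> gain \<open>\<rho>\<close> each, the
  toroidal derivatives of order \<open>\<gamma>\<close> lose \<open>\<delta>\<close> each. The
  product of the multipliers for \<open>\<beta>\<close> and \<open>\<gamma>\<close> is in general
  not a single falling factorial, which is why \<open>ffact_comb\<close> is needed.\<close>

lemma estimate_expansion_term:
  "estimate (\<mu> - \<rho> * real (mabs \<alpha> + mabs \<gamma>) + \<delta> * real (mabs \<beta> + mabs \<gamma>)) \<alpha> \<beta> (expansion_term \<gamma>)"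
proof -
  \<comment> \<open>\<open>q (- m)\<close> is the multiplier with which
    \<open>torus_D h \<beta>\<close> and the term \<open>\<gamma>\<close> act on the conjugated
    symbol at frequency m; on \<sigma> itself the frequency is -m.\<close>
  define q where "q m = ffact (- m) \<beta> * (h ^ mabs \<beta> * h ^ mabs \<gamma> / mfact \<gamma> * ffact (- m) \<gamma>)" for m :: "real ^ 'n::_"
  have one: "ffact_comb 0 (\<lambda>m :: real ^ 'n::_. h ^ mabs \<beta> * h ^ mabs \<gamma> / mfact \<gamma>)"
    using ffact_comb_base[of "\<lambda>_. 0" 0 "h ^ mabs \<beta> * h ^ mabs \<gamma> / mfact \<gamma>"] by simp
  have "ffact_comb (mabs \<gamma> + mabs \<beta>) q"
    using ffact_comb_ffact_minus[OF ffact_comb_ffact_minus[OF one, of \<gamma>], of \<beta>]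
    by (simp add: q_def[abs_def] mult_ac)
  from ffact_comb_estimate[OF this, of "\<lambda>j. \<alpha> j + \<gamma> j"] obtain C g where
    g: "\<forall>k\<in>hlattice h. smooth_torus (g k) \<and>
      (\<forall>m\<in>int_lattice. tcoef (g k) m = of_real (q m) * tcoef (\<lambda>\<theta>'. hDelta h (\<lambda>j. \<alpha> j + \<gamma> j) (\<lambda>k'. \<sigma> k' \<theta>') k) m) \<and>
      (\<forall>\<theta>. norm (g k \<theta>) \<le> C * (1 + norm k) powr (\<mu> - \<rho> * real (mabs \<alpha> + mabs \<gamma>) + \<delta> * real (mabs \<gamma> + mabs \<beta>)))"
    unfolding mabs_add by blast
  show ?thesis
  proof (rule estimateI)
    fix k :: "real ^ 'n::_" and \<theta> assume k: "k \<in> hlattice h"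
    note g = bspec[OF g k]
    let ?f = "\<lambda>\<theta>'. hDelta h \<alpha> (\<lambda>k'. expansion_term \<gamma> k' \<theta>') k"
    have f: "smooth_torus ?f" by (rule smooth_torus_hDelta[OF k smooth_expansion_term])
    have "torus_D h \<beta> ?f = (\<lambda>\<theta>. cnj (g k \<theta>))"
    proof (rule smooth_torus_eqI)
      fix m :: "real ^ 'n::_" assume m: "m \<in> int_lattice"
      have "hDelta h \<alpha> (\<lambda>k'. tcoef (expansion_term \<gamma> k') m) k
          = hDelta h \<alpha> (\<lambda>k'. of_real (h ^ mabs \<gamma> * mbinom m \<gamma>) * hDelta h \<gamma> (acoef m) k') k"
        by (rule hDelta_cong[OF k]) (rule tcoef_expansion_term[OF _ m])
      then have 1: "tcoef ?f m = of_real (h ^ mabs \<gamma> * mbinom m \<gamma>) * hDelta h (\<lambda>j. \<alpha> j + \<gamma> j) (acoef m) k"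
        using tcoef_hDelta[OF k smooth_expansion_term[where \<gamma> = \<gamma>] m, where \<alpha> = \<alpha>]
        by (simp only: hDelta_cmult hDelta_add)
      have 2: "tcoef (\<lambda>\<theta>'. hDelta h (\<lambda>j. \<alpha> j + \<gamma> j) (\<lambda>k'. \<sigma> k' \<theta>') k) (- m)
          = cnj (hDelta h (\<lambda>j. \<alpha> j + \<gamma> j) (acoef m) k)"
        using m by (simp add: tcoef_hDelta[OF k smooth_\<sigma>] acoef_eq[abs_def] hDelta_cnj)
      have "tcoef (torus_D h \<beta> ?f) m = of_real (h ^ mabs \<beta> * ffact m \<beta>) *
          (of_real (h ^ mabs \<gamma> * mbinom m \<gamma>) * hDelta h (\<lambda>j. \<alpha> j + \<gamma> j) (acoef m) k)"
        by (simp only: tcoef_torus_D[OF f m] 1)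
      also have "\<dots> = of_real (q (- m)) * hDelta h (\<lambda>j. \<alpha> j + \<gamma> j) (acoef m) k"
        by (simp add: q_def mbinom_ffact)
      also have "\<dots> = tcoef (\<lambda>\<theta>. cnj (g k \<theta>)) m"
        using g m by (simp add: tcoef_cnj 2)
      finally show "tcoef (torus_D h \<beta> ?f) m = tcoef (\<lambda>\<theta>. cnj (g k \<theta>)) m" .
    qed (use g f in \<open>auto intro: smooth_torus_torus_D smooth_torus_cnj\<close>)
    then show "norm (torus_D h \<beta> ?f \<theta>)
        \<le> C * (1 + norm k) powr (\<mu> - \<rho> * real (mabs \<alpha> + mabs \<gamma>) + \<delta> * real (mabs \<beta> + mabs \<gamma>))"
      using g by (simp add: add.commute)
  qed
qed

text \<open>\<open>hDelta h \<alpha>\<close> is expanded into translates, each handled by Peetre's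
  inequality; the gain expected from \<open>\<alpha>\<close> is obtained by taking \<open>N\<close>
  larger.\<close>

lemma estimate_expansion_rem_large:
  obtains N where "N \<ge> N0" "estimate t \<alpha> \<beta> (expansion_rem N)"
proof -
  \<comment> \<open>Of this decay in \<open>m\<close>, the part \<open>mabs \<beta>\<close> absorbs
    the multiplier of \<open>torus_D h \<beta>\<close>, and the rest is exactly
    \<open>lattice_decay\<close>.\<close>
  let ?P = "real (mabs \<beta> + 2 * CARD('n))"
  obtain N M where N: "N \<ge> N0" "\<mu> - \<rho> * real N + \<delta> * real M \<le> t"
    "real N + \<bar>\<mu> - \<rho> * real N + \<delta> * real M\<bar> - real M \<le> - ?P"
    using exponent_choice[of N0 "- t" ?P] by (metis minus_minus)
  define s where "s = \<mu> - \<rho> * real N + \<delta> * real M"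
  obtain C where C: "C \<ge> 0" and Cb: "\<And>k m. k \<in> hlattice h \<Longrightarrow> m \<in> int_lattice \<Longrightarrow>
      norm (newton_rem h N (acoef m) k m) \<le> C * (1 + norm m) powr (real N + \<bar>s\<bar> - real M) * (1 + norm k) powr s"
    unfolding s_def using newton_rem_decay[of N M] by blast
  obtain F where F: "F \<ge> 0" "\<And>m :: real ^ 'n::_. \<bar>ffact m \<beta>\<bar> \<le> F * (1 + norm m) ^ mabs \<beta>"
    using ffact_bound[of \<beta>] by metis
  obtain p w n where p: "\<And>i. p i \<in> int_lattice"
    and r: "\<And>g k. hDelta h \<alpha> g k = (\<Sum>i<n::nat. of_real (w i) * g (k + h *\<^sub>R p i))"
    by (rule hDelta_repr[of h \<alpha>]) (rule that)
  define W where "W = (\<Sum>i<n. \<bar>w i\<bar> * (1 + norm (h *\<^sub>R p i)) powr \<bar>s\<bar>)"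
  have W0: "W \<ge> 0" unfolding W_def by (intro sum_nonneg) simp
  let ?S = "infsum lattice_decay (int_lattice :: (real ^ 'n::_) set)"
  have "estimate s \<alpha> \<beta> (expansion_rem N)"
  proof (rule estimateI)
    fix k :: "real ^ 'n::_" and \<theta> assume k: "k \<in> hlattice h"
    let ?f = "\<lambda>\<theta>'. hDelta h \<alpha> (\<lambda>k'. expansion_rem N k' \<theta>') k"
    have f: "smooth_torus ?f" by (rule smooth_torus_hDelta[OF k smooth_expansion_rem])
    have "norm (torus_D h \<beta> ?f \<theta>) \<le> (F * (C * W) * (1 + norm k) powr s) * ?S"
    proof (rule norm_le_of_tcoef_bound)
      show "torus_fun (torus_D h \<beta> ?f)"
        by (intro smooth_torus_torus_fun smooth_torus_torus_D f)
      fix m :: "real ^ 'n::_" assume m: "m \<in> int_lattice"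
      let ?d = "(1 + norm m) powr (- ?P)"
      have "norm (tcoef ?f m) = norm (\<Sum>i<n. of_real (w i) * newton_rem h N (acoef m) (k + h *\<^sub>R p i) m)"
        using tcoef_hDelta[where \<tau> = "expansion_rem N", OF k smooth_expansion_rem m, where \<alpha> = \<alpha>]
        unfolding r by (simp add: tcoef_expansion_rem m hlattice_shift k p)
      also have "\<dots> \<le> (\<Sum>i<n. \<bar>w i\<bar> * (C * ?d * ((1 + norm k) powr s * (1 + norm (h *\<^sub>R p i)) powr \<bar>s\<bar>)))"
      proof (rule sum_norm_le)
        fix i
        have "norm (newton_rem h N (acoef m) (k + h *\<^sub>R p i) m)
            \<le> C * (1 + norm m) powr (real N + \<bar>s\<bar> - real M) * (1 + norm (k + h *\<^sub>R p i)) powr s"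
          by (intro Cb hlattice_shift k p m)
        also have "\<dots> \<le> C * ?d * ((1 + norm k) powr s * (1 + norm (h *\<^sub>R p i)) powr \<bar>s\<bar>)"
          using C N(3) by (intro mult_mono powr_mono peetre mult_nonneg_nonneg) (auto simp: s_def)
        finally show "norm (of_real (w i) * newton_rem h N (acoef m) (k + h *\<^sub>R p i) m)
            \<le> \<bar>w i\<bar> * (C * ?d * ((1 + norm k) powr s * (1 + norm (h *\<^sub>R p i)) powr \<bar>s\<bar>))"
          unfolding norm_mult norm_of_real by (rule mult_left_mono) simp
      qed
      also have "\<dots> = C * W * (1 + norm k) powr s * ?d"
        by (simp add: W_def sum_distrib_left sum_distrib_right mult_ac)
      finally have nf: "norm (tcoef ?f m) \<le> C * W * (1 + norm k) powr s * ?d" .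
      have "norm (tcoef (torus_D h \<beta> ?f) m) = h ^ mabs \<beta> * \<bar>ffact m \<beta>\<bar> * norm (tcoef ?f m)"
        using h by (simp add: tcoef_torus_D[OF f m] norm_mult norm_power)
      also have "\<dots> \<le> 1 * (F * (1 + norm m) ^ mabs \<beta>) * (C * W * (1 + norm k) powr s * ?d)"
        using h nf F C W0 by (intro mult_mono power_le_one) auto
      also have "\<dots> = (F * (C * W) * (1 + norm k) powr s) * ((1 + norm m) ^ mabs \<beta> * ?d)"
        by simp
      also have "(1 + norm m) ^ mabs \<beta> * ?d = lattice_decay m"
      proof -
        have pos: "1 + norm m > 0" by (simp add: add_pos_nonneg)
        have "(1 + norm m) ^ mabs \<beta> * ?d = (1 + norm m) powr (real (mabs \<beta>) + - ?P)"
          using pos by (simp only: powr_add powr_realpow)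
        also have "\<dots> = (1 + norm m) powr (- real (2 * CARD('n)))" by simp
        also have "\<dots> = lattice_decay m"
          unfolding lattice_decay_def powr_minus using pos by (simp only: powr_realpow)
        finally show ?thesis .
      qed
      finally show "norm (tcoef (torus_D h \<beta> ?f) m) \<le> (F * (C * W) * (1 + norm k) powr s) * lattice_decay m" .
    qed
    then show "norm (torus_D h \<beta> ?f \<theta>) \<le> (F * (C * W) * ?S) * (1 + norm k) powr s"
      by (simp add: mult_ac)
  qed
  then have "estimate t \<alpha> \<beta> (expansion_rem N)"
    by (rule estimate_mono) (use N(2) in \<open>simp add: s_def\<close>)
  with N(1) show thesis by (rule that)
qed

text \<open>The auxiliary length \<open>N'\<close> depends on \<open>\<alpha>\<close> and
  \<open>\<beta>\<close>, which is harmless: the splitting is an identity for every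
  \<open>N'\<close>, and the symbol class fixes its constant only after \<open>\<alpha>\<close> and
  \<open>\<beta>\<close>.\<close>

lemma estimate_expansion_rem:
  "estimate (\<mu> - real N * (\<rho> - \<delta>) - \<rho> * real (mabs \<alpha>) + \<delta> * real (mabs \<beta>)) \<alpha> \<beta> (expansion_rem N)"
    (is "estimate ?t \<alpha> \<beta> _")
proof -
  obtain N' where N': "N' \<ge> N" "estimate ?t \<alpha> \<beta> (expansion_rem N')"
    by (rule estimate_expansion_rem_large)
  let ?A = "{\<gamma> :: 'n \<Rightarrow> nat. mabs \<gamma> < N'} - {\<gamma>. mabs \<gamma> < N}"
  have eq: "expansion_rem N = (\<lambda>k \<theta>. expansion_rem N' k \<theta> + (\<Sum>\<gamma>\<in>?A. expansion_term \<gamma> k \<theta>))"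
  proof (intro ext)
    fix k \<theta>
    have "(\<Sum>\<gamma> | mabs \<gamma> < N'. expansion_term \<gamma> k \<theta>)
        = (\<Sum>\<gamma>\<in>?A. expansion_term \<gamma> k \<theta>) + (\<Sum>\<gamma> | mabs \<gamma> < N. expansion_term \<gamma> k \<theta>)"
      using N'(1) by (intro sum.subset_diff) (auto simp: finite_mabs_less)
    then show "expansion_rem N k \<theta> = expansion_rem N' k \<theta> + (\<Sum>\<gamma>\<in>?A. expansion_term \<gamma> k \<theta>)"
      by (simp add: expansion_rem_def)
  qed
  show ?thesis
    unfolding eq
  proof (intro estimate_add estimate_sum smooth_torus_sum smooth_expansion_rem smooth_expansion_term N'(2))
    show "finite ?A" by (intro finite_Diff finite_mabs_less)
    fix \<gamma> assume "\<gamma> \<in> ?A"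
    then have "real N * (\<rho> - \<delta>) \<le> real (mabs \<gamma>) * (\<rho> - \<delta>)"
      using \<delta> by (intro mult_right_mono) auto
    then show "estimate ?t \<alpha> \<beta> (expansion_term \<gamma>)"
      by (intro estimate_mono[OF estimate_expansion_term]) (simp add: algebra_simps)
  qed
qed

lemma expansion_rem_symbol_class:
  "expansion_rem N \<in> symbol_class h (\<mu> - real N * (\<rho> - \<delta>)) \<rho> \<delta>"
  using estimate_expansion_rem smooth_expansion_rem
  unfolding symbol_class_def estimate_def by blast

lemma adj_symbol_class: "adj \<in> symbol_class h \<mu> \<rho> \<delta>"
proof -
  have "expansion_rem 0 = adj" by (simp add: expansion_rem_def fun_eq_iff)
  then show ?thesis using expansion_rem_symbol_class[of 0] by simp
qed

end

subsection \<open>The adjoint operator\<close>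

lemma summable_on_hlattice_decay:
  assumes h: "0 < h" "h \<le> 1"
  shows "(lattice_decay :: real ^ 'n \<Rightarrow> real) summable_on hlattice h"
proof -
  have inj: "inj_on (\<lambda>z :: real ^ 'n. h *\<^sub>R z) int_lattice"
    using h by (simp add: inj_on_def)
  have "(\<lambda>z :: real ^ 'n. lattice_decay (h *\<^sub>R z)) summable_on int_lattice"
  proof (rule summable_on_comparison_test[OF summable_on_cmult_right[OF summable_on_lattice_decay]])
    fix z :: "real ^ 'n"
    \<comment> \<open>Here \<open>h \<le> 1\<close> enters; the comparison with the integer lattice
      costs the factor h^(-2n).\<close>
    have "h * (1 + norm z) \<le> 1 + norm (h *\<^sub>R z)" using h by (simp add: distrib_left)
    then have "(h * (1 + norm z)) ^ (2 * CARD('n)) \<le> (1 + norm (h *\<^sub>R z)) ^ (2 * CARD('n))"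
      using h by (intro power_mono) auto
    then have "inverse ((1 + norm (h *\<^sub>R z)) ^ (2 * CARD('n))) \<le> inverse ((h * (1 + norm z)) ^ (2 * CARD('n)))"
      using h by (intro le_imp_inverse_le) (auto simp: add_pos_nonneg)
    then show "lattice_decay (h *\<^sub>R z) \<le> inverse (h ^ (2 * CARD('n))) * lattice_decay z"
      by (simp add: lattice_decay_def power_mult_distrib)
    show "0 \<le> lattice_decay (h *\<^sub>R z)" by (simp add: lattice_decay_def)
  qed
  then show ?thesis
    unfolding hlattice_def using summable_on_reindex[OF inj, of lattice_decay] by (simp add: o_def)
qed

lemma schwartz_summable:
  fixes f :: "real ^ 'n \<Rightarrow> complex"
  assumes h: "0 < h" "h \<le> 1" and f: "f \<in> schwartz h"
  shows "(\<lambda>k. norm (f k) * (1 + norm k) ^ p) summable_on hlattice h"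
proof -
  have "bdd_above ((\<lambda>k. (1 + norm k) ^ (p + 2 * CARD('n)) * norm (f k)) ` hlattice h)"
    using f by (simp add: schwartz_def)
  then obtain K where K: "\<And>k. k \<in> hlattice h \<Longrightarrow> (1 + norm k) ^ (p + 2 * CARD('n)) * norm (f k) \<le> K"
    by (auto simp: bdd_above_def)
  have "norm (f k) * (1 + norm k) ^ p \<le> K * lattice_decay k" if "k \<in> hlattice h" for k
  proof -
    have "(1 + norm k) ^ (2 * CARD('n)) > 0" by (simp add: add_pos_nonneg)
    then show ?thesis using K[OF that] by (simp add: lattice_decay_def power_add field_simps)
  qed
  then show ?thesis
    by (intro summable_on_comparison_test[OF summable_on_cmult_right[OF summable_on_hlattice_decay[OF h]]]) auto
qed

section \<open>The kernel of the quantization and the pairing with Schwartz functions\<close>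

lemma exp_tchar: "exp (2 * of_real pi * (\<i> / of_real h) * of_real (k \<bullet> \<theta>)) = tchar ((1 / h) *\<^sub>R k) \<theta>"
  by (simp add: tchar_def cis_conv_exp field_simps)

lemma hfourier_tchar:
  "hfourier h f \<theta> = (\<Sum>\<^sub>\<infinity>l\<in>hlattice h. tchar (- ((1 / h) *\<^sub>R l)) \<theta> * f l)"
  unfolding hfourier_def
  using exp_tchar[of h "- l" \<theta> for l] by simp

text \<open>Inserting the Fourier series of \<open>f\<close> and integrating termwise exhibits the
  operator as an infinite matrix; combining the characters of \<open>k\<close> and \<open>l\<close>
  leaves the coefficient of index (l - k) / h.\<close>

lemma hOp_eq:
  fixes \<tau> :: "real ^ 'n \<Rightarrow> real ^ 'n \<Rightarrow> complex"
  assumes h: "0 < h" "h \<le> 1" and f: "f \<in> schwartz h" and \<tau>: "torus_fun (\<tau> k)"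
  shows "hOp h \<tau> f k = (\<Sum>\<^sub>\<infinity>l\<in>hlattice h. f l * tcoef (\<tau> k) ((1 / h) *\<^sub>R (l - k)))"
proof -
  have fs: "(\<lambda>l. norm (f l)) summable_on hlattice h"
    using schwartz_summable[OF h f, of 0] by simp
  let ?F = "\<lambda>l \<theta>. f l * (\<tau> k \<theta> * tchar (- ((1 / h) *\<^sub>R (l - k))) \<theta>)"
  have "bounded (\<tau> k ` cbox 0 1)"
    by (intro compact_imp_bounded compact_continuous_image torus_funD[OF \<tau>] compact_cbox)
  then obtain B where B: "\<And>\<theta>. \<theta> \<in> cbox 0 1 \<Longrightarrow> norm (\<tau> k \<theta>) \<le> B"
    unfolding bounded_iff by blast
  have "((\<lambda>l. integral (cbox 0 1) (?F l)) has_sum integral (cbox 0 1) (\<lambda>\<theta>. \<Sum>\<^sub>\<infinity>l\<in>hlattice h. ?F l \<theta>)) (hlattice h)"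
  proof (rule has_sum_integral)
    show "continuous_on (cbox 0 1) (?F l)" for l
      by (intro continuous_intros torus_funD[OF \<tau>])
    show "(\<lambda>l. norm (f l) * B) summable_on hlattice h"
      by (rule summable_on_cmult_left[OF fs])
  qed (auto simp: norm_mult intro!: mult_left_mono B)
  then have 1: "(\<Sum>\<^sub>\<infinity>l\<in>hlattice h. integral (cbox 0 1) (?F l)) = integral (cbox 0 1) (\<lambda>\<theta>. \<Sum>\<^sub>\<infinity>l\<in>hlattice h. ?F l \<theta>)"
    by (rule infsumI)
  have 2: "integral (cbox 0 1) (?F l) = f l * tcoef (\<tau> k) ((1 / h) *\<^sub>R (l - k))" for l
    by (simp add: tcoef_def)
  have eq: "exp (2 * of_real pi * (\<i> / of_real h) * of_real (k \<bullet> \<theta>)) * \<tau> k \<theta> * hfourier h f \<theta>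
      = (\<Sum>\<^sub>\<infinity>l\<in>hlattice h. ?F l \<theta>)" for \<theta>
  proof -
    have "tchar (- ((1 / h) *\<^sub>R (l - k))) \<theta> = tchar ((1 / h) *\<^sub>R k) \<theta> * tchar (- ((1 / h) *\<^sub>R l)) \<theta>" for l
      by (simp add: tchar_add[symmetric] scaleR_diff_right)
    then have "?F l \<theta> = (tchar ((1 / h) *\<^sub>R k) \<theta> * \<tau> k \<theta>) * (tchar (- ((1 / h) *\<^sub>R l)) \<theta> * f l)" for l
      by (simp add: mult_ac)
    then show ?thesis
      unfolding exp_tchar hfourier_tchar by (simp only: infsum_cmult_right')
  qed
  \<comment> \<open>Lebesgue and gauge integral agree because the sum is continuous on the cube, as
    a uniform limit by the Weierstrass test.\<close>
  have "(LINT \<theta>:cbox 0 1|lborel. \<Sum>\<^sub>\<infinity>l\<in>hlattice h. ?F l \<theta>) = integral (cbox 0 1) (\<lambda>\<theta>. \<Sum>\<^sub>\<infinity>l\<in>hlattice h. ?F l \<theta>)"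
  proof (rule set_borel_integral_eq_integral)
    have "uniform_limit (cbox 0 1) (\<lambda>X \<theta>. \<Sum>l\<in>X. ?F l \<theta>) (\<lambda>\<theta>. \<Sum>\<^sub>\<infinity>l\<in>hlattice h. ?F l \<theta>) (finite_subsets_at_top (hlattice h))"
      by (rule Weierstrass_m_test_general[OF _ summable_on_cmult_left[OF fs]])
        (auto simp: norm_mult intro!: mult_left_mono B)
    then have "continuous_on (cbox 0 1) (\<lambda>\<theta>. \<Sum>\<^sub>\<infinity>l\<in>hlattice h. ?F l \<theta>)"
      by (rule uniform_limit_theorem[rotated])
        (auto intro!: always_eventually continuous_intros torus_funD[OF \<tau>])
    then show "set_integrable lborel (cbox 0 1) (\<lambda>\<theta>. \<Sum>\<^sub>\<infinity>l\<in>hlattice h. ?F l \<theta>)"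
      unfolding set_integrable_def by (intro borel_integrable_compact compact_cbox)
  qed
  then show ?thesis unfolding hOp_def eq 1[symmetric] 2 .
qed

lemma summable_on_product:
  fixes u :: "'a \<Rightarrow> real" and v :: "'b \<Rightarrow> real"
  assumes "u summable_on A" "v summable_on B" "\<And>x. u x \<ge> 0" "\<And>y. v y \<ge> 0"
  shows "(\<lambda>(x, y). u x * v y) summable_on A \<times> B"
proof -
  have "(\<lambda>z. norm (case z of (x, y) \<Rightarrow> u x * v y)) summable_on A \<times> B"
  proof (rule Infinite_Sum.abs_summable_on_Sigma_iff[THEN iffD2], intro conjI ballI)
    show "(\<lambda>y. norm (case (x, y) of (x, y) \<Rightarrow> u x * v y)) summable_on B" for x
      using assms by (simp add: summable_on_cmult_right abs_mult)
    have "(\<lambda>x. u x * infsum v B) summable_on A"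
      by (rule summable_on_cmult_left[OF assms(1)])
    then show "(\<lambda>x. norm (\<Sum>\<^sub>\<infinity>y\<in>B. norm (case (x, y) of (x, y) \<Rightarrow> u x * v y))) summable_on A"
      using assms by (simp add: abs_mult infsum_cmult_right' infsum_nonneg)
  qed
  then show ?thesis by (rule abs_summable_summable)
qed

context adjoint_symbol
begin

text \<open>The kernel grows at most polynomially in \<open>k\<close>, uniformly in
  \<open>l\<close>. The decay of \<open>g\<close> absorbs this growth and \<open>f\<close> is
  summable in \<open>l\<close>, so the double sum converges absolutely and its order may be
  exchanged.\<close>

lemma is_adjoint_adj: "is_adjoint h (hOp h \<sigma>) (hOp h adj)"
  unfolding is_adjoint_def
proof (intro ballI)
  fix f g :: "real ^ 'n::_ \<Rightarrow> complex" assume f: "f \<in> schwartz h" and g: "g \<in> schwartz h"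
  let ?L = "hlattice h :: (real ^ 'n::_) set"
  define K where "K k l = tcoef (\<sigma> k) ((1 / h) *\<^sub>R (l - k))" for k l
  define F where "F k l = f l * K k l * cnj (g k)" for k l
  have lat: "(1 / h) *\<^sub>R (l - k) \<in> int_lattice" if kl: "k \<in> ?L" "l \<in> ?L" for k l
  proof -
    obtain z w where "k = h *\<^sub>R z" "l = h *\<^sub>R w" "z \<in> int_lattice" "w \<in> int_lattice"
      using kl unfolding hlattice_def by blast
    then show ?thesis using h by (simp add: scaleR_diff_right[symmetric])
  qed
  have A: "hOp h \<sigma> f k = (\<Sum>\<^sub>\<infinity>l\<in>?L. f l * K k l)" if "k \<in> ?L" for k
    unfolding K_def using that by (intro hOp_eq h f smooth_torus_torus_fun smooth_\<sigma>)
  have B: "cnj (hOp h adj g l) = (\<Sum>\<^sub>\<infinity>k\<in>?L. K k l * cnj (g k))" if l: "l \<in> ?L" for l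
  proof -
    have "hOp h adj g l = (\<Sum>\<^sub>\<infinity>k\<in>?L. g k * tcoef (adj l) ((1 / h) *\<^sub>R (k - l)))"
      using l by (intro hOp_eq h g smooth_torus_torus_fun smooth_adj)
    also have "\<dots> = (\<Sum>\<^sub>\<infinity>k\<in>?L. g k * cnj (K k l))"
    proof (rule infsum_cong)
      fix k assume k: "k \<in> ?L"
      \<comment> \<open>With m = (k - l) / h the shifted base point l + h m is \<open>k\<close>, so
        the coefficients of \<open>adj l\<close> form the conjugate transpose of
        \<open>K\<close>.\<close>
      have "- ((1 / h) *\<^sub>R (k - l)) = (1 / h) *\<^sub>R (l - k)" by (simp add: scaleR_diff_right)
      then show "g k * tcoef (adj l) ((1 / h) *\<^sub>R (k - l)) = g k * cnj (K k l)"
        unfolding tcoef_adj[OF l lat[OF l k]] acoef_eq K_def using h by simp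
    qed
    finally show ?thesis by (simp add: mult.commute flip: infsum_cnj)
  qed
  obtain C where C: "C \<ge> 0" "\<And>k m. k \<in> ?L \<Longrightarrow> m \<in> int_lattice \<Longrightarrow> norm (acoef m k) \<le> C * (1 + norm k) powr \<mu>"
  proof -
    obtain C where "C \<ge> 0" "\<And>k m. k \<in> ?L \<Longrightarrow> m \<in> int_lattice \<Longrightarrow>
        norm (hDelta h (\<lambda>_. 0) (acoef m) k) * (1 + norm m) ^ 0
        \<le> C * (1 + norm k) powr (\<mu> - \<rho> * real (mabs (\<lambda>_ :: 'n. 0)) + \<delta> * real 0)"
      using coefficient_decay[of "\<lambda>_. 0" 0] by blast
    then show thesis by (intro that[of C]) auto
  qed
  \<comment> \<open>Schwartz seminorms have natural exponents, so \<open>\<mu>\<close> is rounded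
    up; for negative \<open>\<mu>\<close> this gives 0.\<close>
  define p where "p = nat \<lceil>\<mu>\<rceil>"
  have Kb: "norm (K k l) \<le> C * (1 + norm k) ^ p" if kl: "k \<in> ?L" "l \<in> ?L" for k l
  proof -
    have "norm (K k l) = norm (acoef (- ((1 / h) *\<^sub>R (l - k))) k)" by (simp add: acoef_eq K_def)
    also have "\<dots> \<le> C * (1 + norm k) powr \<mu>" using lat[OF kl] kl by (intro C) auto
    also have "\<dots> \<le> C * (1 + norm k) powr real p"
      unfolding p_def by (intro mult_left_mono powr_mono C) (linarith, simp)
    finally show ?thesis by (simp add: powr_realpow add_pos_nonneg)
  qed
  have s: "(\<lambda>(k, l). F k l) summable_on ?L \<times> ?L"
  proof (rule abs_summable_summable, rule Infinite_Sum.abs_summable_on_comparison_test')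
    show "(\<lambda>(k, l). (C * (norm (g k) * (1 + norm k) ^ p)) * norm (f l)) summable_on ?L \<times> ?L"
      using C schwartz_summable[OF h f, of 0]
      by (intro summable_on_product summable_on_cmult_right schwartz_summable h g) auto
    fix x assume "x \<in> ?L \<times> ?L"
    then obtain k l where x: "x = (k, l)" "k \<in> ?L" "l \<in> ?L" by auto
    have "norm (K k l) * (norm (f l) * norm (g k)) \<le> C * (1 + norm k) ^ p * (norm (f l) * norm (g k))"
      by (intro mult_right_mono Kb x) simp
    then show "norm (case x of (k, l) \<Rightarrow> F k l)
        \<le> (case x of (k, l) \<Rightarrow> (C * (norm (g k) * (1 + norm k) ^ p)) * norm (f l))"
      by (simp add: x F_def norm_mult mult_ac)
  qed
  then have s': "(\<lambda>(l, k). F k l) summable_on ?L \<times> ?L"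
    by (subst (asm) summable_on_swap) (simp add: case_prod_unfold)
  have 1: "hOp h \<sigma> f k * cnj (g k) = (\<Sum>\<^sub>\<infinity>l\<in>?L. F k l)" if "k \<in> ?L" for k
    unfolding F_def A[OF that] by (rule infsum_cmult_left'[symmetric])
  have 2: "f l * cnj (hOp h adj g l) = (\<Sum>\<^sub>\<infinity>k\<in>?L. F k l)" if "l \<in> ?L" for l
    unfolding F_def B[OF that] by (simp add: infsum_cmult_right'[symmetric] mult.assoc)
  show "(\<lambda>k. hOp h \<sigma> f k * cnj (g k)) summable_on ?L \<and>
      (\<lambda>k. f k * cnj (hOp h adj g k)) summable_on ?L \<and>
      hinner h (hOp h \<sigma> f) g = hinner h f (hOp h adj g)"
  proof (intro conjI)
    show "(\<lambda>k. hOp h \<sigma> f k * cnj (g k)) summable_on ?L"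
      using summable_on_Sigma_banach[OF s] by (simp add: 1 cong: summable_on_cong)
    show "(\<lambda>l. f l * cnj (hOp h adj g l)) summable_on ?L"
      using summable_on_Sigma_banach[OF s'] by (simp add: 2 cong: summable_on_cong)
    have "hinner h (hOp h \<sigma> f) g = (\<Sum>\<^sub>\<infinity>k\<in>?L. \<Sum>\<^sub>\<infinity>l\<in>?L. F k l)"
      unfolding hinner_def by (intro infsum_cong 1)
    also have "\<dots> = (\<Sum>\<^sub>\<infinity>l\<in>?L. \<Sum>\<^sub>\<infinity>k\<in>?L. F k l)"
      by (rule infsum_swap_banach[OF s])
    also have "\<dots> = hinner h f (hOp h adj g)"
      unfolding hinner_def by (intro infsum_cong 2[symmetric])
    finally show "hinner h (hOp h \<sigma> f) g = hinner h f (hOp h adj g)" .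
  qed
qed

end

theorem theorem4p2:
  fixes h \<mu> \<rho> \<delta> :: real
    and \<sigma> :: "real ^ 'n::{finite,linorder} \<Rightarrow> real ^ 'n::_ \<Rightarrow> complex"
  assumes "0 < h" and "h \<le> 1"
    and "0 \<le> \<delta>" and "\<delta> < \<rho>" and "\<rho> \<le> 1"
    and "\<sigma> \<in> symbol_class h \<mu> \<rho> \<delta>"
  shows "\<exists>\<sigma>'. \<sigma>' \<in> symbol_class h \<mu> \<rho> \<delta> \<and>
    is_adjoint h (hOp h \<sigma>) (hOp h \<sigma>') \<and>
    (\<forall>N::nat.
      (\<lambda>k \<theta>. \<sigma>' k \<theta> - (\<Sum>\<alpha> | mabs \<alpha> < N.
         1 / of_nat (mfact \<alpha>) *
         hDelta h \<alpha> (\<lambda>k'. torus_D h \<alpha> (\<lambda>\<theta>'. cnj (\<sigma> k' \<theta>')) \<theta>) k))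
      \<in> symbol_class h (\<mu> - real N * (\<rho> - \<delta>)) \<rho> \<delta>)"
proof -
  interpret adjoint_symbol h \<mu> \<rho> \<delta> \<sigma>
    using assms by unfold_locales
  show ?thesis
    using adj_symbol_class is_adjoint_adj expansion_rem_symbol_class
    unfolding expansion_rem_def[abs_def] expansion_term_def by blast
qed

end
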